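(* Let $d\ge1$, let $\sigma\in S_d$ be a $d$-cycle, and let $F(X)=X^d-1$. Let $\alpha>1$ be such that $$|P_{\alpha,F}(x)|\ge(\log x)^{\alpha-o(1)}\quad\text{as }x\to\infty.$$ Then $$\sum_{n<x}L_d^\sigma(n)\ge x^{d+1-\alpha^{-1}-o(1)}\quad\text{as }x\to\infty,$$ where the sum is over odd composite integers $n<x$.
   Context: $M(x)$ denotes the least common multiple of all positive integers up to $\frac{\log x}{\log\log x}$. For $F\in\mathbb{Z}[X]$, $P_{\alpha,F}(x)$ is the set of primes $p<(\log x)^\alpha$ such that $F(p)\mid M(x)$. The notation $o(1)$ stands for a function of $x$ tending to $0$ as $x\to\infty$. For monic polynomials $g_1,g_2$ over $\mathbb{Z}/n\mathbb{Z}$, $\operatorname{gcmd}_n(g_1,g_2)$ is the monic polynomial generating the ideal $(g_1,g_2)$ of $(\mathbb{Z}/n\mathbb{Z})[x]$, if it exists. Let $n>1$ be odd and $f$ monic of degree $d$ over $\mathbb{Z}/n\mathbb{Z}$ with $\gcd(n,f(0)\Delta_f)=1$ ($\Delta_f$ the discriminant). Factorization step: put $f_0=f$, and for $i\ge1$ let $F_i=\operatorname{gcmd}_n(x^{n^i}-x,f_{i-1})$, $f_i=f_{i-1}/F_i$; the pair $(f,n)$ passes if all these gcmd's exist and $f_d=1$. Then the cycle structure of $(f,n)$ is $(\deg F_1/1,\ldots,\deg F_d/d)$, identified with the conjugacy class in $S_d$ having $\deg F_i/i$ cycles of length $i$. Frobenius step: $F_i(x^n)\equiv0\pmod{(n,F_i(x))}$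 for $2\le i\le d$. Jacobi step: $(-1)^S=\left(\frac{\Delta_f}{n}\right)$ with $S=\sum_{2\mid i}\deg(F_i)/i$. $(f,n)$ is a Frobenius pseudoprime if it passes all three steps. $L_d^\sigma(n)$ is the number of monic polynomials $f$ modulo $n$ of degree $d$ such that $(f,n)$ is a Frobenius pseudoprime with cycle structure that of $\sigma$. *)

theory Defs
  imports
    "HOL-Analysis.Analysis"
    "HOL-Combinatorics.Orbits"
    "HOL-Number_Theory.Number_Theory"
    "Subresultants.Resultant_Prelim"
    "Berlekamp_Zassenhaus.Poly_Mod"
begin

text \<open>
  The ring \<open>(\<int>/n\<int>)[x]\<close> is represented as in the theory \<open>Poly_Mod\<close>: its elements are the
  integer polynomials with all coefficients in \<open>{0..<n}\<close>, i.e. those with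
  \<open>poly_mod.Mp n f = f\<close>; equality modulo \<open>n\<close> is \<open>poly_mod.eq_m n\<close> and divisibility modulo \<open>n\<close>
  is \<open>poly_mod.dvdm n\<close>. For \<open>n > 1\<close>, the degree and leading coefficient of a reduced
  polynomial are those of the polynomial modulo \<open>n\<close>.
\<close>

definition poly_mod_carrier :: "nat \<Rightarrow> int poly set" where
  "poly_mod_carrier n = {f. poly_mod.Mp (int n) f = f}"

definition ideal_mod :: "nat \<Rightarrow> int poly \<Rightarrow> int poly \<Rightarrow> int poly set" where
  "ideal_mod n g1 g2 =
     {h \<in> poly_mod_carrier n. \<exists>a b. poly_mod.eq_m (int n) h (a * g1 + b * g2)}"

definition principal_ideal_mod :: "nat \<Rightarrow> int poly \<Rightarrow> int poly set" where
  "principal_ideal_mod n g =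
     {h \<in> poly_mod_carrier n. \<exists>a. poly_mod.eq_m (int n) h (a * g)}"

text \<open>
  \<open>is_gcmd n g1 g2 h\<close>: \<open>gcmd\<^sub>n(g1, g2)\<close> exists and equals \<open>h\<close>. For \<open>n > 1\<close> there is at most
  one such \<open>h\<close>, because two monic generators of the same ideal divide each other.
\<close>

definition is_gcmd :: "nat \<Rightarrow> int poly \<Rightarrow> int poly \<Rightarrow> int poly \<Rightarrow> bool" where
  "is_gcmd n g1 g2 h \<longleftrightarrow>
     h \<in> poly_mod_carrier n \<and> monic h \<and> principal_ideal_mod n h = ideal_mod n g1 g2"

text \<open>
  Discriminant of a monic integer polynomial. It is an integer polynomial in the coefficients
  of \<open>f\<close>, hence for fixed degree its residue modulo \<open>n\<close> depends only on \<open>f\<close> modulo \<open>n\<close>.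
\<close>

definition monic_discriminant :: "int poly \<Rightarrow> int" where
  "monic_discriminant f =
     (-1) ^ (Polynomial.degree f * (Polynomial.degree f - 1) div 2) * resultant f (pderiv f)"

definition Jacobi :: "int \<Rightarrow> nat \<Rightarrow> int" where
  "Jacobi a n = (\<Prod>p\<in>#prime_factorization n. Legendre a (int p))"

text \<open>
  The sequence \<open>g\<close> is \<open>f\<^sub>0, f\<^sub>1, \<dots>, f\<^sub>d\<close>. As \<open>F i\<close> is monic, \<open>g i\<close> is the unique quotient
  of \<open>g (i - 1)\<close> by \<open>F i\<close> modulo \<open>n\<close>. Only the values \<open>F 1, \<dots>, F d\<close> matter here and below.
\<close>

definition factorization_step :: "nat \<Rightarrow> int poly \<Rightarrow> (nat \<Rightarrow> int poly) \<Rightarrow> bool" where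
  "factorization_step n f F \<longleftrightarrow>
     (\<exists>g. g 0 = f \<and>
          (\<forall>i\<in>{1..Polynomial.degree f}.
             is_gcmd n (Polynomial.monom 1 (n ^ i) - Polynomial.monom 1 1) (g (i - 1)) (F i) \<and>
             g i \<in> poly_mod_carrier n \<and>
             poly_mod.eq_m (int n) (g (i - 1)) (F i * g i)) \<and>
          g (Polynomial.degree f) = 1)"

definition frobenius_step :: "nat \<Rightarrow> int poly \<Rightarrow> (nat \<Rightarrow> int poly) \<Rightarrow> bool" where
  "frobenius_step n f F \<longleftrightarrow>
     (\<forall>i\<in>{2..Polynomial.degree f}.
        poly_mod.dvdm (int n) (F i) (pcompose (F i) (Polynomial.monom 1 n)))"

text \<open>
  Number of cycles of length \<open>i\<close> in the cycle structure. The division is exact whenever the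
  factorization and Frobenius steps are passed: modulo a prime divisor of \<open>n\<close>, the map
  \<open>x \<mapsto> x\<^sup>n\<close> then permutes the (distinct) roots of \<open>F i\<close> in cycles of length \<open>i\<close>.
\<close>

definition cycle_structure :: "(nat \<Rightarrow> int poly) \<Rightarrow> nat \<Rightarrow> nat" where
  "cycle_structure F i = Polynomial.degree (F i) div i"

definition jacobi_step :: "nat \<Rightarrow> int poly \<Rightarrow> (nat \<Rightarrow> int poly) \<Rightarrow> bool" where
  "jacobi_step n f F \<longleftrightarrow>
     (-1) ^ (\<Sum>i | i \<in> {1..Polynomial.degree f} \<and> even i. cycle_structure F i) =
       Jacobi (monic_discriminant f) n"

text \<open>\<open>F\<close> is the sequence of factors computed in the factorization step, determined by \<open>f\<close> and \<open>n\<close>.\<close>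

definition frobenius_pseudoprime :: "nat \<Rightarrow> int poly \<Rightarrow> (nat \<Rightarrow> int poly) \<Rightarrow> bool" where
  "frobenius_pseudoprime n f F \<longleftrightarrow>
     n > 1 \<and> odd n \<and> f \<in> poly_mod_carrier n \<and> monic f \<and>
     coprime (int n) (poly f 0 * monic_discriminant f) \<and>
     factorization_step n f F \<and> frobenius_step n f F \<and> jacobi_step n f F"

definition perm_cycle_count :: "nat \<Rightarrow> (nat \<Rightarrow> nat) \<Rightarrow> nat \<Rightarrow> nat" where
  "perm_cycle_count d \<sigma> i = card {C \<in> orbit \<sigma> ` {1..d}. card C = i}"

definition L_count :: "nat \<Rightarrow> (nat \<Rightarrow> nat) \<Rightarrow> nat \<Rightarrow> nat" where
  "L_count d \<sigma> n =
     card {f. Polynomial.degree f = d \<and>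
              (\<exists>F. frobenius_pseudoprime n f F \<and>
                   (\<forall>i\<in>{1..d}. cycle_structure F i = perm_cycle_count d \<sigma> i))}"

definition lcm_upto :: "real \<Rightarrow> nat" where
  "lcm_upto x = Lcm {k::nat. 1 \<le> k \<and> real k \<le> ln x / ln (ln x)}"

definition prime_set :: "real \<Rightarrow> int poly \<Rightarrow> real \<Rightarrow> nat set" where
  "prime_set \<alpha> F x =
     {p. prime p \<and> real p < ln x powr \<alpha> \<and> poly F (int p) dvd int (lcm_upto x)}"

end

theory Submission
  imports Defs "Jordan_Normal_Form.Char_Poly" "HOL-Real_Asymp.Real_Asymp"
begin

text \<open>
  For a set \<open>A\<close> of \<open>k \<approx> ln x / (\<alpha> ln (ln x))\<close> primes of \<open>prime_set \<alpha> F x\<close> consider \<open>N = r \<cdot> \<Prod>A \<cdot> q\<close>. Let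
  \<open>h p\<close> be the part of \<open>p\<^sup>d - 1\<close> free of small primes. If \<open>N \<equiv> p\<close> modulo \<open>h p\<close>, then \<open>N\<close>-th powers
  agree with the Frobenius map on the elements of order dividing \<open>h p\<close> of the field with \<open>p\<^sup>d\<close>
  elements, so their minimal polynomials of degree \<open>d\<close>, about \<open>p\<^sup>d / d\<close> up to a factor \<open>p\<^sup>o\<^sup>(\<^sup>1\<^sup>)\<close>, pass the
  test modulo \<open>p\<close>; the Chinese remainder theorem combines the polynomials modulo the factors of \<open>N\<close>.

  Since \<open>p\<close> is a \<open>d\<close>-th root of unity modulo each prime factor of \<open>h p\<close>, a pigeonhole argument gives
  one residue \<open>c\<close> with \<open>c \<equiv> p\<close> modulo \<open>h p\<close> for many \<open>p\<close>, and it suffices that \<open>N \<equiv> c\<close> modulo the least common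
  multiple \<open>M = x\<^sup>o\<^sup>(\<^sup>1\<^sup>)\<close> of the \<open>h p\<close>. This is achieved by \<open>q\<close>: fix primes \<open>r\<close>, \<open>s\<close> such that \<open>r\<close> has order
  \<open>d\<close> modulo \<open>s\<close>. A product \<open>q\<close> of values of the form \<open>(a\<^sup>s - b\<^sup>s) / (a - b)\<close> can be found in any residue class
  prime to \<open>M\<close>, with \<open>q = x\<^sup>o\<^sup>(\<^sup>1\<^sup>)\<close>. Its prime factors are \<open>1\<close> modulo \<open>s\<close>, so there is a primitive \<open>s\<close>-th root
  of unity \<open>z\<close> modulo \<open>q\<close>, and the polynomial with roots \<open>z ^ (r ^ i)\<close>, \<open>i < d\<close>, passes modulo \<open>q\<close>.

  The sets \<open>A\<close> contribute \<open>x\<^sup>1\<^sup>-\<^sup>1\<^sup>/\<^sup>\<alpha>\<close> moduli and the polynomials a factor \<open>x\<^sup>d\<close>, both up to \<open>x\<^sup>o\<^sup>(\<^sup>1\<^sup>)\<close>.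
\<close>

text \<open>The elements of \<open>A\<close> lie below (ln x)^\<alpha>, so the size k keeps their
  product below x, and the roughly ((ln x)^\<alpha> / k)^k choices of \<open>A\<close> give x^(1 -
  1/\<alpha>). The obstacle is that \<open>N\<close> must be p modulo \<open>h p\<close> for all p
  in \<open>A\<close> at once, although the numbers \<open>h p\<close> share prime factors; hence
  the common residue c. Removing small primes from p^d - 1 makes the pigeonhole loss, a factor d for
  each prime factor, a small power of ln x, and makes \<open>h p\<close> coprime to d, so that
  residues modulo its primes lift to residues modulo \<open>h p\<close>. The factor r serves the
  Jacobi step: each prime of \<open>A\<close>, and r itself, contributes the sign (-1)^(d - 1),
  while q contributes 1; with k even the total is (-1)^(d - 1), as a d-cycle demands. As q is at
  most x^o(1), only that many sets \<open>A\<close> can share one \<open>N\<close>. Prime ideals of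
  Z[X] above p replace the field with p^d elements: roots become congruence classes, and the same
  lemmas serve the integers modulo q.\<close>

hide_const (open) up_ring.coeff up_ring.monom module.smult comm_monoid_mult_class.coprime
alias coprime = algebraic_semidom_class.coprime

section \<open>Congruences modulo an ideal\<close>

lemma poly_altdef':
  fixes z :: "'a :: comm_semiring_1"
  shows "degree r \<le> n \<Longrightarrow> poly r z = (\<Sum>k\<le>n. coeff r k * z ^ k)"
  unfolding poly_altdef by (intro sum.mono_neutral_left) (auto intro: le_degree)

text \<open>Ideals are sets with a congruence, without quotient rings. The instances are mZ, the
  zero ideal of a domain, prime ideals of Z[X] above p, and extensions \<open>poly_ideal I\<close>;
  the arguments about roots are thus shared by all moduli.\<close>

locale ring_ideal =
  fixes I :: "'a :: comm_ring_1 set"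
  assumes zero_mem: "0 \<in> I"
    and add_mem: "a \<in> I \<Longrightarrow> b \<in> I \<Longrightarrow> a + b \<in> I"
    and mult_mem: "a \<in> I \<Longrightarrow> r * a \<in> I"
begin

definition eqv :: "'a \<Rightarrow> 'a \<Rightarrow> bool" (infix \<open>\<simeq>\<close> 50) where
  "a \<simeq> b \<longleftrightarrow> a - b \<in> I"

lemma minus_mem: "a \<in> I \<Longrightarrow> - a \<in> I"
  using mult_mem[of a "-1"] by simp

lemma diff_mem: "a \<in> I \<Longrightarrow> b \<in> I \<Longrightarrow> a - b \<in> I"
  using add_mem[of a "- b"] minus_mem[of b] by simp

lemma mult_mem': "a \<in> I \<Longrightarrow> a * r \<in> I"
  using mult_mem[of a r] by (simp add: mult.commute)

lemma sum_mem: "(\<And>x. x \<in> A \<Longrightarrow> f x \<in> I) \<Longrightarrow> (\<Sum>x\<in>A. f x) \<in> I"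
  by (induction A rule: infinite_finite_induct) (auto simp: zero_mem intro!: add_mem)

lemma eqv_refl [simp]: "a \<simeq> a"
  by (simp add: eqv_def zero_mem)

lemma eqv_sym: "a \<simeq> b \<Longrightarrow> b \<simeq> a"
  using minus_mem[of "a - b"] by (simp add: eqv_def)

lemma eqv_trans [trans]: "a \<simeq> b \<Longrightarrow> b \<simeq> c \<Longrightarrow> a \<simeq> c"
  using add_mem[of "a - b" "b - c"] by (simp add: eqv_def)

lemma eqv_add: "a \<simeq> b \<Longrightarrow> c \<simeq> d \<Longrightarrow> a + c \<simeq> b + d"
  using add_mem[of "a - b" "c - d"] by (simp add: eqv_def algebra_simps)

lemma eqv_diff: "a \<simeq> b \<Longrightarrow> c \<simeq> d \<Longrightarrow> a - c \<simeq> b - d"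
  using diff_mem[of "a - b" "c - d"] by (simp add: eqv_def algebra_simps)

lemma eqv_mult: "a \<simeq> b \<Longrightarrow> c \<simeq> d \<Longrightarrow> a * c \<simeq> b * d"
  using add_mem[OF mult_mem'[of "a - b" c] mult_mem[of "c - d" b]]
  by (simp add: eqv_def algebra_simps)

lemma eqv_power: "a \<simeq> b \<Longrightarrow> a ^ n \<simeq> b ^ n"
  by (induction n) (auto intro: eqv_mult)

lemma eqv_sum: "(\<And>x. x \<in> A \<Longrightarrow> f x \<simeq> g x) \<Longrightarrow> (\<Sum>x\<in>A. f x) \<simeq> (\<Sum>x\<in>A. g x)"
  by (induction A rule: infinite_finite_induct) (auto intro: eqv_add)

lemma eqv_prod: "(\<And>x. x \<in> A \<Longrightarrow> f x \<simeq> g x) \<Longrightarrow> (\<Prod>x\<in>A. f x) \<simeq> (\<Prod>x\<in>A. g x)"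
  by (induction A rule: infinite_finite_induct) (auto intro: eqv_mult)

lemma eqv_0_iff: "a \<simeq> 0 \<longleftrightarrow> a \<in> I"
  by (simp add: eqv_def)

lemma mem_eqv: "a \<simeq> b \<Longrightarrow> a \<in> I \<longleftrightarrow> b \<in> I"
  by (meson eqv_0_iff eqv_sym eqv_trans)

lemma eqv_poly: "(\<And>k. coeff p k \<simeq> coeff q k) \<Longrightarrow> x \<simeq> y \<Longrightarrow> poly p x \<simeq> poly q y"
proof -
  assume coeffs: "\<And>k. coeff p k \<simeq> coeff q k" and xy: "x \<simeq> y"
  define n where "n = max (degree p) (degree q)"
  have "poly r z = (\<Sum>k\<le>n. coeff r k * z ^ k)" if "degree r \<le> n" for r :: "'a poly" and z
    by (rule poly_altdef'[OF that])
  then have "poly p x = (\<Sum>k\<le>n. coeff p k * x ^ k)" "poly q y = (\<Sum>k\<le>n. coeff q k * y ^ k)"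
    by (simp_all add: n_def)
  then show ?thesis
    using coeffs xy by (auto intro!: eqv_sum eqv_mult eqv_power)
qed

lemma freshman_sum:
  assumes "prime p" and p: "of_nat p \<in> I"
  shows "(\<Sum>x\<in>A. f x) ^ p \<simeq> (\<Sum>x\<in>A. f x ^ p)"
proof -
  have add: "(a + b) ^ p \<simeq> a ^ p + b ^ p" for a b
  proof -
    have "(a + b) ^ p = (\<Sum>k\<le>p. of_nat (p choose k) * a ^ k * b ^ (p - k))"
      by (rule binomial_ring)
    also have "{..p} = insert 0 (insert p {0<..<p})"
      by auto
    also have "(\<Sum>k\<in>\<dots>. of_nat (p choose k) * a ^ k * b ^ (p - k)) =
        b ^ p + (a ^ p + (\<Sum>k\<in>{0<..<p}. of_nat (p choose k) * a ^ k * b ^ (p - k)))"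
      using prime_gt_0_nat[OF assms(1)] by simp
    also have "\<dots> \<simeq> b ^ p + (a ^ p + (\<Sum>k\<in>{0<..<p}. 0))"
    proof (intro eqv_add eqv_sum eqv_refl)
      fix k assume "k \<in> {0<..<p}"
      then have "p dvd (p choose k)"
        using assms(1) by (intro dvd_choose_prime) auto
      then obtain c where "p choose k = p * c" ..
      then have "of_nat (p choose k) \<in> I"
        using mult_mem'[OF p, of "of_nat c"] by simp
      then show "of_nat (p choose k) * a ^ k * b ^ (p - k) \<simeq> 0"
        by (auto simp: eqv_0_iff intro: mult_mem')
    qed
    finally show ?thesis
      by (simp add: add.commute)
  qed
  show ?thesis
  proof (induction A rule: infinite_finite_induct)
    case (insert x A)
    have "(\<Sum>x\<in>insert x A. f x) ^ p = (f x + (\<Sum>x\<in>A. f x)) ^ p"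
      using insert by simp
    also have "\<dots> \<simeq> f x ^ p + (\<Sum>x\<in>A. f x) ^ p"
      by (rule add)
    also have "\<dots> \<simeq> f x ^ p + (\<Sum>x\<in>A. f x ^ p)"
      using insert by (intro eqv_add eqv_refl)
    finally show ?case
      using insert by simp
  qed (simp_all add: zero_power[OF prime_gt_0_nat[OF assms(1)]])
qed

lemma freshman_diff:
  assumes "prime p" and "of_nat p \<in> I"
  shows "(a - b) ^ p \<simeq> a ^ p - b ^ p"
proof -
  have "((a - b) + b) ^ p \<simeq> (a - b) ^ p + b ^ p"
    using freshman_sum[OF assms, of "\<lambda>i::nat. if i = 0 then a - b else b" "{0, 1}"] by simp
  then have "a ^ p - b ^ p \<simeq> ((a - b) ^ p + b ^ p) - b ^ p"
    by (intro eqv_diff) auto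
  then show ?thesis
    by (auto intro: eqv_sym)
qed

text \<open>Lagrange's bound on the number of roots, by splitting off one linear factor at a time.
  Differences of roots need only be cancellable modulo \<open>I\<close>, so composite moduli are
  covered as well as prime ideals.\<close>

lemma coeffs_mem_of_roots:
  assumes "\<And>k. k \<ge> n \<Longrightarrow> coeff p k = 0"
    and "\<And>i. i < n \<Longrightarrow> poly p (\<beta> i) \<in> I"
    and "\<And>i j a. i < n \<Longrightarrow> j < n \<Longrightarrow> i \<noteq> j \<Longrightarrow> a * (\<beta> i - \<beta> j) \<in> I \<Longrightarrow> a \<in> I"
  shows "coeff p k \<in> I"
  using assms
proof (induction n arbitrary: p k)
  case 0
  then show ?case by (simp add: zero_mem)
next
  case (Suc n)
  define q where "q = synthetic_div p (\<beta> n)"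
  have p: "p = [:- \<beta> n, 1:] * q + [:poly p (\<beta> n):]"
    unfolding q_def by (rule synthetic_div_correct'[symmetric])
  have "degree p \<le> n"
    using Suc.prems(1) by (intro degree_le) auto
  have "coeff q k \<in> I" for k
  proof (rule Suc.IH)
    fix k assume "k \<ge> n"
    then show "coeff q k = 0"
    proof (cases "degree p = 0")
      case True
      then show ?thesis
        by (simp add: q_def synthetic_div_eq_0_iff[THEN iffD2])
    next
      case False
      then have "degree q < n"
        using \<open>degree p \<le> n\<close> by (simp add: q_def degree_synthetic_div)
      then show ?thesis
        using \<open>k \<ge> n\<close> by (intro coeff_eq_0) simp
    qed
  next
    fix i assume i: "i < n"
    have "poly p (\<beta> i) = (\<beta> i - \<beta> n) * poly q (\<beta> i) + poly p (\<beta> n)"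
      by (subst p) (simp add: algebra_simps)
    then have "poly q (\<beta> i) * (\<beta> i - \<beta> n) = poly p (\<beta> i) - poly p (\<beta> n)"
      by (simp add: algebra_simps)
    then have "poly q (\<beta> i) * (\<beta> i - \<beta> n) \<in> I"
      using Suc.prems(2)[of i] Suc.prems(2)[of n] i by (simp add: diff_mem)
    then show "poly q (\<beta> i) \<in> I"
      using Suc.prems(3)[of i n] i by simp
  next
    fix i j a assume "i < n" "j < n" "i \<noteq> j" "a * (\<beta> i - \<beta> j) \<in> I"
    then show "a \<in> I"
      using Suc.prems(3)[of i j a] by simp
  qed
  then have q: "coeff q k \<in> I" for k .
  have "coeff p k = coeff (pCons 0 q) k - \<beta> n * coeff q k + coeff [:poly p (\<beta> n):] k"
    by (subst p) (simp add: mult_pCons_left)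
  also have "\<dots> \<in> I"
    using q Suc.prems(2)[of n]
    by (intro add_mem diff_mem mult_mem) (auto simp: coeff_pCons zero_mem split: nat.splits)
  finally show ?case .
qed

end

text \<open>The extension of the ideal to polynomials; for \<open>I\<close> = mZ, membership of a
  difference means equality modulo m.\<close>

definition poly_ideal :: "'a :: comm_ring_1 set \<Rightarrow> 'a poly set" where
  "poly_ideal I = {p. \<forall>k. coeff p k \<in> I}"

lemma (in ring_ideal) ring_ideal_poly_ideal: "ring_ideal (poly_ideal I)"
  by standard (auto simp: poly_ideal_def zero_mem coeff_mult intro!: add_mem sum_mem mult_mem)

locale prime_ring_ideal = ring_ideal +
  assumes one_not_mem: "1 \<notin> I"
    and prime_mem: "a * b \<in> I \<Longrightarrow> a \<in> I \<or> b \<in> I"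
begin

lemma prod_mem_imp: "finite A \<Longrightarrow> (\<Prod>x\<in>A. f x) \<in> I \<Longrightarrow> \<exists>x\<in>A. f x \<in> I"
  by (induction A rule: finite_induct) (use one_not_mem prime_mem in auto)

lemma of_int_mem_iff:
  assumes "prime p" and "of_nat p \<in> I"
  shows "of_int c \<in> I \<longleftrightarrow> int p dvd c"
proof
  assume "int p dvd c"
  then obtain k where "c = int p * k" ..
  then show "of_int c \<in> I"
    using mult_mem'[OF assms(2), of "of_int k"] by simp
next
  assume c: "of_int c \<in> I"
  show "int p dvd c"
  proof (rule ccontr)
    assume "\<not> int p dvd c"
    then have "coprime (int p) c"
      using assms(1) by (simp add: prime_imp_coprime)
    moreover obtain u v where "u * int p + v * c = gcd (int p) c"
      using bezout_int by blast
    ultimately have "u * int p + v * c = 1"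
      by simp
    then have "of_int (u * int p + v * c) = (1::'a)"
      by simp
    then have "of_int u * of_nat p + of_int v * of_int c = (1::'a)"
      by simp
    then show False
      using add_mem[OF mult_mem[OF assms(2), of "of_int u"] mult_mem[OF c, of "of_int v"]]
        one_not_mem by simp
  qed
qed

text \<open>Otherwise 0, ..., p - 1 and \<open>a\<close> would be p + 1 incongruent roots of X^p -
  X.\<close>

lemma fixed_by_frobenius_imp_int:
  assumes p: "prime p" "of_nat p \<in> I" and a: "a ^ p \<simeq> a"
  shows "\<exists>c\<in>{0..<int p}. a \<simeq> of_int c"
proof (rule ccontr)
  assume no: "\<not> ?thesis"
  define \<beta> where "\<beta> i = (if i < p then of_nat i else a)" for i
  have int_pow: "of_nat i ^ p \<simeq> of_nat i" for i
    using freshman_sum[OF p, of "\<lambda>_. 1" "{..<i}"] by simp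
  have "coeff (monom 1 p - monom 1 1) p \<in> I"
  proof (rule coeffs_mem_of_roots[where n = "Suc p" and \<beta> = \<beta>])
    show "coeff (monom 1 p - monom 1 1) k = 0" if "k \<ge> Suc p" for k
      using that prime_gt_1_nat[OF p(1)] by simp
    show "poly (monom 1 p - monom 1 1) (\<beta> i) \<in> I" if "i < Suc p" for i
      using int_pow[of i] a by (simp add: \<beta>_def poly_monom eqv_def)
    show "x \<in> I" if ij: "i < Suc p" "j < Suc p" "i \<noteq> j" and x: "x * (\<beta> i - \<beta> j) \<in> I" for i j x
    proof -
      have "\<beta> i - \<beta> j \<notin> I"
      proof
        assume mem: "\<beta> i - \<beta> j \<in> I"
        consider "i < p" "j < p" | "i = p" "j < p" | "i < p" "j = p"
          using ij by linarith
        then show False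
        proof cases
          case 1
          then have "of_int (int i - int j) \<in> I"
            using mem by (simp add: \<beta>_def)
          then have "int p dvd int i - int j"
            using of_int_mem_iff[OF p] by blast
          then show False
            using 1 ij(3) by (metis mod_eq_dvd_iff mod_less of_nat_eq_iff zmod_int)
        next
          case 2
          then have "a \<simeq> of_int (int j)"
            using mem by (simp add: \<beta>_def eqv_def)
          then show False
            using no 2 atLeastLessThan_iff by (metis of_nat_0_le_iff of_nat_less_iff)
        next
          case 3
          then have "a \<simeq> of_int (int i)"
            using minus_mem[OF mem] by (simp add: \<beta>_def eqv_def)
          then show False
            using no 3 atLeastLessThan_iff by (metis of_nat_0_le_iff of_nat_less_iff)
        qed
      qed
      then show ?thesis
        using prime_mem[OF x] by blast
    qed
  qed
  then show False
    using one_not_mem prime_gt_1_nat[OF p(1)] by simp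
qed

end

section \<open>Resultants of products of linear factors\<close>

hide_const (open) Determinants.det

lemma prime_ring_ideal_zero: "prime_ring_ideal ({0} :: 'a :: idom set)"
  by standard auto

lemma degree_prod_linear:
  fixes \<beta> :: "nat \<Rightarrow> 'a :: idom"
  shows "degree (\<Prod>i<m. [:- \<beta> i, 1:]) = m" "lead_coeff (\<Prod>i<m. [:- \<beta> i, 1:] ) = 1"
proof -
  show deg: "degree (\<Prod>i<m. [:- \<beta> i, 1:]) = m"
    by (simp add: degree_prod_eq_sum_degree)
  have "lead_coeff (\<Prod>i<m. [:- \<beta> i, 1:]) = (\<Prod>i<m. lead_coeff [:- \<beta> i, 1:])"
    by (rule lead_coeff_prod)
  then show "lead_coeff (\<Prod>i<m. [:- \<beta> i, 1:]) = 1"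
    by simp
qed

text \<open>A kernel vector of the transpose would be the coefficient list of a nonzero polynomial
  of degree below \<open>m\<close> with \<open>m\<close> roots. The descending exponents match the
  layout of the Sylvester matrix.\<close>

lemma det_vandermonde_nonzero:
  fixes \<beta> :: "nat \<Rightarrow> 'a :: idom"
  assumes "inj_on \<beta> {..<m}"
  shows "det (mat m m (\<lambda>(i, j). \<beta> j ^ (m - 1 - i))) \<noteq> 0" (is "det ?E \<noteq> 0")
proof
  assume "det ?E = 0"
  then have "det (transpose_mat ?E) = 0"
    by (simp add: det_transpose[of _ m])
  then obtain v where v: "v \<in> carrier_vec m" "v \<noteq> 0\<^sub>v m" "transpose_mat ?E *\<^sub>v v = 0\<^sub>v m"
    using det_0_iff_vec_prod_zero[of "transpose_mat ?E" m] by auto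
  define p where "p = (\<Sum>i<m. monom (v $ i) (m - 1 - i))"
  interpret prime_ring_ideal "{0 :: 'a}"
    by (rule prime_ring_ideal_zero)
  have "coeff p k \<in> {0}" for k
  proof (rule coeffs_mem_of_roots[where n = m and \<beta> = \<beta>])
    show "coeff p k = 0" if "k \<ge> m" for k
      using that by (auto simp: p_def coeff_sum intro!: sum.neutral)
    show "poly p (\<beta> j) \<in> {0}" if j: "j < m" for j
    proof -
      have "poly p (\<beta> j) = (\<Sum>i<m. \<beta> j ^ (m - 1 - i) * v $ i)"
        by (simp add: p_def poly_sum poly_monom mult.commute)
      also have "\<dots> = (transpose_mat ?E *\<^sub>v v) $ j"
        using j v(1) by (simp add: scalar_prod_def atLeast0LessThan)
      also have "\<dots> = 0"
        using v(3) j by simp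
      finally show ?thesis by simp
    qed
    show "a \<in> {0}" if "i < m" "j < m" "i \<noteq> j" "a * (\<beta> i - \<beta> j) \<in> {0}" for i j a
      using that assms by (auto dest: inj_onD)
  qed
  then have "p = 0"
    by (simp add: poly_eq_iff)
  have "v $ i = 0" if i: "i < m" for i
  proof -
    have "coeff p (m - 1 - i) = (\<Sum>i'<m. if i' = i then v $ i else 0)"
      unfolding p_def coeff_sum using i by (intro sum.cong) auto
    also have "\<dots> = v $ i"
      using i by simp
    finally show ?thesis
      using \<open>p = 0\<close> by simp
  qed
  then show False
    using v(1,2) by auto
qed

text \<open>Multiplication by \<open>W\<close> evaluates the row polynomials of the Sylvester matrix
  at the roots. The rows coming from \<open>p\<close> vanish there, so the product is block
  triangular, and cancelling the Vandermonde determinant \<open>det E\<close> leaves the product of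
  the values of \<open>g\<close>.\<close>

lemma resultant_prod_linear:
  fixes \<beta> :: "nat \<Rightarrow> 'a :: idom"
  assumes "inj_on \<beta> {..<m}"
  shows "resultant (\<Prod>i<m. [:- \<beta> i, 1:]) g = (\<Prod>i<m. poly g (\<beta> i))"
proof -
  define p where "p = (\<Prod>i<m. [:- \<beta> i, 1:])"
  have p: "degree p = m" "coeff p m = 1"
    using degree_prod_linear[of \<beta> m] by (simp_all add: p_def)
  have root: "poly p (\<beta> j) = 0" if "j < m" for j
    using that by (auto simp: p_def poly_prod)
  define n where "n = degree g"
  define S where "S = sylvester_mat p g"
  have S: "S \<in> carrier_mat (m + n) (m + n)"
    using sylvester_carrier_mat[of p g] by (simp add: S_def p n_def)
  have S_index: "S $$ (i, j) = coeff (if i < n then monom 1 (n - 1 - i) * p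
        else monom 1 (m + n - 1 - i) * g) (m + n - 1 - j)"
    if ij: "i < m + n" "j < m + n" for i j
  proof -
    have *: "coeff (monom 1 (Suc k) * r) (Suc l) = coeff (monom 1 k * r) l" for k l and r :: "'a poly"
      by (simp add: coeff_monom_mult)
    have "S $$ (i, j) = (if i < n then coeff (monom 1 (n - i) * p) (m + n - j)
        else coeff (monom 1 (m + n - i) * g) (m + n - j))"
      unfolding S_def using ij by (subst sylvester_index_mat2) (auto simp: p n_def)
    moreover have "m + n - j = Suc (m + n - 1 - j)" "i < n \<Longrightarrow> n - i = Suc (n - 1 - i)"
      "m + n - i = Suc (m + n - 1 - i)"
      using ij by linarith+
    ultimately show ?thesis
      by (metis *)
  qed
  \<comment> \<open>The last \<open>m\<close> columns hold the powers of the roots; the first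
    \<open>n\<close> are unit vectors and copy the corresponding columns of
    \<open>S\<close>.\<close>
  define W where "W = mat (m + n) (m + n) (\<lambda>(i, j).
    if j < n then if i = j then 1 else 0 else \<beta> (j - n) ^ (m + n - 1 - i))"
  define E where "E = mat m m (\<lambda>(i, j). \<beta> j ^ (m - 1 - i))"
  define Q where "Q = mat m m (\<lambda>(i, j). \<beta> j ^ (m - 1 - i) * poly g (\<beta> j))"
  define T where "T = mat n n (\<lambda>(i, j). S $$ (i, j))"
  have "W = four_block_mat (1\<^sub>m n) (mat n m (\<lambda>(i, j). W $$ (i, j + n))) (0\<^sub>m m n) E"
    by (rule eq_matI) (auto simp: W_def E_def)
  then have det_W: "det W = det E"
    using det_four_block_mat_lower_left_zero[of "1\<^sub>m n" n "mat n m (\<lambda>(i, j). W $$ (i, j + n))" m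
        "0\<^sub>m m n" E]
    by (metis E_def det_one mat_carrier mult_1 one_carrier_mat)
  have SW_left: "(S * W) $$ (i, j) = S $$ (i, j)" if "i < m + n" "j < n" for i j
  proof -
    have "(S * W) $$ (i, j) = (\<Sum>k<m + n. S $$ (i, k) * W $$ (k, j))"
      using that S by (simp add: scalar_prod_def W_def atLeast0LessThan)
    also have "\<dots> = (\<Sum>k<m + n. if k = j then S $$ (i, j) else 0)"
      using that by (intro sum.cong) (auto simp: W_def)
    finally show ?thesis
      using that by simp
  qed
  have eval: "(\<Sum>k<m + n. coeff r (m + n - 1 - k) * x ^ (m + n - 1 - k)) = poly r x"
    if "r = 0 \<or> degree r < m + n" for r :: "'a poly" and x
  proof -
    have "(\<Sum>k<m + n. coeff r (m + n - 1 - k) * x ^ (m + n - 1 - k)) =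
        (\<Sum>k<m + n. coeff r k * x ^ k)"
      by (rule sum.reindex_bij_witness[of _ "\<lambda>k. m + n - 1 - k" "\<lambda>k. m + n - 1 - k"]) auto
    also have "\<dots> = poly r x"
    proof (cases "m + n")
      case (Suc N)
      then show ?thesis
        using that by (subst poly_altdef'[of _ N]) (auto simp: lessThan_Suc_atMost)
    qed (use that in auto)
    finally show ?thesis .
  qed
  have SW_right: "(S * W) $$ (i, j + n) = (if i < n then 0 else \<beta> j ^ (m + n - 1 - i) * poly g (\<beta> j))"
    if ij: "i < m + n" "j < m" for i j
  proof -
    define r where "r = (if i < n then monom 1 (n - 1 - i) * p else monom 1 (m + n - 1 - i) * g)"
    have "degree r < m + n \<or> r = 0"
    proof (cases "i < n")
      case True
      then have "degree r \<le> n - 1 - i + m"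
        unfolding r_def using degree_mult_le[of "monom 1 (n - 1 - i)" p] p
        by (simp add: degree_monom_eq)
      then show ?thesis
        using True by linarith
    next
      case False
      then have "degree r \<le> m + n - 1 - i + n"
        unfolding r_def using degree_mult_le[of "monom 1 (m + n - 1 - i)" g]
        by (simp add: degree_monom_eq n_def)
      then show ?thesis
        using False ij by linarith
    qed
    have "(S * W) $$ (i, j + n) = (\<Sum>k<m + n. S $$ (i, k) * W $$ (k, j + n))"
      using ij S by (simp add: scalar_prod_def W_def atLeast0LessThan)
    also have "\<dots> = (\<Sum>k<m + n. coeff r (m + n - 1 - k) * \<beta> j ^ (m + n - 1 - k))"
      using ij by (intro sum.cong) (auto simp: W_def S_index r_def)
    also have "\<dots> = poly r (\<beta> j)"
      using \<open>degree r < m + n \<or> r = 0\<close> by (intro eval) auto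
    also have "\<dots> = (if i < n then 0 else \<beta> j ^ (m + n - 1 - i) * poly g (\<beta> j))"
      using root[OF ij(2)] by (simp add: r_def poly_monom)
    finally show ?thesis .
  qed
  have SW: "S * W = four_block_mat T (0\<^sub>m n m) (mat m n (\<lambda>(i, j). S $$ (i + n, j))) Q"
  proof (rule eq_matI)
    fix i j assume "i < dim_row (four_block_mat T (0\<^sub>m n m) (mat m n (\<lambda>(i, j). S $$ (i + n, j))) Q)"
      and "j < dim_col (four_block_mat T (0\<^sub>m n m) (mat m n (\<lambda>(i, j). S $$ (i + n, j))) Q)"
    then have ij: "i < m + n" "j < m + n"
      by (auto simp: T_def Q_def)
    show "(S * W) $$ (i, j) = four_block_mat T (0\<^sub>m n m) (mat m n (\<lambda>(i, j). S $$ (i + n, j))) Q $$ (i, j)"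
    proof (cases "j < n")
      case True
      then show ?thesis
        using ij SW_left[of i j] by (auto simp: T_def Q_def)
    next
      case False
      then show ?thesis
        using ij SW_right[of i "j - n"] by (auto simp: T_def Q_def)
    qed
  qed (use S in \<open>auto simp: T_def Q_def W_def\<close>)
  have "det (S * W) = det T * det Q"
    unfolding SW by (rule det_four_block_mat_upper_right_zero) (auto simp: T_def Q_def)
  moreover have "det T = 1"
  proof -
    \<comment> \<open>Since \<open>p\<close> is monic of degree \<open>m\<close>, this makes
      \<open>T\<close> triangular with ones on the diagonal.\<close>
    have T: "T $$ (i, j) = coeff p (m + i - j)" if "i < n" "j < n" "j \<le> i" for i j
      using that by (simp add: T_def S_index coeff_monom_mult)
    have "upper_triangular T"
    proof
      fix i j assume "i < dim_row T" "j < i"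
      then show "T $$ (i, j) = 0"
        using T[of i j] p by (simp add: T_def coeff_eq_0)
    qed
    then have "det T = prod_list (diag_mat T)"
      by (rule det_upper_triangular[of _ n]) (simp add: T_def)
    also have "\<dots> = (\<Prod>i<n. T $$ (i, i))"
      by (simp add: prod_list_diag_prod T_def atLeast0LessThan)
    also have "\<dots> = 1"
      using T p by simp
    finally show ?thesis .
  qed
  moreover have "det Q = det E * (\<Prod>j<m. poly g (\<beta> j))"
  proof -
    define D where "D = mat m m (\<lambda>(i, j). if i = j then poly g (\<beta> j) else 0)"
    have "Q = E * D"
    proof (rule eq_matI)
      fix i j assume "i < dim_row (E * D)" "j < dim_col (E * D)"
      then have ij: "i < m" "j < m"
        by (auto simp: E_def D_def)
      then have "(E * D) $$ (i, j) = (\<Sum>k<m. E $$ (i, k) * D $$ (k, j))"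
        by (simp add: scalar_prod_def E_def D_def atLeast0LessThan)
      also have "\<dots> = (\<Sum>k<m. if k = j then Q $$ (i, j) else 0)"
        using ij by (intro sum.cong) (auto simp: E_def D_def Q_def)
      finally show "Q $$ (i, j) = (E * D) $$ (i, j)"
        using ij by simp
    qed (auto simp: Q_def E_def D_def)
    then have "det Q = det E * det D"
      using det_mult[of E m D] by (metis D_def E_def mat_carrier)
    moreover have "det D = prod_list (diag_mat D)"
      by (rule det_upper_triangular[of _ m]) (auto simp: D_def upper_triangular_def)
    then have "det D = (\<Prod>j<m. poly g (\<beta> j))"
      by (simp add: prod_list_diag_prod D_def atLeast0LessThan)
    ultimately show ?thesis
      by simp
  qed
  moreover have "det (S * W) = det S * det W"
    using S by (intro det_mult[of _ "m + n"]) (auto simp: W_def)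
  ultimately have "det S * det E = (\<Prod>j<m. poly g (\<beta> j)) * det E"
    by (simp add: det_W mult.commute)
  moreover have "det E \<noteq> 0"
    unfolding E_def using assms by (rule det_vandermonde_nonzero)
  ultimately show ?thesis
    by (simp add: S_def p_def resultant_def)
qed

lemma (in ring_ideal) det_eqv:
  assumes "A \<in> carrier_mat n n" and "B \<in> carrier_mat n n"
    and "\<And>i j. i < n \<Longrightarrow> j < n \<Longrightarrow> A $$ (i, j) \<simeq> B $$ (i, j)"
  shows "det A \<simeq> det B"
  unfolding det_def'[OF assms(1)] det_def'[OF assms(2)]
  using assms(3) by (intro eqv_sum eqv_mult eqv_prod eqv_refl) (auto dest: permutes_in_image)

text \<open>Equal degrees give the two Sylvester matrices the same shape, so that they can be
  compared entry by entry.\<close>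

lemma (in ring_ideal) resultant_eqv:
  assumes "degree p = degree p'" "degree q = degree q'"
    and "\<And>k. coeff p k \<simeq> coeff p' k" "\<And>k. coeff q k \<simeq> coeff q' k"
  shows "resultant p q \<simeq> resultant p' q'"
  unfolding resultant_def using assms
  by (intro det_eqv[of _ "degree p + degree q"])
    (auto simp: sylvester_mat_def sylvester_mat_sub_index)

text \<open>A square root of the discriminant. A cyclic shift of the roots changes it by a sign
  only, and this sign decides the Legendre symbol of the discriminant.\<close>

definition vandermonde_prod :: "nat \<Rightarrow> (nat \<Rightarrow> 'a :: comm_ring_1) \<Rightarrow> 'a" where
  "vandermonde_prod d \<beta> = (\<Prod>i<d. \<Prod>j<i. \<beta> j - \<beta> i)"

lemma vandermonde_prod_Suc:
  "vandermonde_prod (Suc k) \<beta> = vandermonde_prod k \<beta> * (\<Prod>j<k. \<beta> j - \<beta> k)"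
  by (simp add: vandermonde_prod_def)

lemma vandermonde_prod_Suc_shift:
  "vandermonde_prod (Suc k) \<beta> = (\<Prod>i<k. \<beta> 0 - \<beta> (Suc i)) * vandermonde_prod k (\<lambda>i. \<beta> (Suc i))"
  unfolding vandermonde_prod_def
  by (simp add: prod.lessThan_Suc_shift prod.distrib del: prod.lessThan_Suc)

lemma prod_diff_eq_vandermonde_prod:
  fixes \<beta> :: "nat \<Rightarrow> 'a :: comm_ring_1"
  shows "(\<Prod>i<d. \<Prod>j\<in>{..<d} - {i}. \<beta> i - \<beta> j) = (-1) ^ (d * (d - 1) div 2) * vandermonde_prod d \<beta> ^ 2"
proof (induction d)
  case 0
  then show ?case by (simp add: vandermonde_prod_def)
next
  case (Suc d)
  have "(\<Prod>i<Suc d. \<Prod>j\<in>{..<Suc d} - {i}. \<beta> i - \<beta> j) =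
      (\<Prod>i<d. \<Prod>j\<in>insert d ({..<d} - {i}). \<beta> i - \<beta> j) * (\<Prod>j<d. \<beta> d - \<beta> j)"
  proof -
    have "{..<Suc d} - {i} = insert d ({..<d} - {i})" if "i < d" for i
      using that by auto
    moreover have "{..<Suc d} - {d} = {..<d}"
      by auto
    ultimately show ?thesis
      by simp
  qed
  also have "\<dots> = (\<Prod>i<d. (\<beta> i - \<beta> d) * (\<Prod>j\<in>{..<d} - {i}. \<beta> i - \<beta> j)) * (\<Prod>j<d. (-1) * (\<beta> j - \<beta> d))"
    by simp
  also have "\<dots> = (-1) ^ d * (\<Prod>i<d. \<beta> i - \<beta> d) ^ 2 * (\<Prod>i<d. \<Prod>j\<in>{..<d} - {i}. \<beta> i - \<beta> j)"
    unfolding prod.distrib by (simp add: power2_eq_square ac_simps)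
  also have "\<dots> = (-1) ^ (d + d * (d - 1) div 2) * vandermonde_prod (Suc d) \<beta> ^ 2"
    by (simp add: Suc vandermonde_prod_Suc power_add power_mult_distrib ac_simps)
  also have "d + d * (d - 1) div 2 = Suc d * (Suc d - 1) div 2"
  proof -
    have "Suc d * d = d * 2 + d * (d - 1)"
      by (cases d) (auto simp: algebra_simps)
    then show ?thesis by simp
  qed
  finally show ?case .
qed

lemma resultant_pderiv_prod_linear:
  fixes \<beta> :: "nat \<Rightarrow> 'a :: idom"
  assumes "inj_on \<beta> {..<d}"
  defines "p \<equiv> \<Prod>i<d. [:- \<beta> i, 1:]"
  shows "(-1) ^ (d * (d - 1) div 2) * resultant p (pderiv p) = vandermonde_prod d \<beta> ^ 2"
proof -
  have "poly (pderiv p) (\<beta> i) = (\<Prod>j\<in>{..<d} - {i}. \<beta> i - \<beta> j)" if i: "i < d" for i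
  proof -
    have "poly (pderiv p) (\<beta> i) = (\<Sum>k<d. \<Prod>j\<in>{..<d} - {k}. \<beta> i - \<beta> j)"
      by (simp add: p_def pderiv_prod poly_sum poly_prod pderiv_pCons)
    also have "\<dots> = (\<Sum>k<d. if k = i then \<Prod>j\<in>{..<d} - {i}. \<beta> i - \<beta> j else 0)"
      using i by (intro sum.cong refl) (auto intro!: prod_zero)
    finally show ?thesis
      using i by simp
  qed
  then have "resultant p (pderiv p) = (-1) ^ (d * (d - 1) div 2) * vandermonde_prod d \<beta> ^ 2"
    unfolding p_def resultant_prod_linear[OF assms(1)] by (simp add: prod_diff_eq_vandermonde_prod)
  then show ?thesis
    by (simp flip: power_add mult.assoc)
qed

section \<open>Pseudoprimality from cyclically permuted roots\<close>

lemma ring_ideal_dvd: "ring_ideal {a :: int. m dvd a}"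
  by standard auto

text \<open>
  The first three conditions are the factorization and Frobenius steps with \<open>F\<^sub>d = f\<close> and \<open>F\<^sub>i = 1\<close> for
  \<open>i < d\<close>, which is the cycle structure of a \<open>d\<close>-cycle. The Jacobi step is kept separate, in \<open>good_polys\<close>
  below, because its sign depends on the prime factors of the modulus.
\<close>

definition pseudoprime_mod :: "nat \<Rightarrow> nat \<Rightarrow> int \<Rightarrow> int poly \<Rightarrow> bool" where
  "pseudoprime_mod N d m f \<longleftrightarrow>
     (\<exists>h. monom 1 (N ^ d) - monom 1 1 - f * h \<in> poly_ideal {a. m dvd a}) \<and>
     (\<forall>i\<in>{1..<d}. \<exists>a b. a * (monom 1 (N ^ i) - monom 1 1) + b * f - 1 \<in> poly_ideal {a. m dvd a}) \<and>
     (\<exists>h. pcompose f (monom 1 N) - f * h \<in> poly_ideal {a. m dvd a}) \<and>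
     coprime m (poly f 0 * monic_discriminant f)"

text \<open>The situation common to both kinds of moduli: \<open>w\<close> is a root of unity modulo
  \<open>I\<close>, and \<open>N\<close>-th powers act on it like \<open>b\<close>-th powers, so
  they permute the roots \<open>w ^ (b ^ i)\<close> cyclically. For a prime p, \<open>I\<close> lies
  above p, \<open>b\<close> is p and \<open>Suc e\<close> is p^d - 1; for the cofactor q,
  \<open>I\<close> is qZ and \<open>Suc e\<close> is the totient of q. Units are described by a
  power being 1, which is stable under products and passes down to the integers. The ring itself is
  a domain, so resultants can be computed there before reducing modulo \<open>I\<close>.\<close>

locale frobenius_roots = ring_ideal I for I :: "'a :: {idom, ring_char_0} set" +
  fixes w :: 'a and b wo d e N :: nat and m :: int and f :: "int poly"
  assumes of_int_mem_iff': "of_int a \<in> I \<longleftrightarrow> m dvd a"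
    and one_not_mem': "1 \<notin> I"
    and wo_pos: "wo > 0"
    and w_order: "w ^ wo \<simeq> 1"
    and b_order: "[b ^ d = 1] (mod wo)"
    and N_cong: "[N = b] (mod wo)"
    and d_pos: "d > 0"
    and diff_unit: "i < d \<Longrightarrow> j < d \<Longrightarrow> i \<noteq> j \<Longrightarrow> (w ^ (b ^ i) - w ^ (b ^ j)) ^ Suc e \<simeq> 1"
    and degree_f: "degree f = d"
    and monic_f: "monic f"
    and coeff_f: "of_int (coeff f k) \<simeq> coeff (\<Prod>i<d. [:- (w ^ (b ^ i)), 1:]) k"
begin

definition \<beta> :: "nat \<Rightarrow> 'a" where
  "\<beta> i = w ^ (b ^ i)"

definition P :: "'a poly" where
  "P = (\<Prod>i<d. [:- \<beta> i, 1:])"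

abbreviation ev :: "int poly \<Rightarrow> 'a \<Rightarrow> 'a" where
  "ev g x \<equiv> poly (of_int_poly g) x"

lemma coeff_f_P: "coeff (of_int_poly f) k \<simeq> coeff P k"
  using coeff_f[of k] by (simp add: P_def \<beta>_def)

lemma degree_P: "degree P = d" and monic_P: "monic P"
  using degree_prod_linear[of \<beta> d] by (simp_all add: P_def)

lemma w_power_cong: "[x = y] (mod wo) \<Longrightarrow> w ^ x \<simeq> w ^ y"
proof -
  have *: "w ^ z \<simeq> w ^ (z mod wo)" for z
  proof -
    have "w ^ z = (w ^ wo) ^ (z div wo) * w ^ (z mod wo)"
      by (metis div_mult_mod_eq mult.commute power_add power_mult)
    also have "\<dots> \<simeq> 1 ^ (z div wo) * w ^ (z mod wo)"
      by (intro eqv_mult eqv_power w_order eqv_refl)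
    finally show ?thesis by simp
  qed
  assume "[x = y] (mod wo)"
  then show ?thesis
    using *[of x] *[of y] by (metis cong_def eqv_sym eqv_trans)
qed

lemma \<beta>_power: "[k = b ^ j] (mod wo) \<Longrightarrow> \<beta> i ^ k \<simeq> \<beta> (i + j)"
  unfolding \<beta>_def
  by (simp add: w_power_cong cong_scalar_left power_add flip: power_mult)

lemma \<beta>_mod: "\<beta> i \<simeq> \<beta> (i mod d)"
proof -
  have "b ^ i = (b ^ d) ^ (i div d) * b ^ (i mod d)"
    by (metis div_mult_mod_eq mult.commute power_add power_mult)
  moreover have "[(b ^ d) ^ (i div d) * b ^ (i mod d) = 1 ^ (i div d) * b ^ (i mod d)] (mod wo)"
    by (intro cong_mult cong_pow b_order cong_refl)
  ultimately show ?thesis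
    unfolding \<beta>_def by (intro w_power_cong) simp
qed

lemma diff_unit_mod:
  assumes "i mod d \<noteq> j mod d"
  shows "(\<beta> i - \<beta> j) ^ Suc e \<simeq> 1"
proof -
  have "(\<beta> i - \<beta> j) ^ Suc e \<simeq> (\<beta> (i mod d) - \<beta> (j mod d)) ^ Suc e"
    by (intro eqv_power eqv_diff \<beta>_mod)
  also have "\<dots> \<simeq> 1"
    using assms d_pos diff_unit[of "i mod d" "j mod d"] by (simp add: \<beta>_def)
  finally show ?thesis .
qed

lemma regular_of_unit:
  assumes "u ^ Suc e \<simeq> 1" and "a * u \<in> I"
  shows "a \<in> I"
proof -
  have "a * u ^ Suc e \<in> I"
    using mult_mem'[OF assms(2), of "u ^ e"] by (simp add: mult.assoc)
  moreover have "a * u ^ Suc e \<simeq> a * 1"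
    by (intro eqv_mult eqv_refl assms(1))
  ultimately show ?thesis
    using mem_eqv by simp
qed

lemma inj_\<beta>: "inj_on \<beta> {..<d}"
proof
  fix i j assume "i \<in> {..<d}" "j \<in> {..<d}" "\<beta> i = \<beta> j"
  then show "i = j"
    using diff_unit[of i j] one_not_mem' minus_mem[of "-1"] by (auto simp: \<beta>_def eqv_def)
qed

lemma ev_root: "x \<simeq> \<beta> i \<Longrightarrow> ev f x \<in> I"
proof -
  assume "x \<simeq> \<beta> i"
  then have "x \<simeq> \<beta> (i mod d)"
    using \<beta>_mod eqv_trans by blast
  then have "ev f x \<simeq> poly P (\<beta> (i mod d))"
    by (intro eqv_poly coeff_f_P)
  moreover have "poly P (\<beta> (i mod d)) = 0"
    using d_pos by (auto simp: P_def poly_prod)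
  ultimately show ?thesis
    by (simp add: eqv_0_iff)
qed

text \<open>Division by the monic \<open>f\<close> leaves a remainder of degree below
  \<open>d\<close> that vanishes at the \<open>d\<close> roots modulo \<open>I\<close>. Its
  coefficients therefore lie in \<open>I\<close> and, being integers, are divisible by
  \<open>m\<close>.\<close>

lemma dvd_of_roots:
  assumes "\<And>i. i < d \<Longrightarrow> ev g (\<beta> i) \<in> I"
  shows "\<exists>h. g - f * h \<in> poly_ideal {a. m dvd a}"
proof -
  obtain h r where hr: "pseudo_divmod g f = (h, r)"
    by fastforce
  have f0: "f \<noteq> 0"
    using monic_f by auto
  have g: "g = f * h + r" and r: "r = 0 \<or> degree r < d"
    using pseudo_divmod[OF f0 hr] monic_f degree_f by auto
  have "coeff (of_int_poly r) k \<in> I" for k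
  proof (rule coeffs_mem_of_roots[where n = d and \<beta> = \<beta>])
    show "coeff (of_int_poly r :: 'a poly) k = 0" if "k \<ge> d" for k
      using r that by (auto simp: coeff_eq_0)
    show "ev r (\<beta> i) \<in> I" if i: "i < d" for i
    proof -
      have "ev r (\<beta> i) = ev g (\<beta> i) - ev f (\<beta> i) * ev h (\<beta> i)"
        by (simp add: g hom_distribs)
      then show ?thesis
        using assms[OF i] ev_root[of "\<beta> i" i] by (simp add: diff_mem mult_mem')
    qed
    show "a \<in> I" if "i < d" "j < d" "i \<noteq> j" "a * (\<beta> i - \<beta> j) \<in> I" for i j a
      using that regular_of_unit[OF diff_unit_mod[of i j]] by simp
  qed
  then have "r \<in> poly_ideal {a. m dvd a}"
    by (simp add: poly_ideal_def of_int_mem_iff')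
  then show ?thesis
    by (intro exI[of _ h]) (simp add: g)
qed

lemma ev_simps:
  "ev (g - h) x = ev g x - ev h x" "ev (monom 1 k) x = x ^ k" "ev (g ^ k) x = ev g x ^ k" "ev 1 x = 1"
  "ev (pcompose g h) x = ev g (ev h x)"
  by (simp_all add: hom_distribs poly_monom poly_pcompose)

lemma N_power_cong: "[N ^ i = b ^ i] (mod wo)"
  by (intro cong_pow N_cong)

lemma dvd_frobenius_d: "\<exists>h. monom 1 (N ^ d) - monom 1 1 - f * h \<in> poly_ideal {a. m dvd a}"
proof (rule dvd_of_roots)
  fix i assume "i < d"
  have "\<beta> i ^ (N ^ d) \<simeq> \<beta> (i + d)"
    by (rule \<beta>_power[OF N_power_cong])
  also have "\<dots> \<simeq> \<beta> i"
    by (metis \<beta>_mod eqv_sym eqv_trans mod_add_self2)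
  finally show "ev (monom 1 (N ^ d) - monom 1 1) (\<beta> i) \<in> I"
    unfolding ev_simps by (simp add: eqv_def)
qed

text \<open>X^(N^i) - X has unit values at all roots, since the shift by \<open>i\<close> has no
  fixed point. Its power with exponent \<open>Suc e\<close> is thus 1 modulo \<open>f\<close> and
  \<open>m\<close>, which is already a Bezout identity.\<close>

lemma bezout_frobenius:
  assumes i: "i \<in> {1..<d}"
  shows "\<exists>a b. a * (monom 1 (N ^ i) - monom 1 1) + b * f - 1 \<in> poly_ideal {a. m dvd a}"
proof -
  define g :: "int poly" where "g = monom 1 (N ^ i) - monom 1 1"
  have "\<exists>h. g ^ Suc e - 1 - f * h \<in> poly_ideal {a. m dvd a}"
  proof (rule dvd_of_roots)
    fix j assume j: "j < d"
    have neq: "(j + i) mod d \<noteq> j mod d"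
    proof
      assume "(j + i) mod d = j mod d"
      then have "[j + i = j + 0] (mod d)"
        by (simp add: cong_def)
      then have "[i = 0] (mod d)"
        using cong_add_lcancel_nat by blast
      then show False
        using i by (simp add: cong_def)
    qed
    have "ev g (\<beta> j) ^ Suc e \<simeq> (\<beta> (j + i) - \<beta> j) ^ Suc e"
      unfolding g_def ev_simps using \<beta>_power[OF N_power_cong]
      by (intro eqv_power eqv_diff) auto
    also have "\<dots> \<simeq> 1"
      by (rule diff_unit_mod[OF neq])
    finally show "ev (g ^ Suc e - 1) (\<beta> j) \<in> I"
      unfolding ev_simps by (simp add: eqv_def)
  qed
  then obtain h where "g ^ Suc e - 1 - f * h \<in> poly_ideal {a. m dvd a}" ..
  moreover have "g ^ Suc e - 1 - f * h = g ^ e * g + (- h) * f - 1"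
    by (simp add: algebra_simps)
  ultimately show ?thesis
    unfolding g_def[symmetric] by metis
qed

lemma dvd_pcompose: "\<exists>h. pcompose f (monom 1 N) - f * h \<in> poly_ideal {a. m dvd a}"
proof (rule dvd_of_roots)
  fix i assume "i < d"
  have "\<beta> i ^ N \<simeq> \<beta> (i + 1)"
    using N_cong by (intro \<beta>_power) simp
  then show "ev (pcompose f (monom 1 N)) (\<beta> i) \<in> I"
    unfolding ev_simps by (rule ev_root)
qed

lemma discriminant_eqv: "of_int (monic_discriminant f) \<simeq> vandermonde_prod d \<beta> ^ 2"
proof -
  have "of_int (monic_discriminant f) =
      (-1) ^ (d * (d - 1) div 2) * resultant (of_int_poly f) (pderiv (of_int_poly f) :: 'a poly)"
    by (simp add: monic_discriminant_def degree_f of_int_hom.map_poly_pderiv flip: of_int_hom.resultant_hom)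
  also have "\<dots> \<simeq> (-1) ^ (d * (d - 1) div 2) * resultant P (pderiv P)"
  proof (intro eqv_mult eqv_refl resultant_eqv)
    show "coeff (pderiv (of_int_poly f)) k \<simeq> coeff (pderiv P) k" for k
      unfolding coeff_pderiv by (intro eqv_mult eqv_refl coeff_f_P)
    show "coeff (of_int_poly f) k \<simeq> coeff P k" for k
      by (rule coeff_f_P)
  qed (simp_all add: degree_f degree_P degree_pderiv)
  also have "\<dots> = vandermonde_prod d \<beta> ^ 2"
    unfolding P_def by (rule resultant_pderiv_prod_linear[OF inj_\<beta>])
  finally show ?thesis .
qed

lemma vandermonde_unit: "vandermonde_prod d \<beta> ^ Suc e \<simeq> 1"
proof -
  have "(\<Prod>i<d. \<Prod>j<i. (\<beta> j - \<beta> i) ^ Suc e) \<simeq> (\<Prod>i<d. \<Prod>j<i. 1)"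
    by (intro eqv_prod diff_unit_mod) auto
  then show ?thesis
    unfolding vandermonde_prod_def prod_power_distrib by simp
qed

lemma pseudoprime_mod: "pseudoprime_mod N d m f"
proof -
  \<comment> \<open>The constant term is the product of the roots up to sign; the factor 2 in the
    exponent removes the sign.\<close>
  have "(of_int (poly f 0) :: 'a) ^ (2 * wo) \<simeq> 1"
  proof -
    have "(of_int (poly f 0) :: 'a) = coeff (of_int_poly f) 0"
      by (simp add: poly_0_coeff_0)
    also have "\<dots> \<simeq> poly P 0"
      unfolding poly_0_coeff_0 by (rule coeff_f_P)
    also have "\<dots> = (-1) ^ d * (\<Prod>i<d. \<beta> i)"
      by (simp add: P_def poly_prod prod_uminus)
    finally have "(of_int (poly f 0) :: 'a) ^ (2 * wo) \<simeq> ((-1) ^ d * (\<Prod>i<d. \<beta> i)) ^ (2 * wo)"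
      by (rule eqv_power)
    also have "\<dots> = (\<Prod>i<d. \<beta> i ^ wo) ^ 2"
    proof -
      have "((- 1) ^ d) ^ (2 * wo) = (1 :: 'a)"
        by (simp flip: power_mult)
      then show ?thesis
        by (simp only: power_mult_distrib prod_power_distrib mult_1 mult.commute[of 2] flip: power_mult)
    qed
    also have "\<dots> = (\<Prod>i<d. (w ^ wo) ^ (b ^ i)) ^ 2"
      by (simp add: \<beta>_def mult.commute flip: power_mult)
    also have "\<dots> \<simeq> (\<Prod>i<d. 1 ^ (b ^ i)) ^ 2"
      by (intro eqv_prod eqv_power w_order)
    finally show ?thesis by simp
  qed
  moreover have "of_int (monic_discriminant f) ^ Suc e \<simeq> (1 :: 'a)"
  proof -
    have "of_int (monic_discriminant f) ^ Suc e \<simeq> (vandermonde_prod d \<beta> ^ Suc e) ^ 2"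
      using eqv_power[OF discriminant_eqv, of "Suc e"] by (simp only: power_mult [symmetric] mult.commute)
    also have "\<dots> \<simeq> 1 ^ 2"
      by (intro eqv_power vandermonde_unit)
    finally show ?thesis by simp
  qed
  ultimately have "of_int (poly f 0) ^ (2 * wo) * of_int (monic_discriminant f) ^ Suc e \<simeq> (1 * 1 :: 'a)"
    by (rule eqv_mult)
  then have "of_int (poly f 0 ^ (2 * wo) * monic_discriminant f ^ Suc e - 1) \<in> I"
    by (simp add: eqv_def)
  then have *: "m dvd poly f 0 ^ (2 * wo) * monic_discriminant f ^ Suc e - 1"
    unfolding of_int_mem_iff' .
  have "monic_discriminant f ^ Suc e = monic_discriminant f * monic_discriminant f ^ e"
    by simp
  moreover have "poly f 0 ^ (2 * wo) = poly f 0 * poly f 0 ^ (2 * wo - 1)"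
    using power_minus_mult[of "2 * wo" "poly f 0"] wo_pos by (simp add: mult.commute)
  ultimately have "poly f 0 ^ (2 * wo) * monic_discriminant f ^ Suc e =
      (poly f 0 * monic_discriminant f) * (poly f 0 ^ (2 * wo - 1) * monic_discriminant f ^ e)"
    by (simp only: mult_ac)
  moreover have "coprime m x" if "m dvd x * k - 1" for x k
  proof (rule Rings.coprimeI)
    fix c assume c: "c dvd m" "c dvd x"
    have "c dvd x * k - 1"
      using that c(1) dvd_trans by blast
    then have "c dvd x * k - (x * k - 1)"
      using dvd_diff[OF dvd_mult2[OF c(2)], of "x * k - 1" k] by blast
    moreover have "x * k - (x * k - 1) = 1"
      by simp
    ultimately show "is_unit c"
      by metis
  qed
  ultimately have "coprime m (poly f 0 * monic_discriminant f)"
    using * by metis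
  then show ?thesis
    unfolding pseudoprime_mod_def using dvd_frobenius_d bezout_frobenius dvd_pcompose by blast
qed

end

text \<open>Stickelberger's parity theorem for a Frobenius that permutes the roots cyclically.\<close>

lemma (in frobenius_roots) Legendre_discriminant:
  assumes p: "prime p" "odd p" and m: "m = int p" and b: "b = p"
  shows "Legendre (monic_discriminant f) (int p) = (-1) ^ (d - 1)"
proof -
  have "int p dvd m"
    by (simp add: m)
  then have "of_int (int p) \<in> I"
    unfolding of_int_mem_iff' by (simp add: m)
  then have pI: "of_nat p \<in> I"
    by simp
  let ?\<delta> = "vandermonde_prod d \<beta>"
  obtain k where k: "d = Suc k"
    using d_pos gr0_implies_Suc by blast
  \<comment> \<open>Frobenius shifts the indices of the roots cyclically. Moving the wrapped-around
    root back to the front costs \<open>k = d - 1\<close> sign changes, the sign of a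
    d-cycle.\<close>
  have "?\<delta> ^ p = (\<Prod>i<d. \<Prod>j<i. (\<beta> j - \<beta> i) ^ p)"
    by (simp add: vandermonde_prod_def prod_power_distrib)
  also have "\<dots> \<simeq> (\<Prod>i<d. \<Prod>j<i. \<beta> j ^ p - \<beta> i ^ p)"
    by (intro eqv_prod freshman_diff p pI)
  also have "\<dots> \<simeq> (\<Prod>i<d. \<Prod>j<i. \<beta> (Suc j) - \<beta> (Suc i))"
    using \<beta>_power[of p 1] b by (intro eqv_prod eqv_diff) auto
  also have "\<dots> = vandermonde_prod (Suc k) (\<lambda>i. \<beta> (Suc i))"
    by (simp add: vandermonde_prod_def k)
  also have "\<dots> = vandermonde_prod k (\<lambda>i. \<beta> (Suc i)) * (\<Prod>j<k. \<beta> (Suc j) - \<beta> d)"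
    by (simp add: vandermonde_prod_Suc k)
  also have "\<dots> \<simeq> vandermonde_prod k (\<lambda>i. \<beta> (Suc i)) * (\<Prod>j<k. \<beta> (Suc j) - \<beta> 0)"
    using \<beta>_mod[of d] by (intro eqv_mult eqv_prod eqv_diff eqv_refl) simp
  also have "(\<Prod>j<k. \<beta> (Suc j) - \<beta> 0) = (-1) ^ k * (\<Prod>j<k. \<beta> 0 - \<beta> (Suc j))"
  proof -
    have "(\<Prod>j<k. \<beta> (Suc j) - \<beta> 0) = (\<Prod>j<k. (-1) * (\<beta> 0 - \<beta> (Suc j)))"
      by (intro prod.cong) auto
    then show ?thesis
      by (simp only: prod.distrib) simp
  qed
  also have "vandermonde_prod k (\<lambda>i. \<beta> (Suc i)) * \<dots> = (-1) ^ k * ?\<delta>"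
    by (simp add: k vandermonde_prod_Suc_shift)
  finally have frob: "?\<delta> ^ p \<simeq> (-1) ^ k * ?\<delta>" .
  have "(?\<delta> ^ (p - 1) - (-1) ^ k) * ?\<delta> = ?\<delta> ^ p - (-1) ^ k * ?\<delta>"
    using power_minus_mult[of p ?\<delta>] prime_gt_0_nat[OF p(1)] by (simp add: algebra_simps)
  then have "?\<delta> ^ (p - 1) - (-1) ^ k \<in> I"
    using frob regular_of_unit[OF vandermonde_unit] by (simp add: eqv_def)
  then have "?\<delta> ^ (p - 1) \<simeq> (-1) ^ k"
    by (simp add: eqv_def)
  moreover have "of_int (monic_discriminant f) ^ ((p - 1) div 2) \<simeq> (?\<delta> ^ 2) ^ ((p - 1) div 2)"
    by (rule eqv_power[OF discriminant_eqv])
  moreover have "(?\<delta> ^ 2) ^ ((p - 1) div 2) = ?\<delta> ^ (p - 1)"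
    using p(2) by (simp flip: power_mult)
  ultimately have "of_int (monic_discriminant f) ^ ((p - 1) div 2) \<simeq> (-1) ^ k"
    using eqv_trans by metis
  then have "of_int (monic_discriminant f ^ ((p - 1) div 2) - (-1) ^ k) \<in> I"
    by (simp add: eqv_def)
  then have "[monic_discriminant f ^ ((p - 1) div 2) = (-1) ^ k] (mod int p)"
    unfolding of_int_mem_iff' m by (simp add: cong_iff_dvd_diff)
  moreover have p2: "2 < int p"
    using p prime_ge_2_nat[OF p(1)] by (cases "p = 2") auto
  then have "[Legendre (monic_discriminant f) (int p) = monic_discriminant f ^ ((p - 1) div 2)] (mod int p)"
    using euler_criterion[of p "monic_discriminant f"] p(1) by simp
  ultimately have "[Legendre (monic_discriminant f) (int p) = (-1) ^ k] (mod int p)"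
    using cong_trans by blast
  then have dvd: "int p dvd Legendre (monic_discriminant f) (int p) - (-1) ^ k"
    by (simp add: cong_iff_dvd_diff)
  \<comment> \<open>Both sides have absolute value at most 1 and p exceeds 2, so the congruence is
    an equality.\<close>
  have "\<bar>Legendre (monic_discriminant f) (int p)\<bar> \<le> 1" "\<bar>(-1) ^ k :: int\<bar> = 1"
    by (auto simp: Legendre_def power_abs)
  then have "\<bar>Legendre (monic_discriminant f) (int p) - (-1) ^ k\<bar> \<le> 2"
    by linarith
  moreover have "\<bar>int p\<bar> \<le> \<bar>Legendre (monic_discriminant f) (int p) - (-1) ^ k\<bar>"
    if "Legendre (monic_discriminant f) (int p) - (-1) ^ k \<noteq> 0"
    using that dvd by (rule dvd_imp_le_int)
  ultimately have "Legendre (monic_discriminant f) (int p) - (-1) ^ k = 0"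
    using p2 by linarith
  then show ?thesis
    by (simp add: k)
qed

lemma Legendre_square:
  assumes "prime p" "\<not> int p dvd c" "[a = c ^ 2] (mod int p)"
  shows "Legendre a (int p) = 1"
proof -
  have "\<not> [a = 0] (mod int p)"
  proof
    assume "[a = 0] (mod int p)"
    then have "[c ^ 2 = 0] (mod int p)"
      using assms(3) cong_sym cong_trans by blast
    then have "int p dvd c ^ 2"
      by (simp add: cong_0_iff)
    then show False
      using assms(1,2) prime_dvd_power[of "int p" c 2] by simp
  qed
  moreover have "QuadRes (int p) a"
    using assms(3) cong_sym by (auto simp: QuadRes_def)
  ultimately show ?thesis
    by (simp add: Legendre_def)
qed

text \<open>Here the roots are integers, so modulo \<open>q\<close> the discriminant is the square
  of the integer \<open>vandermonde_prod d \<beta>\<close>, which is prime to \<open>q\<close>;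
  hence every Legendre factor is 1.\<close>

lemma Jacobi_discriminant_square:
  assumes "frobenius_roots {a :: int. m dvd a} w b wo d e N m f" and "m = int q"
  shows "Jacobi (monic_discriminant f) q = 1"
proof -
  interpret frobenius_roots "{a :: int. m dvd a}" w b wo d e N m f
    by fact
  let ?\<delta> = "vandermonde_prod d \<beta>"
  have "Legendre (monic_discriminant f) (int r) = 1" if r: "r \<in> prime_factors q" for r
  proof (rule Legendre_square[of _ ?\<delta>])
    show "prime r"
      using r by auto
    have rm: "int r dvd m"
      using r assms(2) by auto
    have "m dvd monic_discriminant f - ?\<delta> ^ 2"
      using discriminant_eqv by (simp add: eqv_def)
    then show "[monic_discriminant f = ?\<delta> ^ 2] (mod int r)"
      using rm by (auto simp: cong_iff_dvd_diff intro: dvd_trans)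
    have "m dvd ?\<delta> * ?\<delta> ^ e - 1"
      using vandermonde_unit by (simp add: eqv_def)
    then have *: "int r dvd ?\<delta> * ?\<delta> ^ e - 1"
      using rm dvd_trans by blast
    show "\<not> int r dvd ?\<delta>"
    proof
      assume "int r dvd ?\<delta>"
      then have "int r dvd ?\<delta> * ?\<delta> ^ e - (?\<delta> * ?\<delta> ^ e - 1)"
        using dvd_diff[OF dvd_mult2 *] by blast
      then show False
        using prime_gt_1_nat[OF \<open>prime r\<close>] by simp
    qed
  qed
  then show ?thesis
    by (simp add: Jacobi_def prod_mset.neutral)
qed

section \<open>Roots of unity modulo prime ideals\<close>

text \<open>Otherwise 1/p would be an algebraic integer: multiplication by h(\<omega>) acts on 1,
  \<omega>, ..., \<omega>^(n - 1) through the integer matrix \<open>A\<close>, so 1/p is a root of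
  the monic integer polynomial \<open>char_poly A\<close>. Clearing denominators makes 1 a multiple
  of p.\<close>

lemma not_inverse_prime_in_cyclotomic_ring:
  fixes \<omega> :: complex
  assumes "prime p" and "n > 0" and "\<omega> ^ n = 1"
  shows "of_nat p * poly (of_int_poly h) \<omega> \<noteq> 1"
proof
  assume inv: "of_nat p * poly (of_int_poly h) \<omega> = 1"
  have p0: "of_nat p \<noteq> (0 :: complex)"
    using assms(1) by auto
  define x where "x = poly (of_int_poly h) \<omega>"
  have px: "of_nat p * x = 1"
    using inv by (simp add: x_def)
  define A where "A = mat n n (\<lambda>(i, j). \<Sum>k\<le>degree h. if (i + k) mod n = j then coeff h k else 0)"
  define v where "v = vec n (\<lambda>j. \<omega> ^ j)"
  have A: "A \<in> carrier_mat n n"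
    by (simp add: A_def)
  have \<omega>_mod: "\<omega> ^ (k mod n) = \<omega> ^ k" for k
  proof -
    have "\<omega> ^ k = (\<omega> ^ n) ^ (k div n) * \<omega> ^ (k mod n)"
      by (metis div_mult_mod_eq mult.commute power_add power_mult)
    then show ?thesis
      using assms(3) by simp
  qed
  have "map_mat of_int A *\<^sub>v v = x \<cdot>\<^sub>v v"
  proof (rule eq_vecI)
    fix i assume "i < dim_vec (x \<cdot>\<^sub>v v)"
    then have i: "i < n"
      by (simp add: v_def)
    have "(map_mat of_int A *\<^sub>v v) $ i =
        (\<Sum>j<n. (\<Sum>k\<le>degree h. if (i + k) mod n = j then of_int (coeff h k) else 0) * \<omega> ^ j)"
      using i by (simp add: scalar_prod_def A_def v_def atLeast0LessThan if_distrib[of of_int] cong: if_cong)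
    also have "\<dots> = (\<Sum>j<n. \<Sum>k\<le>degree h. if (i + k) mod n = j then of_int (coeff h k) * \<omega> ^ j else 0)"
      by (simp add: sum_distrib_right if_distrib[of "\<lambda>x. x * _"] cong: if_cong)
    also have "\<dots> = (\<Sum>k\<le>degree h. \<Sum>j<n. if (i + k) mod n = j then of_int (coeff h k) * \<omega> ^ j else 0)"
      by (rule sum.swap)
    also have "\<dots> = (\<Sum>k\<le>degree h. of_int (coeff h k) * \<omega> ^ ((i + k) mod n))"
      using assms(2) by (simp add: sum.delta)
    also have "\<dots> = \<omega> ^ i * (\<Sum>k\<le>degree h. of_int (coeff h k) * \<omega> ^ k)"
      by (simp add: \<omega>_mod power_add sum_distrib_left mult_ac)
    also have "(\<Sum>k\<le>degree h. of_int (coeff h k) * \<omega> ^ k) = x"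
      unfolding x_def by (subst poly_altdef'[of _ "degree h"]) simp_all
    finally show "(map_mat of_int A *\<^sub>v v) $ i = (x \<cdot>\<^sub>v v) $ i"
      using i by (simp add: v_def)
  qed (simp_all add: A_def v_def)
  moreover have "v \<noteq> 0\<^sub>v n"
  proof
    assume "v = 0\<^sub>v n"
    then have "v $ 0 = 0"
      using assms(2) by simp
    then show False
      using assms(2) by (simp add: v_def)
  qed
  ultimately have "eigenvalue (map_mat of_int A) x"
    using A unfolding eigenvalue_def eigenvector_def by (intro exI[of _ v]) (auto simp: v_def)
  then have root: "poly (of_int_poly (char_poly A)) x = 0"
    using A by (simp add: eigenvalue_root_char_poly[of _ n] of_int_hom.char_poly_hom)
  define c where "c = char_poly A"
  have c: "degree c = n" "coeff c n = 1"
    using degree_monic_char_poly[OF A] by (auto simp: c_def)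
  have "of_nat p ^ n * poly (of_int_poly c) x = (\<Sum>k\<le>n. of_int (coeff c k) * of_nat p ^ (n - k))"
  proof -
    have "of_nat p ^ n * x ^ k = of_nat p ^ (n - k)" if "k \<le> n" for k
    proof -
      have "of_nat p ^ n * x ^ k = of_nat p ^ (n - k) * (of_nat p * x) ^ k"
        using that by (simp add: power_mult_distrib flip: power_add mult.assoc)
      then show ?thesis
        by (simp add: px)
    qed
    then show ?thesis
      by (subst poly_altdef'[of _ n]) (auto simp: c sum_distrib_left mult.left_commute intro!: sum.cong)
  qed
  then have "of_int (\<Sum>k\<le>n. coeff c k * int p ^ (n - k)) = (0 :: complex)"
    using root by (simp add: c_def)
  then have "(\<Sum>k\<le>n. coeff c k * int p ^ (n - k)) = 0"
    by (simp only: of_int_eq_0_iff)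
  moreover have "{..n} = insert n {..<n}"
    by auto
  ultimately have "1 + (\<Sum>k<n. coeff c k * int p ^ (n - k)) = 0"
    using c by simp
  moreover have "int p dvd (\<Sum>k<n. coeff c k * int p ^ (n - k))"
    by (intro dvd_sum) auto
  ultimately have "int p dvd 1"
    by (metis add_eq_0_iff dvd_minus_iff dvd_refl)
  then show False
    using prime_gt_1_nat[OF assms(1)] by simp
qed

text \<open>The value at 1 of (X^n - 1) / (X - 1) = 1 + X + ... + X^(n - 1). Consequently each
  factor divides n, which keeps it out of prime ideals above a prime not dividing n.\<close>

lemma prod_one_minus_roots_of_unity:
  assumes "n > 0"
  shows "(\<Prod>j\<in>{1..<n}. 1 - cis (2 * pi / n) ^ j) = of_nat n"
proof -
  define \<omega> where "\<omega> = cis (2 * pi / n)"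
  have \<omega>: "\<omega> ^ j = cis (2 * pi * j / n)" for j
    by (simp add: \<omega>_def Complex.DeMoivre mult_ac)
  have inj: "inj_on (\<lambda>j. \<omega> ^ j) {..<n}"
    using Complex.bij_betw_roots_unity[OF assms] unfolding \<omega> by (auto simp: bij_betw_def)
  have one: "\<omega> ^ n = 1"
    using assms by (simp add: \<omega>)
  have prod: "(\<Prod>j<n. [:- (\<omega> ^ j), 1:]) = monom 1 n - 1"
  proof -
    define q where "q = (\<Prod>j<n. [:- (\<omega> ^ j), 1:]) - (monom 1 n - 1)"
    interpret prime_ring_ideal "{0 :: complex}"
      by (rule prime_ring_ideal_zero)
    have "coeff q k \<in> {0}" for k
    proof (rule coeffs_mem_of_roots[where n = n and \<beta> = "\<lambda>j. \<omega> ^ j"])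
      show "coeff q k = 0" if "k \<ge> n" for k
      proof (cases "k = n")
        case True
        then show ?thesis
          using degree_prod_linear[of "\<lambda>j. \<omega> ^ j" n] assms by (simp add: q_def)
      next
        case False
        then have "coeff (\<Prod>j<n. [:- (\<omega> ^ j), 1:]) k = 0"
          using that degree_prod_linear(1)[of "\<lambda>j. \<omega> ^ j" n] by (intro coeff_eq_0) simp
        then show ?thesis
          using False that by (simp add: q_def coeff_eq_0)
      qed
      show "poly q (\<omega> ^ j) \<in> {0}" if "j < n" for j
      proof -
        have "(\<omega> ^ j) ^ n = 1"
          using one by (metis mult.commute power_mult power_one)
        then show ?thesis
          using that by (auto simp: q_def poly_prod poly_monom intro!: prod_zero)
      qed
      show "a \<in> {0}" if "i < n" "j < n" "i \<noteq> j" "a * (\<omega> ^ i - \<omega> ^ j) \<in> {0}" for i j a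
        using that inj by (auto dest: inj_onD)
    qed
    then show ?thesis
      by (simp add: q_def poly_eq_iff)
  qed
  have "{..<n} = insert 0 {1..<n}"
    using assms by auto
  then have "(\<Prod>j<n. [:- (\<omega> ^ j), 1:]) = [:- 1, 1:] * (\<Prod>j\<in>{1..<n}. [:- (\<omega> ^ j), 1:])"
    by simp
  moreover have "monom 1 n - 1 = [:- 1, 1:] * (\<Sum>i<n. monom (1::complex) i)"
  proof -
    have "monom (1::complex) n - 1 = monom 1 1 ^ n - 1"
      by (simp add: monom_power)
    also have "\<dots> = (monom 1 1 - 1) * (\<Sum>i<n. monom 1 1 ^ i)"
      by (rule power_diff_1_eq)
    also have "monom (1::complex) 1 - 1 = [:0, 1:] - [:1:]"
      by (simp only: One_nat_def monom_Suc monom_0 pCons_one)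
    also have "\<dots> = [:- 1, 1:]"
      by (simp only: diff_pCons diff_0 diff_0_right)
    finally show ?thesis
      by (simp add: monom_power)
  qed
  ultimately have "(\<Prod>j\<in>{1..<n}. [:- (\<omega> ^ j), 1:]) = (\<Sum>i<n. monom (1::complex) i)"
    using prod mult_left_cancel[of "[:- 1, 1::complex:]"] by auto
  then have "poly (\<Prod>j\<in>{1..<n}. [:- (\<omega> ^ j), 1:]) 1 = poly (\<Sum>i<n. monom (1::complex) i) 1"
    by simp
  then show ?thesis
    by (simp add: poly_prod poly_sum poly_monom \<omega>_def)
qed

lemma ex_maximal_ring_ideal:
  assumes "ring_ideal J" and "1 \<notin> J"
  shows "\<exists>I. prime_ring_ideal I \<and> J \<subseteq> I"
proof -
  define F where "F = {I. ring_ideal I \<and> J \<subseteq> I \<and> 1 \<notin> I}"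
  have "\<exists>M\<in>F. \<forall>X\<in>F. M \<subseteq> X \<longrightarrow> X = M"
  proof (rule subset_Zorn_nonempty)
    show "F \<noteq> {}"
      using assms by (auto simp: F_def)
    fix C assume C: "C \<noteq> {}" "subset.chain F C"
    then have ideals: "ring_ideal X" "J \<subseteq> X" "1 \<notin> X" if "X \<in> C" for X
      using that by (auto simp: F_def subset_chain_def)
    have "ring_ideal (\<Union>C)"
    proof
      show "0 \<in> \<Union>C"
        using C(1) ideals ring_ideal.zero_mem by fastforce
      show "a + b \<in> \<Union>C" if ab: "a \<in> \<Union>C" "b \<in> \<Union>C" for a b
      proof -
        obtain X Y where XY: "X \<in> C" "Y \<in> C" "a \<in> X" "b \<in> Y"
          using ab by blast
        then have "X \<subseteq> Y \<or> Y \<subseteq> X"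
          using C(2) by (auto simp: subset_chain_def)
        then show ?thesis
          using XY ideals ring_ideal.add_mem by (meson UnionI subsetD)
      qed
      show "r * a \<in> \<Union>C" if "a \<in> \<Union>C" for a r
        using that ideals ring_ideal.mult_mem by blast
    qed
    then show "\<Union>C \<in> F"
      unfolding F_def using C(1) ideals(2,3) by blast
  qed
  then obtain I where IF: "I \<in> F" and maxF: "\<forall>X\<in>F. I \<subseteq> X \<longrightarrow> X = I"
    by (elim bexE)
  have I: "ring_ideal I" "J \<subseteq> I" "1 \<notin> I"
    using IF by (simp_all add: F_def)
  have max: "X = I" if "ring_ideal X" "1 \<notin> X" "I \<subseteq> X" for X
    using maxF that I(2) by (auto simp: F_def)
  interpret ring_ideal I by fact
  have "prime_ring_ideal I"
  proof
    show "1 \<notin> I" by fact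
    fix a b assume ab: "a * b \<in> I"
    show "a \<in> I \<or> b \<in> I"
    proof (rule ccontr)
      assume no: "\<not> ?thesis"
      define X where "X = {x. \<exists>r. x - r * a \<in> I}"
      have "ring_ideal X"
      proof
        show "0 \<in> X"
          unfolding X_def using zero_mem by (auto intro!: exI[of _ 0])
        show "x + y \<in> X" if "x \<in> X" "y \<in> X" for x y
        proof -
          obtain r s where "x - r * a \<in> I" "y - s * a \<in> I"
            using \<open>x \<in> X\<close> \<open>y \<in> X\<close> by (auto simp: X_def)
          then have "(x - r * a) + (y - s * a) \<in> I"
            by (rule add_mem)
          then show ?thesis
            unfolding X_def by (auto simp: algebra_simps intro!: exI[of _ "r + s"])
        qed
        show "c * x \<in> X" if "x \<in> X" for x c
        proof -
          obtain r where "x - r * a \<in> I"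
            using \<open>x \<in> X\<close> by (auto simp: X_def)
          then have "c * (x - r * a) \<in> I"
            by (rule mult_mem)
          then show ?thesis
            unfolding X_def by (auto simp: algebra_simps intro!: exI[of _ "c * r"])
        qed
      qed
      moreover have "I \<subseteq> X"
        unfolding X_def by (auto intro!: exI[of _ 0])
      moreover have "a \<in> X"
        unfolding X_def using zero_mem by (auto intro!: exI[of _ 1])
      ultimately have "1 \<in> X"
        using max[of X] no by blast
      then obtain r where "1 - r * a \<in> I"
        by (auto simp: X_def)
      then have "(1 - r * a) * b + r * (a * b) \<in> I"
        by (intro add_mem mult_mem' mult_mem ab)
      then have "b \<in> I"
        by (simp add: algebra_simps)
      then show False
        using no by blast
    qed
  qed
  then show ?thesis
    using I(2) by blast
qed

text \<open>Reduction modulo \<open>I\<close> stands in for the field generated by a primitive n-th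
  root of unity in characteristic p, with X as that root. \<open>I\<close> contains the preimage
  \<open>J\<close> of pZ[\<omega>] under evaluation at \<omega>. The order of X is exactly n,
  because the product of all 1 - X^j is n modulo \<open>I\<close>, and n is not in
  \<open>I\<close>.\<close>

lemma ex_prime_ideal_with_root_of_unity:
  assumes p: "prime p" and n: "n > 0" "coprime p n"
  obtains I :: "int poly set" where "prime_ring_ideal I" "of_nat p \<in> I"
    "\<And>k. monom 1 k - 1 \<in> I \<longleftrightarrow> n dvd k"
proof -
  define \<omega> where "\<omega> = cis (2 * pi / n)"
  have \<omega>: "\<omega> ^ n = 1"
    using n by (simp add: \<omega>_def Complex.DeMoivre)
  let ?ev = "\<lambda>g :: int poly. poly (of_int_poly g) \<omega>"
  define J where "J = {g. \<exists>h. ?ev g = of_nat p * ?ev h}"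
  have J: "ring_ideal J"
  proof
    show "0 \<in> J"
      by (auto simp: J_def intro!: exI[of _ 0])
    show "a + b \<in> J" if ab: "a \<in> J" "b \<in> J" for a b
    proof -
      obtain g h where "?ev a = of_nat p * ?ev g" "?ev b = of_nat p * ?ev h"
        using ab by (auto simp: J_def)
      then have "?ev (a + b) = of_nat p * ?ev (g + h)"
        by (simp add: hom_distribs algebra_simps)
      then show ?thesis
        unfolding J_def by blast
    qed
    show "r * a \<in> J" if a: "a \<in> J" for a r
    proof -
      obtain g where "?ev a = of_nat p * ?ev g"
        using a by (auto simp: J_def)
      then have "?ev (r * a) = of_nat p * ?ev (r * g)"
        by (simp add: hom_distribs)
      then show ?thesis
        unfolding J_def by blast
    qed
  qed
  have "1 \<notin> J"
    using not_inverse_prime_in_cyclotomic_ring[OF p n(1) \<omega>] by (auto simp: J_def)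
  then obtain I where I: "prime_ring_ideal I" "J \<subseteq> I"
    using ex_maximal_ring_ideal[OF J] by blast
  interpret prime_ring_ideal I by fact
  have ker: "g \<in> I" if "?ev g = 0" for g
    using that I(2) by (auto simp: J_def intro!: exI[of _ 0])
  have "of_nat p \<in> J"
    unfolding J_def by (auto intro!: exI[of _ 1] simp: hom_distribs)
  then have pI: "of_nat p \<in> I"
    using I(2) by blast
  have X: "monom 1 k - 1 \<in> I \<longleftrightarrow> n dvd k" for k
  proof -
    have *: "monom 1 (k mod n) - 1 \<in> I \<longleftrightarrow> monom 1 k - 1 \<in> I"
    proof -
      have "\<omega> ^ k = (\<omega> ^ n) ^ (k div n) * \<omega> ^ (k mod n)"
        by (metis div_mult_mod_eq mult.commute power_add power_mult)
      then have "(monom 1 (k mod n) - 1) - (monom 1 k - 1) \<in> I"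
        by (intro ker) (simp add: hom_distribs poly_monom \<omega>)
      then show ?thesis
        using mem_eqv[unfolded eqv_def] by blast
    qed
    show ?thesis
    proof
      assume "n dvd k"
      then show "monom 1 k - 1 \<in> I"
        using * by (simp add: zero_mem)
    next
      assume k: "monom 1 k - 1 \<in> I"
      show "n dvd k"
      proof (rule ccontr)
        assume "\<not> n dvd k"
        then have j: "k mod n \<in> {1..<n}"
          using n(1) by (simp add: mod_greater_zero_iff_not_dvd Suc_le_eq)
        define g :: "int poly" where "g = (\<Prod>j\<in>{1..<n}. 1 - monom 1 j)"
        have "?ev (g - of_nat n) = 0"
          using prod_one_minus_roots_of_unity[OF n(1)]
          by (simp add: g_def hom_distribs poly_prod poly_monom \<omega>_def)
        then have "g - of_nat n \<in> I"
          by (rule ker)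
        moreover have "g \<in> I"
        proof -
          have "g = (1 - monom 1 (k mod n)) * (\<Prod>j\<in>{1..<n} - {k mod n}. 1 - monom 1 j)"
            unfolding g_def by (rule prod.remove[OF _ j]) simp
          moreover have "1 - monom 1 (k mod n) \<in> I"
            using minus_mem[of "monom 1 (k mod n) - 1"] * k by simp
          ultimately show ?thesis
            by (simp add: mult_mem')
        qed
        ultimately have "of_int (int n) \<in> I"
          using diff_mem[of g "g - of_nat n"] by simp
        then have "p dvd n"
          using of_int_mem_iff[OF p pI] by (simp only: int_dvd_int_iff)
        then show False
          using n(2) p by (metis coprime_absorb_left not_prime_unit)
      qed
    qed
  qed
  show ?thesis
    by (rule that[OF I(1) pI X])
qed

section \<open>Counting polynomials modulo a prime\<close>

text \<open>\<open>N\<close> is the number under test and \<open>m\<close> one of its factors: the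
  conditions refer to powers with exponent \<open>N\<close> but are imposed modulo \<open>m\<close>
  only, so the sets for coprime factors can be combined. \<open>s\<close> records the contribution
  of \<open>m\<close> to the Jacobi symbol.\<close>

definition good_polys :: "nat \<Rightarrow> nat \<Rightarrow> nat \<Rightarrow> int \<Rightarrow> int poly set" where
  "good_polys N d m s = {f \<in> poly_mod_carrier m. degree f = d \<and> monic f \<and>
     pseudoprime_mod N d (int m) f \<and> Jacobi (monic_discriminant f) m = s}"

lemma poly_mod_carrier_iff: "f \<in> poly_mod_carrier n \<longleftrightarrow> (\<forall>k. coeff f k mod int n = coeff f k)"
  by (simp add: poly_mod_carrier_def poly_eq_iff poly_mod.Mp_coeff poly_mod.M_def)

lemma coeff_sum_monom: "coeff (\<Sum>k\<le>d. monom (c k) k) j = (if j \<le> d then c j else 0)"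
  by (simp add: coeff_sum)

lemma finite_poly_mod_carrier:
  assumes "n > 0"
  shows "finite {f \<in> poly_mod_carrier n. degree f = d}"
proof (rule finite_subset)
  show "{f \<in> poly_mod_carrier n. degree f = d} \<subseteq>
      (\<lambda>c. \<Sum>k\<le>d. monom (c k) k) ` (PiE {..d} (\<lambda>_. {0..<int n}))"
  proof
    fix f assume f: "f \<in> {f \<in> poly_mod_carrier n. degree f = d}"
    have "f = (\<Sum>k\<le>d. monom (restrict (coeff f) {..d} k) k)"
      using f by (intro poly_eqI) (auto simp: coeff_sum_monom coeff_eq_0)
    moreover have "restrict (coeff f) {..d} \<in> PiE {..d} (\<lambda>_. {0..<int n})"
    proof -
      have "coeff f k \<in> {0..<int n}" for k
      proof -
        have "coeff f k = coeff f k mod int n"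
          using f by (simp add: poly_mod_carrier_iff)
        then show ?thesis
          using assms by (metis atLeastLessThan_iff of_nat_0_less_iff pos_mod_bound pos_mod_sign)
      qed
      then show ?thesis by auto
    qed
    ultimately show "f \<in> (\<lambda>c. \<Sum>k\<le>d. monom (c k) k) ` (PiE {..d} (\<lambda>_. {0..<int n}))"
      by (rule image_eqI)
  qed
qed (auto intro!: finite_PiE)

lemma finite_good_polys: "n > 0 \<Longrightarrow> finite (good_polys N d n s)"
  by (rule finite_subset[OF _ finite_poly_mod_carrier[of n d]]) (auto simp: good_polys_def)

lemma Jacobi_prime: "prime p \<Longrightarrow> Jacobi a p = Legendre a (int p)"
  by (simp add: Jacobi_def prime_factorization_prime)

lemma (in ring_ideal) poly_ideal_of_nat: "of_nat p \<in> I \<Longrightarrow> of_nat p \<in> poly_ideal I"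
  by (auto simp: poly_ideal_def of_nat_poly coeff_pCons zero_mem split: nat.split)

text \<open>Frobenius permutes the roots, so Q(X)^p and Q(X^p) agree modulo \<open>I\<close>;
  comparing the coefficients of X^(kp) gives the claim.\<close>

lemma (in ring_ideal) coeffs_fixed_by_frobenius:
  assumes p: "prime p" "of_nat p \<in> I" and d: "d > 0"
    and \<beta>: "\<And>i. i < d \<Longrightarrow> \<beta> i ^ p \<simeq> \<beta> (Suc i)" "\<beta> d \<simeq> \<beta> 0"
  defines "Q \<equiv> \<Prod>i<d. [:- \<beta> i, 1:]"
  shows "coeff Q k ^ p \<simeq> coeff Q k"
proof -
  interpret poly: ring_ideal "poly_ideal I"
    by (rule ring_ideal_poly_ideal)
  note pp = poly_ideal_of_nat[OF p(2)]
  define n where "n = degree Q"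
  have Q: "Q = (\<Sum>k\<le>n. monom (coeff Q k) k)"
    by (simp add: n_def poly_as_sum_of_monoms)
  have "poly.eqv (Q ^ p) (\<Sum>k\<le>n. monom (coeff Q k) k ^ p)"
    by (subst (1) Q) (rule poly.freshman_sum[OF p(1) pp])
  also have "(\<Sum>k\<le>n. monom (coeff Q k) k ^ p) = (\<Sum>k\<le>n. monom (coeff Q k ^ p) (k * p))"
    by (simp add: monom_power)
  finally have 1: "poly.eqv (Q ^ p) (\<Sum>k\<le>n. monom (coeff Q k ^ p) (k * p))" .
  obtain l where l: "d = Suc l"
    using d gr0_implies_Suc by blast
  have const: "poly.eqv [:a:] [:b:]" if "a \<simeq> b" for a b
    using that zero_mem unfolding poly.eqv_def eqv_def
    by (auto simp: poly_ideal_def coeff_pCons split: nat.split)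
  have "Q ^ p = (\<Prod>i<d. (monom 1 1 - [:\<beta> i:]) ^ p)"
  proof -
    have "[:- \<beta> i, 1:] = monom 1 1 - [:\<beta> i:]" for i
      by (rule poly_eqI) (simp add: coeff_pCons split: nat.split)
    then show ?thesis
      by (simp add: Q_def prod_power_distrib)
  qed
  also have "poly.eqv \<dots> (\<Prod>i<d. monom 1 1 ^ p - [:\<beta> i:] ^ p)"
    by (intro poly.eqv_prod poly.freshman_diff p(1) pp)
  also have "(\<Prod>i<d. monom 1 1 ^ p - [:\<beta> i:] ^ p) = (\<Prod>i<d. monom 1 p - [:\<beta> i ^ p:])"
    by (simp add: monom_power poly_const_pow)
  also have "poly.eqv \<dots> (\<Prod>i<d. monom 1 p - [:\<beta> (Suc i):])"
    by (intro poly.eqv_prod poly.eqv_diff poly.eqv_refl const \<beta>) auto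
  also have "(\<Prod>i<d. monom 1 p - [:\<beta> (Suc i):]) = (\<Prod>i<l. monom 1 p - [:\<beta> (Suc i):]) * (monom 1 p - [:\<beta> d:])"
    by (simp add: l)
  also have "poly.eqv \<dots> ((\<Prod>i<l. monom 1 p - [:\<beta> (Suc i):]) * (monom 1 p - [:\<beta> 0:]))"
    by (intro poly.eqv_mult poly.eqv_diff poly.eqv_refl const \<beta>)
  also have "\<dots> = (\<Prod>i<d. monom 1 p - [:\<beta> i:])"
    unfolding l prod.lessThan_Suc_shift by (rule mult.commute)
  also have "\<dots> = pcompose Q (monom 1 p)"
  proof -
    have "monom 1 p - [:b:] = [:- b:] + monom 1 p" for b :: 'a
      by (rule poly_eqI) (simp add: coeff_pCons split: nat.split)
    then show ?thesis
      unfolding Q_def pcompose_prod by (intro prod.cong) (simp_all add: pcompose_pCons)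
  qed
  also have "\<dots> = (\<Sum>k\<le>n. monom (coeff Q k) (k * p))"
  proof -
    have "pcompose (monom a k) (monom 1 p) = monom a (k * p)" for a :: 'a and k
    proof (induction k)
      case 0
      then show ?case by (simp add: monom_0)
    next
      case (Suc k)
      then show ?case
        by (simp add: monom_Suc pcompose_pCons mult_monom)
    qed
    then show ?thesis
      by (subst Q) (simp add: pcompose_sum)
  qed
  finally have "poly.eqv (Q ^ p) (\<Sum>k\<le>n. monom (coeff Q k) (k * p))" .
  then have "poly.eqv (\<Sum>k\<le>n. monom (coeff Q k ^ p) (k * p)) (\<Sum>k\<le>n. monom (coeff Q k) (k * p))"
    using 1 poly.eqv_sym poly.eqv_trans by blast
  then have "coeff (\<Sum>j\<le>n. monom (coeff Q j ^ p) (j * p)) (k * p) - coeff (\<Sum>j\<le>n. monom (coeff Q j) (j * p)) (k * p) \<in> I"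
    unfolding poly.eqv_def by (simp add: poly_ideal_def)
  moreover have "coeff (\<Sum>j\<le>n. monom (c j) (j * p)) (k * p) = (if k \<le> n then c k else 0)" for c :: "nat \<Rightarrow> 'a"
    using prime_gt_0_nat[OF p(1)] by (simp add: coeff_sum)
  moreover have "coeff Q k = 0" if "\<not> k \<le> n"
    using that by (simp add: n_def coeff_eq_0)
  ultimately show ?thesis
    using prime_gt_0_nat[OF p(1)] by (cases "k \<le> n") (auto simp: eqv_def zero_mem zero_power)
qed

lemma (in prime_ring_ideal) ex_int_poly_eqv:
  assumes p: "prime p" "of_nat p \<in> I" and Q: "monic Q" "degree Q = d"
    and fixed: "\<And>k. coeff Q k ^ p \<simeq> coeff Q k"
  shows "\<exists>f\<in>poly_mod_carrier p. monic f \<and> degree f = d \<and> (\<forall>k. of_int (coeff f k) \<simeq> coeff Q k)"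
proof -
  obtain c where c: "\<And>k. c k \<in> {0..<int p}" "\<And>k. coeff Q k \<simeq> of_int (c k)"
    using fixed_by_frobenius_imp_int[OF p fixed] by metis
  define c' where "c' k = (if k < d then c k else 1)" for k
  define f where "f = (\<Sum>k\<le>d. monom (c' k) k)"
  have coeff_f: "coeff f k = (if k < d then c k else if k = d then 1 else 0)" for k
    by (simp add: f_def coeff_sum_monom c'_def)
  have "degree f = d"
    by (intro antisym degree_le le_degree) (auto simp: coeff_f)
  moreover have "of_int (coeff f k) \<simeq> coeff Q k" for k
    using c(2)[of k] Q by (auto simp: coeff_f eqv_sym coeff_eq_0)
  moreover have "coeff f k mod int p = coeff f k" for k
    using c(1)[of k] prime_gt_1_nat[OF p(1)] by (simp add: coeff_f)
  ultimately show ?thesis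
    by (intro bexI[of _ f]) (auto simp: poly_mod_carrier_iff coeff_f)
qed

lemma card_le_mult_card_image:
  assumes "finite S" and "\<And>x. x \<in> S \<Longrightarrow> card {y \<in> S. g y = g x} \<le> k"
  shows "card S \<le> k * card (g ` S)"
proof -
  have "card S = (\<Sum>x\<in>S. 1)"
    by simp
  also have "\<dots> = (\<Sum>z\<in>g ` S. \<Sum>x\<in>{x \<in> S. g x = z}. 1)"
    by (rule sum.image_gen[OF assms(1)])
  also have "\<dots> \<le> (\<Sum>z\<in>g ` S. k)"
    using assms(2) by (intro sum_mono) auto
  finally show ?thesis
    by (simp add: mult.commute)
qed

text \<open>Let X be the root of unity of order \<open>n\<close> modulo the prime ideal. Each
  \<open>j\<close> in the set yields the polynomial whose roots are the conjugates X^(j p^i); the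
  conditions on \<open>j\<close> make these d conjugates distinct. One polynomial arises from at
  most d values of \<open>j\<close>, one for each of its roots.\<close>

lemma card_good_polys_prime:
  assumes p: "prime p" "odd p" and d: "d > 0" and n: "n > 0" "n dvd p ^ d - 1"
    and N: "[N = p] (mod n)"
  shows "card {j \<in> {..<n}. \<forall>i\<in>{1..<d}. \<not> n dvd j * (p ^ i - 1)} \<le> d * card (good_polys N d p ((-1) ^ (d - 1)))"
    (is "card ?S \<le> d * card ?G")
proof -
  have p1: "p > 1"
    using prime_gt_1_nat[OF p(1)] .
  have pd: "p ^ d > 1"
    using one_less_power[OF p1 d] .
  have cop: "coprime p n"
  proof -
    have "\<not> p dvd n"
    proof
      assume "p dvd n"
      then have "p dvd p ^ d - 1"
        using n(2) dvd_trans by blast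
      moreover have "p dvd p ^ d"
        using d by simp
      ultimately have "p dvd p ^ d - (p ^ d - 1)"
        by (rule dvd_diff_nat[rotated])
      then show False
        using pd p1 by simp
    qed
    then show ?thesis
      using p(1) prime_imp_coprime by blast
  qed
  have order: "[p ^ d = 1] (mod n)"
    using n(2) pd by (metis cong_altdef_nat less_imp_le)
  obtain I :: "int poly set" where I: "prime_ring_ideal I" "of_nat p \<in> I"
    and X: "\<And>k. monom 1 k - 1 \<in> I \<longleftrightarrow> n dvd k"
    using ex_prime_ideal_with_root_of_unity[OF p(1) n(1) cop] by blast
  interpret prime_ring_ideal I by fact
  write eqv (infix \<open>\<simeq>\<close> 50)
  have X_diff: "monom 1 k - monom 1 l \<in> I \<longleftrightarrow> [k = l] (mod n)" for k l
  proof -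
    have *: "monom 1 k - monom 1 l \<in> I \<longleftrightarrow> n dvd l - k" if "k \<le> l" for k l
    proof -
      have "monom 1 k * (monom 1 (l - k) - 1) = monom 1 l - monom (1::int) k"
        using that by (simp add: algebra_simps mult_monom)
      then have "monom 1 k - monom 1 l \<in> I \<longleftrightarrow> monom 1 k * (monom 1 (l - k) - 1) \<in> I"
        using minus_mem by (metis minus_diff_eq)
      also have "\<dots> \<longleftrightarrow> monom 1 (l - k) - 1 \<in> I"
      proof
        assume "monom 1 k * (monom 1 (l - k) - 1) \<in> I"
        moreover have "monom 1 k \<notin> I"
        proof
          assume "monom 1 k \<in> I"
          then have "monom 1 k * monom 1 (k * (n - 1)) \<in> I"
            by (rule mult_mem')
          moreover have "k + k * (n - 1) = k * n"
            using n(1) by (cases n) auto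
          ultimately have "monom 1 (k * n) \<in> I"
            by (simp only: mult_monom mult_1)
          moreover have "monom 1 (k * n) - 1 \<in> I"
            by (simp add: X)
          ultimately show False
            using one_not_mem diff_mem by fastforce
        qed
        ultimately show "monom 1 (l - k) - 1 \<in> I"
          using prime_mem by blast
      qed (rule mult_mem)
      finally show ?thesis
        by (simp add: X)
    qed
    show ?thesis
    proof (cases "k \<le> l")
      case True
      then show ?thesis
        using * by (metis cong_altdef_nat cong_sym_eq)
    next
      case False
      then have "monom 1 k - monom 1 l \<in> I \<longleftrightarrow> monom 1 l - monom 1 k \<in> I"
        using minus_mem by (metis minus_diff_eq)
      then show ?thesis
        using * False by (metis cong_altdef_nat nat_le_linear)
    qed
  qed
  define w :: "nat \<Rightarrow> int poly" where "w j = monom 1 j" for j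
  have w_pow: "w j ^ k = monom 1 (j * k)" for j k
    by (simp add: w_def monom_power)
  define \<beta> where "\<beta> j i = w j ^ (p ^ i)" for j i
  \<comment> \<open>As in the field with p^d elements: \<open>a\<close> satisfies a^(p^d) = a modulo
    \<open>I\<close> and, not being in \<open>I\<close>, can be cancelled once.\<close>
  have diff_unit: "(\<beta> j i - \<beta> j k) ^ (p ^ d - 1) \<simeq> 1"
    if j: "j \<in> ?S" and ik: "i < d" "k < d" "i \<noteq> k" for j i k
  proof -
    define a where "a = \<beta> j i - \<beta> j k"
    have "a \<notin> I"
    proof
      have *: False if "a < b" "b < d" "[j * p ^ a = j * p ^ b] (mod n)" for a b
      proof -
        have "p ^ a \<le> p ^ b"
          using \<open>a < b\<close> p1 by (intro power_increasing) auto
        then have "n dvd j * p ^ b - j * p ^ a"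
          using that(3) by (metis cong_altdef_nat cong_sym_eq mult_le_mono2)
        also have "j * p ^ b - j * p ^ a = p ^ a * (j * (p ^ (b - a) - 1))"
        proof -
          have "p ^ b = p ^ a * p ^ (b - a)"
            using \<open>a < b\<close> by (simp flip: power_add)
          then have "j * p ^ b - j * p ^ a = j * (p ^ a * p ^ (b - a)) - j * p ^ a"
            by (rule arg_cong)
          also have "\<dots> = p ^ a * (j * (p ^ (b - a) - 1))"
            by (simp only: diff_mult_distrib2 mult.assoc mult.left_commute mult.commute mult_1_right)
          finally show ?thesis .
        qed
        finally have "n dvd p ^ a * (j * (p ^ (b - a) - 1))" .
        moreover have "coprime n (p ^ a)"
          using cop by (simp add: ac_simps)
        ultimately have "n dvd j * (p ^ (b - a) - 1)"
          by (simp add: GCD.coprime_dvd_mult_right_iff)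
        moreover have "b - a \<in> {1..<d}"
          using that by auto
        ultimately show False
          using j by auto
      qed
      assume "a \<in> I"
      then have "[j * p ^ i = j * p ^ k] (mod n)"
        by (simp add: a_def \<beta>_def w_pow X_diff)
      then show False
        using *[of i k] *[of k i] ik cong_sym by (metis linorder_neqE_nat)
    qed
    have "a ^ (p ^ l) \<simeq> \<beta> j i ^ (p ^ l) - \<beta> j k ^ (p ^ l)" for l
    proof (induction l)
      case (Suc l)
      have "a ^ (p ^ Suc l) = (a ^ (p ^ l)) ^ p"
        by (simp add: mult.commute flip: power_mult)
      also have "\<dots> \<simeq> (\<beta> j i ^ (p ^ l) - \<beta> j k ^ (p ^ l)) ^ p"
        by (rule eqv_power[OF Suc])
      also have "\<dots> \<simeq> (\<beta> j i ^ (p ^ l)) ^ p - (\<beta> j k ^ (p ^ l)) ^ p"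
        by (rule freshman_diff[OF p(1) I(2)])
      finally show ?case
        by (simp add: mult.commute flip: power_mult)
    qed (simp add: a_def)
    also have "\<beta> j i ^ (p ^ d) - \<beta> j k ^ (p ^ d) \<simeq> \<beta> j i - \<beta> j k"
    proof -
      have "\<beta> j l ^ (p ^ d) \<simeq> \<beta> j l" for l
        using cong_mult[OF cong_refl order, of "j * p ^ l"]
        by (simp add: eqv_def \<beta>_def w_pow X_diff monom_power)
      then show ?thesis
        by (intro eqv_diff)
    qed
    finally have "a ^ (p ^ d) \<simeq> a"
      by (simp add: a_def)
    moreover have "a ^ (p ^ d) = a * a ^ (p ^ d - 1)"
    proof -
      have "0 < p ^ d"
        using pd by linarith
      from power_minus_mult[OF this, of a] show ?thesis
        by (simp add: mult.commute)
    qed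
    ultimately have "a * (a ^ (p ^ d - 1) - 1) \<in> I"
      by (simp add: eqv_def algebra_simps)
    then show ?thesis
      using \<open>a \<notin> I\<close> prime_mem by (auto simp: eqv_def a_def)
  qed
  have ex: "\<exists>f. f \<in> poly_mod_carrier p \<and> monic f \<and> degree f = d \<and>
      (\<forall>k. of_int (coeff f k) \<simeq> coeff (\<Prod>i<d. [:- \<beta> j i, 1:]) k)" for j
  proof -
    have "\<beta> j i ^ p \<simeq> \<beta> j (Suc i)" for i
      by (simp add: \<beta>_def mult.commute flip: power_mult)
    moreover have "\<beta> j d \<simeq> \<beta> j 0"
      using cong_mult[OF cong_refl order, of j] unfolding eqv_def \<beta>_def w_pow X_diff by simp
    ultimately have "coeff (\<Prod>i<d. [:- \<beta> j i, 1:]) k ^ p \<simeq> coeff (\<Prod>i<d. [:- \<beta> j i, 1:]) k" for k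
      using d by (intro coeffs_fixed_by_frobenius p(1) I(2)) auto
    then show ?thesis
      using ex_int_poly_eqv[OF p(1) I(2) degree_prod_linear(2) degree_prod_linear(1)] by blast
  qed
  then obtain f where f: "\<And>j. f j \<in> poly_mod_carrier p" "\<And>j. monic (f j)" "\<And>j. degree (f j) = d"
      "\<And>j k. of_int (coeff (f j) k) \<simeq> coeff (\<Prod>i<d. [:- \<beta> j i, 1:]) k"
    by metis
  have roots: "frobenius_roots I (w j) p n d (p ^ d - 2) N (int p) (f j)" if j: "j \<in> ?S" for j
  proof
    show "of_int a \<in> I \<longleftrightarrow> int p dvd a" for a
      by (rule of_int_mem_iff[OF p(1) I(2)])
    show "w j ^ n \<simeq> 1"
      by (simp add: eqv_def w_pow X)
    have "Suc (p ^ d - 2) = p ^ d - 1"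
      using pd by simp
    then show "(w j ^ p ^ i - w j ^ p ^ k) ^ Suc (p ^ d - 2) \<simeq> 1"
      if "i < d" "k < d" "i \<noteq> k" for i k
      using diff_unit[OF j that] by (simp only: \<beta>_def)
    show "of_int (coeff (f j) k) \<simeq> coeff (\<Prod>i<d. [:- (w j ^ p ^ i), 1:]) k" for k
      using f(4)[of j k] by (simp add: \<beta>_def)
  qed (use n d N order one_not_mem f in auto)
  have good: "f j \<in> ?G" if j: "j \<in> ?S" for j
  proof -
    interpret r: frobenius_roots I "w j" p n d "p ^ d - 2" N "int p" "f j"
      by (rule roots[OF j])
    show ?thesis
      using f r.pseudoprime_mod r.Legendre_discriminant[OF p refl refl]
      by (simp add: good_polys_def Jacobi_prime p(1))
  qed
  have "card {k \<in> ?S. f k = f j} \<le> d" if j: "j \<in> ?S" for j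
  proof -
    have "{k \<in> ?S. f k = f j} \<subseteq> (\<lambda>i. j * p ^ i mod n) ` {..<d}"
    proof
      fix k assume k: "k \<in> {k \<in> ?S. f k = f j}"
      interpret r: frobenius_roots I "w k" p n d "p ^ d - 2" N "int p" "f k"
        using k by (intro roots) auto
      have "poly (of_int_poly (f k)) (w k) \<in> I"
        using r.ev_root[of "w k" 0] by (simp add: r.\<beta>_def)
      then have "poly (of_int_poly (f j)) (w k) \<in> I"
        using k by simp
      moreover have "poly (of_int_poly (f j)) (w k) \<simeq> poly (\<Prod>i<d. [:- \<beta> j i, 1:]) (w k)"
        using f(4)[of j] by (intro eqv_poly) auto
      ultimately have "(\<Prod>i<d. w k - \<beta> j i) \<in> I"
        using mem_eqv by (auto simp: poly_prod)
      then obtain i where i: "i < d" "w k - \<beta> j i \<in> I"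
        using prod_mem_imp[of "{..<d}"] by auto
      then have "[k = j * p ^ i] (mod n)"
        by (simp add: \<beta>_def w_pow) (simp add: w_def X_diff)
      then show "k \<in> (\<lambda>i. j * p ^ i mod n) ` {..<d}"
        using i(1) k by (auto simp: cong_def)
    qed
    then have "card {k \<in> ?S. f k = f j} \<le> card ((\<lambda>i. j * p ^ i mod n) ` {..<d})"
      by (intro card_mono) auto
    also have "\<dots> \<le> d"
      using card_image_le[of "{..<d}" "\<lambda>i. j * p ^ i mod n"] by simp
    finally show ?thesis .
  qed
  then have "card ?S \<le> d * card (f ` ?S)"
    by (intro card_le_mult_card_image) auto
  also have "\<dots> \<le> d * card ?G"
    using good finite_good_polys[OF prime_gt_0_nat[OF p(1)]] by (intro mult_le_mono card_mono) auto
  finally show ?thesis .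
qed

section \<open>Gluing coprime moduli\<close>

lemma poly_ideal_dvd_iff: "g \<in> poly_ideal {a :: int. m dvd a} \<longleftrightarrow> [:m:] dvd g"
  by (simp add: poly_ideal_def const_poly_dvd_iff)

lemma eq_m_iff: "poly_mod.eq_m m f g \<longleftrightarrow> [:m:] dvd f - g"
  by (simp add: poly_eq_iff poly_mod.Mp_coeff poly_mod.M_def const_poly_dvd_iff mod_eq_dvd_iff)

lemma eq_m_imp_monic_discriminant_cong:
  assumes "[:m:] dvd f - g" "degree f = degree g"
  shows "[monic_discriminant f = monic_discriminant g] (mod m)"
proof -
  interpret ring_ideal "{a :: int. m dvd a}"
    by (rule ring_ideal_dvd)
  have coeff: "eqv (coeff f k) (coeff g k)" for k
    using assms(1) by (simp add: eqv_def const_poly_dvd_iff)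
  have "eqv (resultant f (pderiv f)) (resultant g (pderiv g))"
  proof (rule resultant_eqv)
    show "eqv (coeff (pderiv f) k) (coeff (pderiv g) k)" for k
      unfolding coeff_pderiv by (intro eqv_mult eqv_refl coeff)
  qed (use assms(2) coeff in \<open>simp_all add: degree_pderiv\<close>)
  then show ?thesis
    unfolding monic_discriminant_def assms(2)
    by (intro cong_mult cong_refl) (simp add: eqv_def cong_iff_dvd_diff)
qed

lemma pseudoprime_mod_cong:
  assumes "pseudoprime_mod N d m f" and dvd: "[:m:] dvd f - g" and deg: "degree f = degree g"
  shows "pseudoprime_mod N d m g"
proof -
  obtain k where f: "f = g + [:m:] * k"
    using dvd by (metis add.commute diff_add_cancel dvdE)
  have "\<exists>h. [:m:] dvd x - g * h" if "[:m:] dvd x - f * h" for x h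
  proof -
    have "x - g * h = (x - f * h) + [:m:] * (k * h)"
      by (simp add: f algebra_simps)
    then show ?thesis
      using that by (metis dvd_add dvd_triv_left)
  qed
  moreover have "\<exists>h. [:m:] dvd pcompose g q - g * h" if "[:m:] dvd pcompose f q - f * h" for q h
  proof -
    have "pcompose g q - g * h = (pcompose f q - f * h) + [:m:] * (k * h - pcompose k q)"
      by (simp add: f pcompose_add pcompose_mult pcompose_smult algebra_simps)
    then show ?thesis
      using that by (metis dvd_add dvd_triv_left)
  qed
  moreover have "\<exists>a b. [:m:] dvd a * x + b * g - 1" if "[:m:] dvd a * x + b * f - 1" for a b x
  proof -
    have "a * x + b * g - 1 = (a * x + b * f - 1) + [:m:] * (- b * k)"
      by (simp add: f algebra_simps)
    then show ?thesis
      using that by (metis dvd_add dvd_triv_left)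
  qed
  moreover have "coprime m (poly g 0 * monic_discriminant g)"
  proof -
    have "[poly f 0 = poly g 0] (mod m)"
      by (simp add: f cong_iff_dvd_diff)
    then have "[poly f 0 * monic_discriminant f = poly g 0 * monic_discriminant g] (mod m)"
      using eq_m_imp_monic_discriminant_cong[OF dvd deg] by (intro cong_mult)
    then show ?thesis
      using assms(1) unfolding pseudoprime_mod_def by (metis cong_imp_coprime Rings.coprime_commute)
  qed
  ultimately show ?thesis
    using assms(1) unfolding pseudoprime_mod_def poly_ideal_dvd_iff by meson
qed

lemma bezout_coprime_int:
  fixes a b :: int
  assumes "coprime a b"
  shows "\<exists>u v. u * a + v * b = 1"
proof -
  obtain u v where "u * a + v * b = gcd a b"
    using bezout_int by blast
  also have "\<dots> = 1"
    using assms by (rule GCD.coprime_imp_gcd_eq_1)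
  finally show ?thesis by blast
qed

lemma pseudoprime_mod_coprime_mult:
  assumes "pseudoprime_mod N d m1 f" "pseudoprime_mod N d m2 f" and cop: "coprime m1 m2"
  shows "pseudoprime_mod N d (m1 * m2) f"
proof -
  obtain u v where uv: "u * m1 + v * m2 = 1"
    using bezout_coprime_int[OF cop] by blast
  \<comment> \<open>\<open>V\<close> is 1 modulo \<open>m1\<close> and 0 modulo \<open>m2\<close>,
    and \<open>U\<close> the reverse: the idempotents of the Chinese remainder theorem.\<close>
  define U V where "U = [:u * m1:]" and "V = [:v * m2:]"
  have UV: "V = 1 - U"
  proof -
    have "v * m2 = 1 - u * m1"
      using uv by simp
    then show ?thesis
      by (simp only: U_def V_def one_pCons diff_pCons diff_self)
  qed
  have comb: "[:m1 * m2:] dvd V * x + U * y" if "[:m1:] dvd x" "[:m2:] dvd y" for x y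
  proof (rule dvd_add)
    have "[:m2:] * [:m1:] dvd V * x"
      unfolding V_def using that(1) by (intro mult_dvd_mono) (auto simp: const_poly_dvd)
    then show "[:m1 * m2:] dvd V * x"
      by (simp add: mult.commute)
    have "[:m1:] * [:m2:] dvd U * y"
      unfolding U_def using that(2) by (intro mult_dvd_mono) (auto simp: const_poly_dvd)
    then show "[:m1 * m2:] dvd U * y"
      by (simp add: mult.commute)
  qed
  have "\<exists>h. [:m1 * m2:] dvd x - f * h" if "[:m1:] dvd x - f * h1" "[:m2:] dvd x - f * h2" for x h1 h2
  proof -
    have "V * (x - f * h1) + U * (x - f * h2) = x - f * (V * h1 + U * h2)"
      by (simp add: UV algebra_simps)
    then show ?thesis
      using comb[OF that] by metis
  qed
  moreover have "\<exists>a b. [:m1 * m2:] dvd a * x + b * f - 1"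
    if "[:m1:] dvd a1 * x + b1 * f - 1" "[:m2:] dvd a2 * x + b2 * f - 1" for x a1 a2 b1 b2
  proof -
    have "V * (a1 * x + b1 * f - 1) + U * (a2 * x + b2 * f - 1) =
        (V * a1 + U * a2) * x + (V * b1 + U * b2) * f - 1"
      by (simp add: UV algebra_simps)
    then show ?thesis
      using comb[OF that] by metis
  qed
  moreover have "coprime (m1 * m2) (poly f 0 * monic_discriminant f)"
    using assms(1,2) unfolding pseudoprime_mod_def by (metis coprime_mult_left_iff)
  ultimately show ?thesis
    using assms(1,2) unfolding pseudoprime_mod_def poly_ideal_dvd_iff by meson
qed

lemma Jacobi_cong:
  assumes "[a = b] (mod int n)"
  shows "Jacobi a n = Jacobi b n"
proof -
  have "Legendre a (int p) = Legendre b (int p)" if "p \<in> prime_factors n" for p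
  proof -
    have "[a = b] (mod int p)"
      using assms that by (metis cong_dvd_modulus in_prime_factors_imp_dvd of_nat_dvd_iff)
    then have "[a = 0] (mod int p) \<longleftrightarrow> [b = 0] (mod int p)" "QuadRes (int p) a \<longleftrightarrow> QuadRes (int p) b"
      unfolding QuadRes_def by (meson cong_sym cong_trans)+
    then show ?thesis
      by (simp add: Legendre_def)
  qed
  then show ?thesis
    unfolding Jacobi_def by (intro arg_cong[of _ _ prod_mset] image_mset_cong) auto
qed

lemma Jacobi_mult: "m > 0 \<Longrightarrow> n > 0 \<Longrightarrow> Jacobi a (m * n) = Jacobi a m * Jacobi a n"
  by (simp add: Jacobi_def prime_factorization_mult)

text \<open>Coefficientwise Chinese remaindering. The glued polynomial keeps degree d and leading
  coefficient 1 because both parts are monic of the same degree.\<close>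

lemma card_good_polys_mult:
  assumes m: "m1 > 1" "m2 > 1" and cop: "coprime m1 m2"
  shows "card (good_polys N d m1 s1) * card (good_polys N d m2 s2) \<le> card (good_polys N d (m1 * m2) (s1 * s2))"
proof -
  obtain u v where uv: "u * int m1 + v * int m2 = 1"
  proof -
    have "coprime (int m1) (int m2)"
      using cop by simp
    then show ?thesis
      using that bezout_coprime_int by blast
  qed
  define \<Phi> where "\<Phi> = (\<lambda>(f1, f2). poly_mod.Mp (int (m1 * m2)) (smult (v * int m2) f1 + smult (u * int m1) f2))"
  have dvd: "[:int m1:] dvd f1 - \<Phi> (f1, f2)" "[:int m2:] dvd f2 - \<Phi> (f1, f2)" for f1 f2
  proof -
    define g where "g = smult (v * int m2) f1 + smult (u * int m1) f2"
    have "poly_mod.eq_m (int (m1 * m2)) g (\<Phi> (f1, f2))"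
      by (simp add: \<Phi>_def g_def poly_mod.Mp_Mp)
    then have g: "[:int (m1 * m2):] dvd g - \<Phi> (f1, f2)"
      unfolding eq_m_iff .
    have v: "v * int m2 = 1 - u * int m1"
      using uv by simp
    have "f1 - g = smult (u * int m1) (f1 - f2)"
      unfolding g_def v smult_diff_left smult_diff_right by simp
    then have "[:int m1:] dvd f1 - g"
      by (intro dvdI[of _ _ "smult u (f1 - f2)"]) simp
    moreover have "[:int m1:] dvd g - \<Phi> (f1, f2)"
      using g by (rule dvd_trans[rotated]) (simp add: const_poly_dvd)
    ultimately have "[:int m1:] dvd (f1 - g) + (g - \<Phi> (f1, f2))"
      by (rule dvd_add)
    then show "[:int m1:] dvd f1 - \<Phi> (f1, f2)"
      by simp
    have u: "u * int m1 = 1 - v * int m2"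
      using uv by simp
    have "f2 - g = smult (v * int m2) (f2 - f1)"
      unfolding g_def u smult_diff_left smult_diff_right by simp
    then have "[:int m2:] dvd f2 - g"
      by (intro dvdI[of _ _ "smult v (f2 - f1)"]) simp
    moreover have "[:int m2:] dvd g - \<Phi> (f1, f2)"
      using g by (rule dvd_trans[rotated]) (simp add: const_poly_dvd)
    ultimately have "[:int m2:] dvd (f2 - g) + (g - \<Phi> (f1, f2))"
      by (rule dvd_add)
    then show "[:int m2:] dvd f2 - \<Phi> (f1, f2)"
      by simp
  qed
  let ?G1 = "good_polys N d m1 s1" and ?G2 = "good_polys N d m2 s2"
  have "\<Phi> ` (?G1 \<times> ?G2) \<subseteq> good_polys N d (m1 * m2) (s1 * s2)"
  proof (clarify)
    fix f1 f2 assume f1: "f1 \<in> ?G1" and f2: "f2 \<in> ?G2"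
    define f where "f = \<Phi> (f1, f2)"
    have f_coeff: "coeff f k = (v * int m2 * coeff f1 k + u * int m1 * coeff f2 k) mod int (m1 * m2)" for k
      by (simp add: f_def \<Phi>_def poly_mod.Mp_coeff poly_mod.M_def)
    have carrier: "f \<in> poly_mod_carrier (m1 * m2)"
      by (simp add: poly_mod_carrier_iff f_coeff)
    have lead: "coeff f d = 1"
    proof -
      have "1 < m1 * m2"
        using m by (simp add: one_less_mult)
      then have "(1 :: int) mod int (m1 * m2) = 1"
        by (simp del: of_nat_mult)
      moreover have "v * int m2 * coeff f1 d + u * int m1 * coeff f2 d = 1"
        using uv f1 f2 by (auto simp: good_polys_def algebra_simps)
      ultimately show ?thesis
        by (simp only: f_coeff)
    qed
    have "coeff f k = 0" if "k > d" for k
      using f1 f2 that by (simp add: f_coeff good_polys_def coeff_eq_0)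
    then have deg: "degree f = d"
      using lead by (intro antisym degree_le le_degree) auto
    have g1: "degree f1 = d" "pseudoprime_mod N d (int m1) f1" "Jacobi (monic_discriminant f1) m1 = s1"
      and g2: "degree f2 = d" "pseudoprime_mod N d (int m2) f2" "Jacobi (monic_discriminant f2) m2 = s2"
      using f1 f2 by (simp_all add: good_polys_def)
    have dvd1: "[:int m1:] dvd f1 - f" and dvd2: "[:int m2:] dvd f2 - f"
      using dvd(1)[of f1 f2] dvd(2)[of f2 f1] by (simp_all only: f_def)
    have p1: "pseudoprime_mod N d (int m1) f"
      by (rule pseudoprime_mod_cong[OF g1(2) dvd1]) (simp only: g1 deg)
    have p2: "pseudoprime_mod N d (int m2) f"
      by (rule pseudoprime_mod_cong[OF g2(2) dvd2]) (simp only: g2 deg)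
    have "pseudoprime_mod N d (int (m1 * m2)) f"
      using pseudoprime_mod_coprime_mult[OF p1 p2] cop by simp
    moreover have "Jacobi (monic_discriminant f) m1 = s1" "Jacobi (monic_discriminant f) m2 = s2"
      using Jacobi_cong[OF eq_m_imp_monic_discriminant_cong[OF dvd1]]
        Jacobi_cong[OF eq_m_imp_monic_discriminant_cong[OF dvd2]] g1 g2 deg by simp_all
    ultimately have "f \<in> good_polys N d (m1 * m2) (s1 * s2)"
      using carrier deg lead m by (simp add: good_polys_def Jacobi_mult)
    then show "\<Phi> (f1, f2) \<in> good_polys N d (m1 * m2) (s1 * s2)"
      by (simp add: f_def)
  qed
  moreover have "inj_on \<Phi> (?G1 \<times> ?G2)"
  proof -
    have unique: "f = g" if "f \<in> poly_mod_carrier n" "g \<in> poly_mod_carrier n" "[:int n:] dvd f - g" for f g n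
      using that unfolding poly_mod_carrier_def eq_m_iff[symmetric] by simp
    show ?thesis
    proof (rule inj_onI, clarify)
      fix f1 f2 g1 g2
      assume G: "f1 \<in> ?G1" "f2 \<in> ?G2" "g1 \<in> ?G1" "g2 \<in> ?G2" and eq: "\<Phi> (f1, f2) = \<Phi> (g1, g2)"
      have "[:int m1:] dvd (f1 - \<Phi> (f1, f2)) - (g1 - \<Phi> (g1, g2))"
        "[:int m2:] dvd (f2 - \<Phi> (f1, f2)) - (g2 - \<Phi> (g1, g2))"
        by (intro dvd_diff dvd)+
      then have "[:int m1:] dvd f1 - g1" "[:int m2:] dvd f2 - g2"
        by (simp_all add: eq)
      then show "f1 = g1 \<and> f2 = g2"
        using G unique by (auto simp: good_polys_def)
    qed
  qed
  moreover have "finite (good_polys N d (m1 * m2) (s1 * s2))"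
    using m by (intro finite_good_polys) auto
  ultimately have "card (?G1 \<times> ?G2) \<le> card (good_polys N d (m1 * m2) (s1 * s2))"
    by (metis card_inj_on_le)
  then show ?thesis
    by (simp add: card_cartesian_product)
qed

lemma prod_card_good_polys_le:
  assumes "finite A" "A \<noteq> {}" "\<And>p. p \<in> A \<Longrightarrow> prime p"
  shows "(\<Prod>p\<in>A. card (good_polys N d p s)) \<le> card (good_polys N d (\<Prod>A) (s ^ card A))"
  using assms
proof (induction A rule: finite_ne_induct)
  case (insert p A)
  have "coprime p (\<Prod>A)"
  proof (rule prod_coprime_right)
    fix x assume "x \<in> A"
    then have "x \<noteq> p" "prime x" "prime p"
      using insert.hyps insert.prems by auto
    then show "coprime p x"
      using primes_coprime[of p x] by simp
  qed
  moreover have "\<Prod>A > 1"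
  proof -
    obtain x where x: "x \<in> A"
      using insert.hyps by blast
    then have "x \<le> \<Prod>A"
      using insert.hyps insert.prems prime_gt_0_nat
      by (intro dvd_imp_le dvd_prodI[where f = "\<lambda>x. x", simplified] prod_pos) auto
    then show ?thesis
      using insert.prems[of x] x prime_gt_1_nat[of x] by simp
  qed
  ultimately have "card (good_polys N d p s) * card (good_polys N d (\<Prod>A) (s ^ card A)) \<le>
      card (good_polys N d (p * \<Prod>A) (s * s ^ card A))"
    using insert.prems prime_gt_1_nat by (intro card_good_polys_mult) auto
  moreover have "(\<Prod>p\<in>A. card (good_polys N d p s)) \<le> card (good_polys N d (\<Prod>A) (s ^ card A))"
    using insert by auto
  ultimately show ?case
    using insert.hyps by simp (meson le_trans mult_le_mono2)
qed simp

text \<open>The polynomial with roots z^(b^i) splits over the integers modulo \<open>q\<close>.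
  Since \<open>b\<close> has order exactly d modulo \<open>s\<close>, the exponents are distinct
  modulo \<open>s\<close>, so the differences of the roots are prime to \<open>q\<close>, whether or
  not \<open>q\<close> is prime.\<close>

lemma good_polys_root_of_unity_nonempty:
  assumes q: "q > 1" and s: "s > 0" "[z ^ s = 1] (mod int q)"
    and z: "\<And>j. j \<in> {1..<s} \<Longrightarrow> coprime (int q) (z ^ j - 1)"
    and d: "d > 0" "[b ^ d = 1] (mod s)" "\<And>i. i \<in> {1..<d} \<Longrightarrow> [b ^ i \<noteq> 1] (mod s)"
    and N: "[N = b] (mod s)"
  shows "good_polys N d q 1 \<noteq> {}"
proof -
  interpret ring_ideal "{a :: int. int q dvd a}"
    by (rule ring_ideal_dvd)
  write eqv (infix \<open>\<simeq>\<close> 50)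
  have eqv_iff: "x \<simeq> y \<longleftrightarrow> [x = y] (mod int q)" for x y
    by (simp add: eqv_def cong_iff_dvd_diff)
  define P where "P = (\<Prod>i<d. [:- (z ^ (b ^ i)), 1:])"
  define f where "f = poly_mod.Mp (int q) P"
  have P: "degree P = d" "coeff P d = 1"
    using degree_prod_linear[of "\<lambda>i. z ^ (b ^ i)" d] by (simp_all add: P_def)
  have f_mod: "coeff f k = coeff P k mod int q" for k
    by (simp add: f_def poly_mod.Mp_coeff poly_mod.M_def)
  have f: "coeff f d = 1"
    using P(2) q by (simp add: f_mod)
  have "degree f = d"
    using P(1) f by (intro antisym degree_le le_degree) (auto simp: f_mod coeff_eq_0)
  note f = \<open>degree f = d\<close> f
  have s_cop: "coprime b s"
    using cong_imp_coprime[OF cong_sym[OF d(2)]] d(1) by simp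
  have q_cop: "coprime (int q) z"
    using cong_imp_coprime[OF cong_sym[OF s(2)]] s(1) by (simp add: ac_simps)
  have cop: "coprime (int q) (z ^ (b ^ i) - z ^ (b ^ j))" if "i < d" "j < d" "i \<noteq> j" for i j
  proof -
    have *: "coprime (int q) (z ^ k - z ^ l)" if kl: "\<not> [k = l] (mod s)" "l \<le> k" for k l
    proof -
      define r where "r = (k - l) mod s"
      have "r \<in> {1..<s}"
        using kl s(1) by (auto simp: r_def Suc_le_eq cong_altdef_nat cong_sym_eq mod_greater_zero_iff_not_dvd)
      have "[z ^ s ^ 1 = 1] (mod int q)"
        using s by simp
      have "z ^ (k - l) = (z ^ s) ^ ((k - l) div s) * z ^ r"
        unfolding r_def by (metis div_mult_mod_eq mult.commute power_add power_mult)
      then have "[z ^ (k - l) = 1 ^ ((k - l) div s) * z ^ r] (mod int q)"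
        using s(2) by (simp only:) (intro cong_mult cong_pow cong_refl)
      then have "[z ^ (k - l) - 1 = z ^ r - 1] (mod int q)"
        by (intro cong_diff) simp_all
      then have "coprime (int q) (z ^ (k - l) - 1)"
        using z[OF \<open>r \<in> {1..<s}\<close>] by (metis cong_imp_coprime cong_sym Rings.coprime_commute)
      moreover have "z ^ k - z ^ l = z ^ l * (z ^ (k - l) - 1)"
        using kl(2) by (simp add: algebra_simps flip: power_add)
      ultimately show ?thesis
        using q_cop by simp
    qed
    have neq: "\<not> [b ^ k = b ^ l] (mod s)" if "l < k" "k < d" for k l
    proof
      assume "[b ^ k = b ^ l] (mod s)"
      moreover have "b ^ k = b ^ l * b ^ (k - l)"
        using that by (simp flip: power_add)
      ultimately have "[b ^ l * b ^ (k - l) = b ^ l * 1] (mod s)"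
        by simp
      moreover have "coprime (b ^ l) s"
        using s_cop by simp
      ultimately have "[b ^ (k - l) = 1] (mod s)"
        using cong_mult_lcancel_nat by blast
      moreover have "k - l \<in> {1..<d}"
        using that by auto
      ultimately show False
        using d(3) by blast
    qed
    have "\<not> [b ^ i = b ^ j] (mod s)"
      using neq[of i j] neq[of j i] that by (metis cong_sym linorder_neqE_nat)
    then show ?thesis
    proof (cases "b ^ j \<le> b ^ i")
      case True
      then show ?thesis
        using * \<open>\<not> [b ^ i = b ^ j] (mod s)\<close> by blast
    next
      case False
      then have "coprime (int q) (- (z ^ (b ^ i) - z ^ (b ^ j)))"
        using *[of "b ^ j" "b ^ i"] \<open>\<not> [b ^ i = b ^ j] (mod s)\<close> cong_sym by fastforce
      then show ?thesis
        by (simp only: coprime_minus_right_iff)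
    qed
  qed
  \<comment> \<open>Euler's theorem supplies the exponent for the unit condition of the
    locale.\<close>
  have unit: "x ^ Suc (totient q - 1) \<simeq> 1" if "coprime (int q) x" for x
  proof -
    have "coprime x (int q)"
      using that by (simp add: Rings.coprime_commute)
    then have "coprime (nat (x mod int q)) q"
      using q by (metis coprime_mod_left_iff int_nat_eq of_nat_0_less_iff coprime_int_iff
          less_trans pos_mod_sign zero_less_one_class.zero_less_one zero_neq_one of_nat_eq_0_iff less_irrefl)
    then have "[nat (x mod int q) ^ totient q = 1] (mod q)"
      by (rule euler_theorem)
    then have "[int (nat (x mod int q) ^ totient q) = int 1] (mod int q)"
      by (simp only: cong_int_iff)
    moreover have "int (nat (x mod int q)) = x mod int q"
      using q by simp
    ultimately have "[(x mod int q) ^ totient q = 1] (mod int q)"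
      by simp
    moreover have "[x ^ totient q = (x mod int q) ^ totient q] (mod int q)"
      by (intro cong_pow) (simp add: cong_def)
    ultimately have "[x ^ totient q = 1] (mod int q)"
      using cong_trans by blast
    moreover have "Suc (totient q - 1) = totient q"
      using q by simp
    ultimately show ?thesis
      by (simp only: eqv_iff)
  qed
  have roots: "frobenius_roots {a :: int. int q dvd a} z b s d (totient q - 1) N (int q) f"
  proof
    show "of_int (coeff f k) \<simeq> coeff (\<Prod>i<d. [:- (z ^ b ^ i), 1:]) k" for k
      unfolding P_def[symmetric] f_mod eqv_iff by (simp add: cong_def)
    show "(z ^ b ^ i - z ^ b ^ j) ^ Suc (totient q - 1) \<simeq> 1" if "i < d" "j < d" "i \<noteq> j" for i j
      by (rule unit[OF cop[OF that]])
  qed (use assms f in \<open>auto simp: eqv_iff\<close>)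
  interpret frobenius_roots "{a :: int. int q dvd a}" z b s d "totient q - 1" N "int q" f
    by (rule roots)
  have "f \<in> poly_mod_carrier q"
    by (simp add: poly_mod_carrier_iff f_mod)
  then have "f \<in> good_polys N d q 1"
    using f pseudoprime_mod Jacobi_discriminant_square[OF roots refl] by (simp add: good_polys_def)
  then show ?thesis
    by blast
qed

text \<open>A d-cycle has a single orbit, of length d, so the exponent in the Jacobi step is 1 for
  even d and 0 for odd d; this is the sign \<open>s\<close>.\<close>

lemma card_good_polys_le_L_count:
  assumes d: "d > 0" "cyclic_on \<sigma> {1..d}" and N: "N > 1" "odd N"
    and s: "s = (if even d then -1 else 1)"
  shows "card (good_polys N d N s) \<le> L_count d \<sigma> N"
proof -
  have count: "perm_cycle_count d \<sigma> i = (if i = d then 1 else 0)" if "i \<in> {1..d}" for i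
  proof -
    have "orbit \<sigma> x = {1..d}" if "x \<in> {1..d}" for x
      using d(2) that by (simp add: orbit_cyclic_eq3)
    then have "orbit \<sigma> ` {1..d} = {{1..d}}"
      using d(1) by (auto intro!: image_eqI[of _ _ 1])
    then have "{C \<in> orbit \<sigma> ` {1..d}. card C = i} = (if i = d then {{1..d}} else {})"
      by auto
    then show ?thesis
      by (simp add: perm_cycle_count_def)
  qed
  have "good_polys N d N s \<subseteq> {f. degree f = d \<and> (\<exists>F. frobenius_pseudoprime N f F \<and>
      (\<forall>i\<in>{1..d}. cycle_structure F i = perm_cycle_count d \<sigma> i))}"
  proof clarify
    fix f assume f: "f \<in> good_polys N d N s"
    then have carrier: "f \<in> poly_mod_carrier N" and deg: "degree f = d" and monic: "monic f"
      and pp: "pseudoprime_mod N d (int N) f" and jac: "Jacobi (monic_discriminant f) N = s"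
      by (auto simp: good_polys_def)
    have one: "1 \<in> poly_mod_carrier N"
      using N(1) by (simp add: poly_mod_carrier_iff)
    \<comment> \<open>Nothing splits off before stage \<open>d\<close>, and there the gcmd is
      \<open>f\<close> itself.\<close>
    define F where "F i = (if i = d then f else 1)" for i
    define g where "g i = (if i = d then 1 else f)" for i
    have gcd_d: "is_gcmd N (monom 1 (N ^ d) - monom 1 1) f f"
    proof -
      obtain k where k: "[:int N:] dvd monom 1 (N ^ d) - monom 1 1 - f * k"
        using pp by (auto simp: pseudoprime_mod_def poly_ideal_dvd_iff)
      let ?G = "monom 1 (N ^ d) - monom 1 1"
      have "(\<exists>a. [:int N:] dvd h - a * f) \<longleftrightarrow> (\<exists>a b. [:int N:] dvd h - (a * ?G + b * f))" for h
      proof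
        assume "\<exists>a. [:int N:] dvd h - a * f"
        then obtain a where "[:int N:] dvd h - (0 * ?G + a * f)"
          by auto
        then show "\<exists>a b. [:int N:] dvd h - (a * ?G + b * f)"
          by blast
      next
        assume "\<exists>a b. [:int N:] dvd h - (a * ?G + b * f)"
        then obtain a b where ab: "[:int N:] dvd h - (a * ?G + b * f)"
          by blast
        have "[:int N:] dvd (h - (a * ?G + b * f)) + a * (?G - f * k)"
          using ab k by (intro dvd_add dvd_mult)
        also have "(h - (a * ?G + b * f)) + a * (?G - f * k) = h - (a * k + b) * f"
          by (simp add: algebra_simps)
        finally show "\<exists>a. [:int N:] dvd h - a * f" ..
      qed
      then show ?thesis
        using carrier monic by (simp add: is_gcmd_def principal_ideal_mod_def ideal_mod_def eq_m_iff)
    qed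
    have gcd_1: "is_gcmd N (monom 1 (N ^ i) - monom 1 1) f 1" if i: "i \<in> {1..<d}" for i
    proof -
      let ?G = "monom 1 (N ^ i) - monom 1 1"
      obtain a b where ab: "[:int N:] dvd a * ?G + b * f - 1"
        using pp i unfolding pseudoprime_mod_def poly_ideal_dvd_iff by meson
      have "\<exists>a b. [:int N:] dvd h - (a * ?G + b * f)" for h
      proof -
        have "[:int N:] dvd (- h) * (a * ?G + b * f - 1)"
          using ab by (rule dvd_mult)
        also have "(- h) * (a * ?G + b * f - 1) = h - ((h * a) * ?G + (h * b) * f)"
          by (simp add: algebra_simps)
        finally show ?thesis by blast
      qed
      moreover have "\<exists>a. [:int N:] dvd h - a * 1" for h
        by (intro exI[of _ h]) simp
      ultimately show ?thesis
        using one by (simp add: is_gcmd_def principal_ideal_mod_def ideal_mod_def eq_m_iff)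
    qed
    have "factorization_step N f F"
      unfolding factorization_step_def deg
    proof (intro exI[of _ g] conjI ballI)
      fix i assume i: "i \<in> {1..d}"
      show "is_gcmd N (monom 1 (N ^ i) - monom 1 1) (g (i - 1)) (F i)"
        using gcd_d gcd_1[of i] i by (auto simp: F_def g_def)
      show "g i \<in> poly_mod_carrier N"
        using one carrier by (simp add: g_def)
      show "poly_mod.eq_m (int N) (g (i - 1)) (F i * g i)"
        using i by (auto simp: F_def g_def)
    qed (use d in \<open>auto simp: g_def\<close>)
    moreover have "frobenius_step N f F"
    proof -
      obtain h where h: "[:int N:] dvd pcompose f (monom 1 N) - f * h"
        using pp by (auto simp: pseudoprime_mod_def poly_ideal_dvd_iff)
      have "poly_mod.dvdm (int N) f (pcompose f (monom 1 N))"
        unfolding poly_mod.dvdm_def eq_m_iff using h by blast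
      moreover have "poly_mod.dvdm (int N) 1 x" for x
        unfolding poly_mod.dvdm_def by (intro exI[of _ x]) simp
      ultimately show ?thesis
        by (simp add: frobenius_step_def F_def)
    qed
    moreover have "jacobi_step N f F"
    proof -
      have "(\<Sum>i | i \<in> {1..d} \<and> even i. cycle_structure F i) = (\<Sum>i | i \<in> {1..d} \<and> even i. if i = d then 1 else 0)"
        using d(1) deg by (intro sum.cong) (auto simp: cycle_structure_def F_def)
      also have "\<dots> = (if even d then 1 else 0)"
        using d(1) by (simp add: sum.delta)
      finally show ?thesis
        unfolding jacobi_step_def deg jac s by simp
    qed
    ultimately have "frobenius_pseudoprime N f F"
      using N carrier monic pp by (auto simp: frobenius_pseudoprime_def pseudoprime_mod_def)
    moreover have "\<forall>i\<in>{1..d}. cycle_structure F i = perm_cycle_count d \<sigma> i"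
      using d(1) deg by (simp add: count) (simp add: cycle_structure_def F_def)
    ultimately show "degree f = d \<and> (\<exists>F. frobenius_pseudoprime N f F \<and>
        (\<forall>i\<in>{1..d}. cycle_structure F i = perm_cycle_count d \<sigma> i))"
      using deg by blast
  qed
  moreover have "finite {f. degree f = d \<and> (\<exists>F. frobenius_pseudoprime N f F \<and>
      (\<forall>i\<in>{1..d}. cycle_structure F i = perm_cycle_count d \<sigma> i))}"
    by (rule finite_subset[OF _ finite_poly_mod_carrier[of N d]])
      (use N in \<open>auto simp: frobenius_pseudoprime_def\<close>)
  ultimately show ?thesis
    unfolding L_count_def by (intro card_mono)
qed

section \<open>A prime of given order modulo another prime\<close>

lemma ex_int_poly_multiple:
  fixes p :: "rat poly"
  shows "\<exists>c q. c > (0 :: int) \<and> of_int_poly q = smult (of_int c) p"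
proof (induction p)
  case 0
  show ?case
    by (intro exI[of _ 1] exI[of _ 0]) simp
next
  case (pCons a p)
  obtain c q where cq: "c > 0" "of_int_poly q = smult (of_int c) p"
    using pCons.IH by blast
  obtain x y where xy: "y > 0" "a = of_int x / of_int y"
    by (metis Fract_of_int_quotient quotient_of_denom_pos quotient_of_div surj_pair)
  have "of_int_poly (pCons (c * x) (smult y q)) = smult (of_int (c * y)) (pCons a p)"
    using xy cq by (simp add: hom_distribs mult.commute)
  moreover have "c * y > 0"
    using cq xy by simp
  ultimately show ?case
    by blast
qed

text \<open>The integer polynomial below is a multiple of the \<open>d\<close>-th cyclotomic polynomial.\<close>

lemma ex_order_poly:
  assumes d: "d > 0"
  obtains Q :: "int poly" and \<kappa> :: int where "\<kappa> > 0" "degree Q > 0" "poly Q 0 \<noteq> 0"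
    "d > 1 \<Longrightarrow> poly Q 1 \<noteq> 0"
    "\<And>a p. prime p \<Longrightarrow> p dvd poly Q a \<Longrightarrow> \<not> p dvd \<kappa> \<Longrightarrow>
       p dvd a ^ d - 1 \<and> (\<forall>e\<in>{1..<d}. \<not> p dvd a ^ e - 1)"
proof -
  define \<Psi> :: "rat poly" where "\<Psi> = monom 1 d - 1"
  define D :: "rat poly" where "D = (\<Prod>e\<in>{1..<d}. monom 1 e - 1)"
  \<comment> \<open>Removing from X^d - 1 the part shared with \<open>D\<close> leaves the primitive
    d-th roots of unity.\<close>
  define G where "G = gcd \<Psi> D"
  obtain Q where \<Psi>: "\<Psi> = G * Q"
    unfolding G_def using dvd_def gcd_dvd1 by blast
  have "coeff \<Psi> d = 1"
    using d by (simp add: \<Psi>_def)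
  then have "\<Psi> \<noteq> 0"
    by auto
  \<comment> \<open>A common factor would divide X^d - 1 twice, hence its derivative and then X^d,
    and so be a unit.\<close>
  have "coprime Q D"
  proof (rule Rings.coprimeI)
    fix h assume h: "h dvd Q" "h dvd D"
    have "h dvd \<Psi>"
      unfolding \<Psi> using h(1) by (rule dvd_mult)
    then have "h dvd G"
      unfolding G_def using h(2) by (rule gcd_greatest)
    then have "h * h dvd \<Psi>"
      unfolding \<Psi> using h(1) by (rule mult_dvd_mono)
    then obtain k where k: "\<Psi> = h * (h * k)"
      by (metis dvdE mult.assoc)
    then have "pderiv \<Psi> = h * pderiv (h * k) + h * k * pderiv h"
      by (simp add: pderiv_mult)
    then have "h dvd pderiv \<Psi>"
      by (metis dvd_add dvd_triv_left mult.assoc)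
    also have "pderiv \<Psi> = smult (of_nat d) (monom 1 (d - 1))"
      by (simp add: \<Psi>_def pderiv_diff pderiv_monom smult_monom)
    finally have "h dvd smult (1 / of_nat d) (smult (of_nat d) (monom 1 (d - 1)))"
      by (rule dvd_smult)
    then have "h dvd monom 1 (d - 1)"
      using d by simp
    then have "h dvd monom 1 1 * monom 1 (d - 1)"
      by (rule dvd_mult)
    then have "h dvd monom 1 d"
      using d by (simp add: mult_monom)
    moreover have "h dvd \<Psi>"
      using k by simp
    ultimately have "h dvd monom 1 d - \<Psi>"
      by (rule dvd_diff)
    then show "is_unit h"
      by (simp add: \<Psi>_def)
  qed
  then obtain u v where uv: "u * Q + v * D = 1"
    by (metis bezout_coefficients_fst_snd GCD.coprime_imp_gcd_eq_1)
  \<comment> \<open>If \<open>Q\<close> were constant, X^d - 1 would divide \<open>D\<close>; but a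
    primitive complex d-th root of unity is not a root of \<open>D\<close>.\<close>
  have degQ: "degree Q > 0"
  proof (rule ccontr)
    assume "\<not> degree Q > 0"
    then obtain c where c: "Q = [:c:]"
      by (metis degree_eq_zeroE gr0I)
    then have "c \<noteq> 0"
      using \<open>\<Psi> \<noteq> 0\<close> \<Psi> by auto
    have "\<Psi> = smult c G"
      using \<Psi> c by simp
    then have "\<Psi> dvd G"
      using \<open>c \<noteq> 0\<close> by (simp add: smult_dvd_iff)
    then have "\<Psi> dvd D"
      unfolding G_def by (meson dvd_trans gcd_dvd2)
    then obtain k where k: "D = \<Psi> * k" ..
    define \<omega> where "\<omega> = cis (2 * pi / d)"
    have \<omega>: "\<omega> ^ e = cis (2 * pi * e / d)" for e
      by (simp add: \<omega>_def Complex.DeMoivre mult_ac)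
    interpret of_rat: map_poly_idom_hom "of_rat :: rat \<Rightarrow> complex" ..
    have "poly (map_poly of_rat D) \<omega> = poly (map_poly of_rat \<Psi>) \<omega> * poly (map_poly of_rat k) \<omega>"
      unfolding k by (simp add: hom_distribs)
    also have "poly (map_poly of_rat \<Psi>) \<omega> = 0"
      using d by (simp add: \<Psi>_def hom_distribs poly_monom \<omega>)
    finally have "(\<Prod>e\<in>{1..<d}. \<omega> ^ e - 1) = 0"
      by (simp add: D_def hom_distribs poly_prod poly_monom)
    then obtain e where e: "e \<in> {1..<d}" "\<omega> ^ e = \<omega> ^ 0"
      by auto
    have "inj_on (\<lambda>k. \<omega> ^ k) {..<d}"
      using Complex.bij_betw_roots_unity[OF d] unfolding \<omega> by (simp add: bij_betw_def)
    then have "e = 0"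
      using e(2) by (rule inj_onD) (use e(1) in auto)
    then show False
      using e by simp
  qed
  obtain c1 Q' where Q': "c1 > 0" "of_int_poly Q' = smult (of_int c1) Q"
    using ex_int_poly_multiple by blast
  obtain c2 U where U: "c2 > 0" "of_int_poly U = smult (of_int c2) u"
    using ex_int_poly_multiple by blast
  obtain c3 V where V: "c3 > 0" "of_int_poly V = smult (of_int c3) v"
    using ex_int_poly_multiple by blast
  obtain c4 G' where G': "c4 > 0" "of_int_poly G' = smult (of_int c4) G"
    using ex_int_poly_multiple by blast
  have inj: "f = g" if "of_int_poly f = (of_int_poly g :: rat poly)" for f g
    using that by (simp add: of_int_poly_hom.eq_iff)
  define D' :: "int poly" where "D' = (\<Prod>e\<in>{1..<d}. monom 1 e - 1)"
  have D': "of_int_poly D' = D"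
    by (simp add: D'_def D_def hom_distribs)
  have eq1: "smult (c1 * c4) (monom 1 d - 1) = Q' * G'"
    by (rule inj) (simp add: hom_distribs Q' G' \<Psi>[unfolded \<Psi>_def] mult_ac)
  have eq2: "smult c3 (U * Q') + smult (c1 * c2) (V * D') = [:c1 * c2 * c3:]"
  proof (rule inj)
    have "of_int_poly (smult c3 (U * Q') + smult (c1 * c2) (V * D')) =
        smult (of_int (c1 * c2 * c3)) (u * Q + v * D)"
      by (simp add: hom_distribs Q' U V D' smult_add_right mult_ac)
    also have "\<dots> = of_int_poly [:c1 * c2 * c3:]"
      unfolding uv by (rule poly_eqI) (simp add: coeff_pCons coeff_map_poly split: nat.split)
    finally show "of_int_poly (smult c3 (U * Q') + smult (c1 * c2) (V * D')) = (of_int_poly [:c1 * c2 * c3:] :: rat poly)" .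
  qed
  have ev1: "c1 * c4 * (a ^ d - 1) = poly Q' a * poly G' a" for a
    using arg_cong[OF eq1, of "\<lambda>f. poly f a"] by (simp add: poly_monom)
  have ev2: "c3 * (poly U a * poly Q' a) + c1 * c2 * (poly V a * poly D' a) = c1 * c2 * c3" for a
    using arg_cong[OF eq2, of "\<lambda>f. poly f a"] by simp
  \<comment> \<open>The denominators cleared so far. Modulo a prime not dividing \<kappa>, a root of
    \<open>Q'\<close> is a root of X^d - 1 by \<open>ev1\<close> and not a root of \<open>D'\<close>
    by \<open>ev2\<close>.\<close>
  define \<kappa> where "\<kappa> = c1 * c4 * (c1 * c2 * c3)"
  show ?thesis
  proof (rule that[of \<kappa> Q'])
    show "\<kappa> > 0"
      using Q' U V G' by (simp add: \<kappa>_def)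
    have "degree (of_int_poly Q' :: rat poly) = degree Q"
      using Q' by simp
    then show "degree Q' > 0"
      using degQ by simp
    show "poly Q' 0 \<noteq> 0"
      using ev1[of 0] zero_power[OF d, where ?'a = int] Q'(1) G'(1) by auto
    show "poly Q' 1 \<noteq> 0" if "d > 1"
    proof -
      have "poly D' 1 = 0"
        using that by (auto simp: D'_def poly_prod poly_monom intro!: bexI[of _ 1])
      then show ?thesis
        using ev2[of 1] Q'(1) U(1) V(1) by auto
    qed
    fix a p :: int assume p: "prime p" "p dvd poly Q' a" "\<not> p dvd \<kappa>"
    have "p dvd c1 * c4 * (a ^ d - 1)"
      unfolding ev1 using p(2) by (rule dvd_mult2)
    then have "p dvd a ^ d - 1"
      using p by (auto simp: prime_dvd_mult_iff \<kappa>_def)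
    moreover have False if e: "e \<in> {1..<d}" "p dvd a ^ e - 1" for e
    proof -
      have "a ^ e - 1 dvd poly D' a"
        using dvd_prodI[OF _ e(1), of "\<lambda>k. a ^ k - 1"] by (simp add: D'_def poly_prod poly_monom)
      then have "p dvd poly D' a"
        using e(2) dvd_trans by blast
      then have "p dvd c1 * c2 * c3"
        unfolding ev2[of a, symmetric] using p(2) by (intro dvd_add dvd_mult)
      then show False
        using p(3) by (simp add: \<kappa>_def)
    qed
    ultimately show "p dvd a ^ d - 1 \<and> (\<forall>e\<in>{1..<d}. \<not> p dvd a ^ e - 1)"
      by blast
  qed
qed

text \<open>Euclid's argument: for a congruent to \<open>a0\<close> modulo K c, the value is c (1 +
  K v), and for all but finitely many such a it exceeds c in absolute value. Then 1 + K v has a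
  prime factor, which cannot divide \<open>K\<close>.\<close>

lemma ex_prime_dvd_poly_value:
  fixes Q :: "int poly"
  assumes deg: "degree Q > 0" and c: "poly Q a0 = c" "c \<noteq> 0" and K: "K > 0"
    and S: "infinite S" "\<And>a. a \<in> S \<Longrightarrow> [a = a0] (mod K * c)"
  shows "\<exists>a\<in>S. \<exists>p. prime p \<and> p dvd poly Q a \<and> \<not> p dvd K"
proof -
  have "finite (\<Union>t\<in>{-\<bar>c\<bar>..\<bar>c\<bar>}. {a. poly (Q - [:t:]) a = 0})"
  proof (intro finite_UN_I poly_roots_finite)
    fix t
    have "degree (Q - [:t:]) = degree Q"
      unfolding diff_conv_add_uminus using deg by (intro degree_add_eq_left) simp
    then show "Q - [:t:] \<noteq> 0"
      using deg by auto
  qed simp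
  then obtain a where a: "a \<in> S" "a \<notin> (\<Union>t\<in>{-\<bar>c\<bar>..\<bar>c\<bar>}. {a. poly (Q - [:t:]) a = 0})"
    using S(1) by (meson finite_subset subsetI)
  then have large: "\<bar>poly Q a\<bar> > \<bar>c\<bar>"
    by auto
  have "[poly Q a = c] (mod K * c)"
  proof -
    have "K * c dvd a - a0"
      using S(2)[OF a(1)] by (simp add: cong_iff_dvd_diff)
    moreover have "a - a0 dvd poly Q a - poly Q a0"
    proof -
      interpret ring_ideal "{x. a - a0 dvd x}"
        by (rule ring_ideal_dvd)
      show ?thesis
        using eqv_poly[of Q Q a a0] by (simp add: eqv_def)
    qed
    ultimately show ?thesis
      using c by (metis cong_iff_dvd_diff dvd_trans)
  qed
  then obtain v where "poly Q a - c = K * c * v"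
    by (auto simp: cong_iff_dvd_diff)
  then have v: "poly Q a = c * (1 + K * v)"
    by (simp add: algebra_simps)
  then have "\<bar>c\<bar> * \<bar>1 + K * v\<bar> > \<bar>c\<bar> * 1"
    using large by (simp add: abs_mult)
  then have "\<not> is_unit (1 + K * v)"
    using c(2) by auto
  moreover have "1 + K * v \<noteq> 0"
    using v large by auto
  ultimately obtain p where p: "prime p" "p dvd 1 + K * v"
    using prime_divisor_exists by blast
  have "\<not> p dvd K"
  proof
    assume "p dvd K"
    then have "p dvd (1 + K * v) - K * v"
      using p(2) by (intro dvd_diff dvd_mult2)
    then have "is_unit p"
      by (simp only: add_diff_cancel_right')
    then show False
      using p(1) not_prime_unit by blast
  qed
  moreover have "p dvd poly Q a"
    unfolding v using p(2) by (rule dvd_mult)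
  ultimately show ?thesis
    using a(1) p(1) by blast
qed

text \<open>A prime p dividing Q(a) but not \<kappa> makes a of order \<open>n\<close> modulo p, so
  \<open>n\<close> divides p - 1.\<close>

lemma ex_prime_cong_1:
  assumes "n > 0"
  shows "\<exists>p::nat. prime p \<and> p > B \<and> [p = 1] (mod n)"
proof -
  obtain Q :: "int poly" and \<kappa> :: int where Q: "\<kappa> > 0" "degree Q > 0" "poly Q 0 \<noteq> 0"
    "\<And>a p. prime p \<Longrightarrow> p dvd poly Q a \<Longrightarrow> \<not> p dvd \<kappa> \<Longrightarrow>
       p dvd a ^ n - 1 \<and> (\<forall>e\<in>{1..<n}. \<not> p dvd a ^ e - 1)"
    using ex_order_poly[OF assms] by metis
  define c where "c = poly Q 0"
  \<comment> \<open>The factorial excludes the primes up to \<open>B\<close>.\<close>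
  define K where "K = \<kappa> * int (fact B)"
  have K: "K > 0"
    using Q(1) by (simp add: K_def)
  have inj: "inj (\<lambda>t. K * \<bar>c\<bar> * int t)"
    using K Q(3) by (auto simp: inj_def c_def)
  have "infinite (range (\<lambda>t. K * \<bar>c\<bar> * int t))"
    using range_inj_infinite[OF inj] .
  moreover have "[a = 0] (mod K * c)" if "a \<in> range (\<lambda>t. K * \<bar>c\<bar> * int t)" for a
  proof -
    have "K * c dvd K * \<bar>c\<bar> * int t" for t
      by (intro dvd_mult2 mult_dvd_mono) auto
    then show ?thesis
      using that by (auto simp: cong_0_iff)
  qed
  ultimately obtain a p where ap: "a \<in> range (\<lambda>t. K * \<bar>c\<bar> * int t)" "prime p" "p dvd poly Q a" "\<not> p dvd K"
    using ex_prime_dvd_poly_value[OF Q(2) c_def[symmetric] _ K] Q(3) unfolding c_def by blast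
  have "\<not> p dvd \<kappa>" "\<not> p dvd int (fact B)"
    using ap(4) by (auto simp: K_def)
  then have order: "p dvd a ^ n - 1" "\<And>e. e \<in> {1..<n} \<Longrightarrow> \<not> p dvd a ^ e - 1"
    using Q(4)[OF ap(2,3)] by auto
  have "a \<ge> 0"
    using ap(1) K by auto
  define r x where "r = nat p" and "x = nat a"
  have r: "int r = p" "prime r" and x: "int x = a"
    using ap(2) \<open>a \<ge> 0\<close> prime_gt_0_int[of p] by (auto simp: r_def x_def)
  have pow: "[x ^ e = 1] (mod r) \<longleftrightarrow> p dvd a ^ e - 1" for e
    by (metis cong_iff_dvd_diff cong_int_iff of_nat_1 of_nat_power r(1) x)
  have "ord r x = n"
  proof -
    have "[x ^ n = 1] (mod r)"
      using order(1) pow by simp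
    then have "ord r x dvd n"
      by (rule ord_divides[THEN iffD1])
    moreover have "\<not> ord r x < n"
    proof
      assume less: "ord r x < n"
      moreover have "ord r x > 0"
        using \<open>ord r x dvd n\<close> assms by (metis dvd_0_left_iff gr0I)
      ultimately have "ord r x \<in> {1..<n}"
        by (simp only: atLeastLessThan_iff Suc_le_eq One_nat_def)
      moreover have "[x ^ ord r x = 1] (mod r)"
        by (rule ord_works[THEN conjunct1])
      ultimately show False
        using order(2) pow by blast
    qed
    ultimately show ?thesis
      using assms by (meson dvd_imp_le le_neq_implies_less)
  qed
  moreover have "coprime r x"
  proof -
    have "coprime (x ^ n) r"
      using cong_imp_coprime[OF cong_sym] pow order(1) by (metis coprime_1_left)
    then show ?thesis
      using assms by (simp add: ac_simps)
  qed
  ultimately have "n dvd r - 1"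
    using order_divides_totient[of r x] r(2) by (simp add: totient_prime)
  then have "[r = 1] (mod n)"
    using prime_gt_0_nat[OF r(2)] by (simp add: cong_altdef_nat)
  moreover have "r > B"
  proof (rule ccontr)
    assume "\<not> r > B"
    then have "r dvd fact B"
      using prime_gt_0_nat[OF r(2)] by (intro dvd_fact) auto
    then show False
      using \<open>\<not> p dvd int (fact B)\<close> r(1) by (metis of_nat_dvd_iff)
  qed
  ultimately show ?thesis
    using r(2) by blast
qed

text \<open>The candidates for r are the infinitely many primes that are 1 modulo n. For them Q(r)
  is congruent to Q(1), which is nonzero for d > 1, and for one of them some prime s divides Q(r)
  but not 2 \<kappa>; then r has order d modulo s. In the case d = 1, where Q(1) vanishes, s = 3
  serves.\<close>

lemma ex_prime_order:
  assumes d: "d > 0"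
  shows "\<exists>r s::nat. prime r \<and> odd r \<and> prime s \<and> odd s \<and> [r ^ d = 1] (mod s) \<and>
    (\<forall>i\<in>{1..<d}. [r ^ i \<noteq> 1] (mod s))"
proof (cases "d = 1")
  case True
  have "\<exists>p::nat. prime p \<and> p > 3 \<and> [p = 1] (mod 3)"
    by (rule ex_prime_cong_1) simp
  then obtain r :: nat where r: "prime r" "r > 3" "[r = 1] (mod 3)"
    by (elim exE conjE)
  then have "odd r"
    by (intro prime_odd_nat) simp_all
  moreover have "prime (3 :: nat)"
    by simp
  ultimately show ?thesis
    using r True by (intro exI[of _ r] exI[of _ 3]) simp
next
  case False
  have d1: "d > 1"
    using False d by linarith
  obtain Q :: "int poly" and \<kappa> :: int where Q': "\<kappa> > 0" "degree Q > 0" "d > 1 \<Longrightarrow> poly Q 1 \<noteq> 0"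
    "\<And>a p. prime p \<Longrightarrow> p dvd poly Q a \<Longrightarrow> \<not> p dvd \<kappa> \<Longrightarrow>
       p dvd a ^ d - 1 \<and> (\<forall>e\<in>{1..<d}. \<not> p dvd a ^ e - 1)"
    using ex_order_poly[OF d] by metis
  note Q = Q'(1,2) Q'(3)[OF d1] Q'(4)
  define c where "c = poly Q 1"
  define K where "K = 2 * \<kappa>"
  define n where "n = nat (K * \<bar>c\<bar>)"
  have K: "K > 0" and n: "n > 0" "int n = K * \<bar>c\<bar>"
    using Q(1,3) by (auto simp: K_def n_def c_def)
  define S where "S = {p. prime p \<and> [p = 1] (mod n)}"
  have "infinite S"
    unfolding infinite_nat_iff_unbounded S_def using ex_prime_cong_1[OF n(1)] by blast
  then have "infinite (int ` S)"
    by (simp add: finite_image_iff)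
  moreover have "[a = 1] (mod K * c)" if "a \<in> int ` S" for a
  proof -
    have "[a = 1] (mod int n)"
      using that by (auto simp: S_def simp flip: cong_int_iff)
    then show ?thesis
      using n(2) by (metis abs_mult abs_of_pos K cong_abs)
  qed
  ultimately obtain a p where ap: "a \<in> int ` S" "prime p" "p dvd poly Q a" "\<not> p dvd K"
    using ex_prime_dvd_poly_value[OF Q(2) c_def[symmetric] _ K] Q(3) unfolding c_def by blast
  then obtain r where r: "r \<in> S" "a = int r"
    by blast
  define s where "s = nat p"
  have s: "int s = p" "prime s"
    using ap(2) prime_gt_0_int[of p] by (auto simp: s_def)
  have "\<not> p dvd \<kappa>" "\<not> p dvd 2"
    using ap(4) by (auto simp: K_def)
  then have order: "p dvd a ^ d - 1" "\<And>e. e \<in> {1..<d} \<Longrightarrow> \<not> p dvd a ^ e - 1"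
    using Q(4)[OF ap(2,3)] by auto
  have pow: "[r ^ e = 1] (mod s) \<longleftrightarrow> p dvd a ^ e - 1" for e
    by (metis cong_iff_dvd_diff cong_int_iff of_nat_1 of_nat_power r(2) s(1))
  have "odd s"
  proof
    assume "even s"
    then have "s = 2"
      using s(2) primes_dvd_imp_eq two_is_prime_nat by blast
    then show False
      using \<open>\<not> p dvd 2\<close> s(1) by simp
  qed
  moreover have "odd r"
  proof -
    have "even n"
      using n(2) by (metis K_def dvd_mult2 dvd_triv_left even_of_nat)
    then have "[r = 1] (mod 2)"
      using r(1) by (auto simp: S_def intro: cong_dvd_modulus_nat)
    then show ?thesis
      by (simp add: cong_def odd_iff_mod_2_eq_one)
  qed
  moreover have "prime r"
    using r(1) by (simp add: S_def)
  ultimately show ?thesis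
    using s(2) order pow by blast
qed

section \<open>Values of the form \<open>(a\<^sup>s - b\<^sup>s) / (a - b)\<close>\<close>

text \<open>Multiplying the summation variable by a primitive root g multiplies the sum by g^k,
  which is 1 only if p - 1 divides k.\<close>

lemma sum_powers_mod_prime:
  assumes p: "prime (p::nat)"
  shows "[(\<Sum>t\<in>{1..<p}. int t ^ k) = (if (p - 1) dvd k then -1 else 0)] (mod int p)"
proof (cases "(p - 1) dvd k")
  case True
  have "[(\<Sum>t\<in>{1..<p}. int t ^ k) = (\<Sum>t\<in>{1..<p}. 1)] (mod int p)"
  proof (rule cong_sum)
    fix t assume t: "t \<in> {1..<p}"
    then have "\<not> p dvd t"
      by (auto dest: dvd_imp_le)
    then have "[t ^ (p - 1) = 1] (mod p)"
      by (rule fermat_theorem[OF p])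
    then have "[(t ^ (p - 1)) ^ (k div (p - 1)) = 1 ^ (k div (p - 1))] (mod p)"
      by (rule cong_pow)
    then have "[t ^ k = 1] (mod p)"
      using True by (simp flip: power_mult)
    then show "[int t ^ k = 1] (mod int p)"
      using cong_int_iff by (metis of_nat_1 of_nat_power)
  qed
  also have "(\<Sum>t\<in>{1..<p}. 1) = int p - 1"
    using prime_gt_0_nat[OF p] by (simp add: of_nat_diff)
  finally have "[(\<Sum>t\<in>{1..<p}. int t ^ k) = int p - 1] (mod int p)" .
  also have "[int p - 1 = -1] (mod int p)"
    by (simp add: cong_iff_dvd_diff)
  finally show ?thesis
    using True by simp
next
  case False
  obtain g where g: "residue_primroot p g"
    using prime_primitive_root_exists[OF prime_gt_1_nat[OF p] p] by blast
  have cop: "coprime p g" and ord: "ord p g = p - 1"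
    using g p by (auto simp: residue_primroot_def totient_prime)
  have p1: "p > 1"
    using prime_gt_1_nat[OF p] .
  define S where "S = (\<Sum>t\<in>{1..<p}. int t ^ k)"
  have "bij_betw (\<lambda>t. (g * t) mod p) {1..<p} {1..<p}"
  proof (rule bij_betw_imageI)
    show inj: "inj_on (\<lambda>t. (g * t) mod p) {1..<p}"
    proof
      fix x y assume xy: "x \<in> {1..<p}" "y \<in> {1..<p}" "(g * x) mod p = (g * y) mod p"
      then have "[g * x = g * y] (mod p)"
        by (simp add: cong_def)
      then have "[x = y] (mod p)"
        using cop cong_mult_lcancel_nat[of g p x y] by (simp add: ac_simps)
      then show "x = y"
        using xy by (simp add: cong_def)
    qed
    have "(\<lambda>t. (g * t) mod p) ` {1..<p} \<subseteq> {1..<p}"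
    proof clarify
      fix t assume t: "t \<in> {1..<p}"
      have "\<not> p dvd g * t"
      proof
        assume "p dvd g * t"
        then have "p dvd t"
          using cop by (simp add: GCD.coprime_dvd_mult_right_iff)
        then show False
          using t by (auto dest: dvd_imp_le)
      qed
      then show "(g * t) mod p \<in> {1..<p}"
        using p1 by (simp add: mod_greater_zero_iff_not_dvd Suc_le_eq)
    qed
    then show "(\<lambda>t. (g * t) mod p) ` {1..<p} = {1..<p}"
      using inj by (intro card_subset_eq) (auto simp: card_image)
  qed
  then have "S = (\<Sum>t\<in>{1..<p}. int ((g * t) mod p) ^ k)"
    unfolding S_def by (rule sum.reindex_bij_betw[symmetric])
  also have "[(\<Sum>t\<in>{1..<p}. int ((g * t) mod p) ^ k) = (\<Sum>t\<in>{1..<p}. int (g * t) ^ k)] (mod int p)"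
    by (intro cong_sum cong_pow) (simp add: cong_def zmod_int)
  also have "(\<Sum>t\<in>{1..<p}. int (g * t) ^ k) = int g ^ k * S"
    by (simp add: S_def sum_distrib_left power_mult_distrib)
  finally have "[S = int g ^ k * S] (mod int p)" .
  then have "int p dvd (int g ^ k - 1) * S"
    by (simp add: cong_iff_dvd_diff algebra_simps dvd_diff_commute)
  moreover have "\<not> int p dvd int g ^ k - 1"
  proof
    assume "int p dvd int g ^ k - 1"
    then have "[int (g ^ k) = int 1] (mod int p)"
      by (simp add: cong_iff_dvd_diff)
    then have "[g ^ k = 1] (mod p)"
      by (simp only: cong_int_iff)
    then have "ord p g dvd k"
      by (rule ord_divides[THEN iffD1])
    then show False
      using False ord by simp
  qed
  ultimately have "int p dvd S"
    using p by (simp add: prime_dvd_mult_iff)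
  then show ?thesis
    using False by (simp add: S_def cong_0_iff)
qed

lemma prime_not_dvd_binomial:
  assumes "prime (p::nat)" "n < p" "k \<le> n"
  shows "\<not> p dvd (n choose k)"
proof
  assume "p dvd (n choose k)"
  then have "p dvd fact k * fact (n - k) * (n choose k)"
    by (rule dvd_mult)
  then have "p dvd fact n"
    using binomial_fact_lemma[OF assms(3)] by simp
  then show False
    using assms by (simp add: prime_dvd_fact_iff)
qed

text \<open>The homogeneous sum avoids the quotient, so it makes sense in the naturals for all
  \<open>a\<close> and \<open>b\<close>, including \<open>a = b\<close>.\<close>

definition geom_form :: "nat \<Rightarrow> nat \<Rightarrow> nat \<Rightarrow> nat" where
  "geom_form s a b = (\<Sum>i<s. a ^ i * b ^ (s - 1 - i))"

lemma geom_form_diff: "(int a - int b) * int (geom_form s a b) = int a ^ s - int b ^ s"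
  unfolding geom_form_def of_nat_sum of_nat_mult of_nat_power
  by (subst power_diff_sumr2) (simp add: mult.commute)

lemma geom_form_scale: "geom_form s (c * a) (c * b) = c ^ (s - 1) * geom_form s a b"
proof -
  have "c ^ i * c ^ (s - 1 - i) = c ^ (s - 1)" if "i < s" for i
    using that by (simp flip: power_add)
  then show ?thesis
    unfolding geom_form_def sum_distrib_left
    by (intro sum.cong refl) (simp add: power_mult_distrib mult.assoc mult.left_commute)
qed

lemma geom_form_cong:
  "[a = a'] (mod m) \<Longrightarrow> [b = b'] (mod m) \<Longrightarrow> [geom_form s a b = geom_form s a' b'] (mod m)"
  unfolding geom_form_def by (intro cong_sum cong_mult cong_pow)

lemma geom_form_0_right: "s > 0 \<Longrightarrow> geom_form s a 0 = a ^ (s - 1)"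
proof -
  assume "s > 0"
  have "geom_form s a 0 = (\<Sum>i<s. if i = s - 1 then a ^ (s - 1) else 0)"
    unfolding geom_form_def by (intro sum.cong) auto
  then show ?thesis
    using \<open>s > 0\<close> by simp
qed

lemma geom_form_0_left: "s > 0 \<Longrightarrow> geom_form s 0 b = b ^ (s - 1)"
proof -
  assume "s > 0"
  have "geom_form s 0 b = (\<Sum>i<s. if i = 0 then b ^ (s - 1) else 0)"
    unfolding geom_form_def by (intro sum.cong) auto
  then show ?thesis
    using \<open>s > 0\<close> by simp
qed

text \<open>
  If all values of \<open>1 + t + \<dots> + t\<^sup>s\<^sup>-\<^sup>1\<close> modulo \<open>p\<close> had order dividing \<open>m\<close>, then
  \<open>(1 - t\<^sup>s)\<^sup>m\<^sup>+\<^sup>1\<close> and \<open>(1 - t)\<^sup>m (1 - t\<^sup>s)\<close> would be the same function on the prime field, although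
  their coefficient sequences modulo \<open>p - 1\<close> differ.
\<close>

lemma geom_form_not_in_subgroup:
  assumes s: "prime s" and p: "prime p" "p > 4 * s + 1" and m: "m \<ge> 2" "2 * m \<le> p - 1"
    and vals: "\<And>t. p dvd geom_form s t 1 \<or> [geom_form s t 1 ^ m = 1] (mod p)"
  shows False
proof -
  have s2: "s \<ge> 2"
    using prime_ge_2_nat[OF s] .
  have eq: "[(1 - int t ^ s) ^ Suc m = (1 - int t) ^ m * (1 - int t ^ s)] (mod int p)" for t
  proof -
    define \<phi> where "\<phi> = int (geom_form s t 1)"
    have "1 - int t ^ s = (1 - int t) * \<phi>"
      using geom_form_diff[of t 1 s] by (simp add: \<phi>_def algebra_simps)
    moreover have "[\<phi> ^ Suc m = \<phi>] (mod int p)"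
      using vals[of t]
    proof
      assume "p dvd geom_form s t 1"
      then have "int p dvd \<phi>"
        by (simp add: \<phi>_def)
      then show ?thesis
        by (simp add: cong_iff_dvd_diff)
    next
      assume "[geom_form s t 1 ^ m = 1] (mod p)"
      then have "[\<phi> ^ m = 1] (mod int p)"
        unfolding \<phi>_def using cong_int_iff by (metis of_nat_1 of_nat_power)
      then have "[\<phi> * \<phi> ^ m = \<phi> * 1] (mod int p)"
        by (intro cong_mult cong_refl)
      then show ?thesis
        by simp
    qed
    then have "[(1 - int t) ^ Suc m * \<phi> ^ Suc m = (1 - int t) ^ Suc m * \<phi>] (mod int p)"
      by (intro cong_mult cong_refl)
    ultimately show ?thesis
      by (simp add: power_mult_distrib mult_ac)
  qed
  define T where "T k = (\<Sum>t\<in>{1..<p}. int t ^ k)" for k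
  have T: "[T k = (if (p - 1) dvd k then -1 else 0)] (mod int p)" for k
    unfolding T_def by (rule sum_powers_mod_prime[OF p(1)])
  have binom: "(1 - x) ^ n = (\<Sum>i\<le>n. (-1) ^ i * int (n choose i) * x ^ i)" for x n
    using binomial_ring[of "- x" 1 n] by (simp add: power_minus[of x] mult_ac)
  \<comment> \<open>Multiplying by t^\<kappa> and summing over all nonzero t isolates, up to sign,
    the coefficients at exponents congruent to -\<kappa> modulo p - 1.\<close>
  have sums: "[(\<Sum>i\<le>Suc m. (-1) ^ i * int (Suc m choose i) * T (s * i + \<kappa>)) =
      (\<Sum>i\<le>m. (-1) ^ i * int (m choose i) * (T (i + \<kappa>) - T (i + s + \<kappa>)))] (mod int p)" for \<kappa>
  proof -
    have "(\<Sum>i\<le>Suc m. (-1) ^ i * int (Suc m choose i) * T (s * i + \<kappa>)) =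
        (\<Sum>t\<in>{1..<p}. (1 - int t ^ s) ^ Suc m * int t ^ \<kappa>)"
      unfolding T_def binom sum_distrib_left sum_distrib_right
      by (subst sum.swap) (simp only: power_add power_mult mult.assoc)
    also have "[\<dots> = (\<Sum>t\<in>{1..<p}. (1 - int t) ^ m * (1 - int t ^ s) * int t ^ \<kappa>)] (mod int p)"
      by (intro cong_sum cong_mult eq cong_refl)
    also have "(\<Sum>t\<in>{1..<p}. (1 - int t) ^ m * (1 - int t ^ s) * int t ^ \<kappa>) =
        (\<Sum>i\<le>m. (-1) ^ i * int (m choose i) * (T (i + \<kappa>) - T (i + s + \<kappa>)))"
      unfolding T_def binom sum_distrib_left sum_distrib_right sum_subtractf[symmetric]
      by (subst sum.swap) (intro sum.cong refl, simp add: power_add algebra_simps)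
    finally show ?thesis .
  qed
  show False
  proof (cases "s dvd p - 1")
    case True
    \<comment> \<open>This selects the exponents that are 1 modulo p - 1. On the left all exponents
      are multiples of \<open>s\<close>, which divides p - 1, so none is selected. On the right only
      the linear term of (1 - t)^m is, and p would divide \<open>m\<close>.\<close>
    define \<kappa> where "\<kappa> = p - 2"
    have "[(\<Sum>i\<le>Suc m. (-1) ^ i * int (Suc m choose i) * T (s * i + \<kappa>)) = (\<Sum>i\<le>Suc m. (-1) ^ i * int (Suc m choose i) * 0)] (mod int p)"
    proof (intro cong_sum cong_mult cong_refl)
      fix i
      have "\<not> (p - 1) dvd s * i + \<kappa>"
      proof
        assume "(p - 1) dvd s * i + \<kappa>"
        then have "s dvd s * i + \<kappa>"
          using True dvd_trans by blast
        then have "s dvd \<kappa>"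
          by (simp add: dvd_add_right_iff)
        then have "s dvd (p - 1) - \<kappa>"
          using True by (rule dvd_diff_nat[rotated])
        then show False
          using s2 p(2) by (simp add: \<kappa>_def)
      qed
      then show "[T (s * i + \<kappa>) = 0] (mod int p)"
        using T[of "s * i + \<kappa>"] by simp
    qed
    moreover have "[(\<Sum>i\<le>m. (-1) ^ i * int (m choose i) * (T (i + \<kappa>) - T (i + s + \<kappa>))) =
        (\<Sum>i\<le>m. (-1) ^ i * int (m choose i) * ((if i = 1 then -1 else 0) - 0))] (mod int p)"
    proof (intro cong_sum cong_mult cong_diff cong_refl)
      fix i assume "i \<in> {..m}"
      then have i: "i \<le> m" by simp
      have "(p - 1) dvd i + \<kappa> \<longleftrightarrow> i = 1"
      proof
        assume "(p - 1) dvd i + \<kappa>"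
        then obtain c where c: "i + \<kappa> = (p - 1) * c" ..
        have "i + \<kappa> < (p - 1) * 2" "i + \<kappa> > 0"
          using i m p(2) by (auto simp: \<kappa>_def)
        then have "c < 2" "c > 0"
          unfolding c by (simp_all only: mult_less_cancel1 nat_0_less_mult_iff)
        then have "c = 1"
          by linarith
        then show "i = 1"
          using c p(2) by (simp add: \<kappa>_def)
      qed (use p(2) in \<open>simp add: \<kappa>_def Suc_diff_Suc numeral_2_eq_2\<close>)
      then show "[T (i + \<kappa>) = (if i = 1 then -1 else 0)] (mod int p)"
        using T[of "i + \<kappa>"] by simp
      have "\<not> (p - 1) dvd i + s + \<kappa>"
      proof
        assume "(p - 1) dvd i + s + \<kappa>"
        then obtain c where c: "i + s + \<kappa> = (p - 1) * c" ..
        have "i + s + \<kappa> < (p - 1) * 2" "i + s + \<kappa> > p - 1"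
          using i m p(2) s2 by (auto simp: \<kappa>_def)
        then have "(p - 1) * 1 < (p - 1) * c" "(p - 1) * c < (p - 1) * 2"
          unfolding c by simp_all
        then have "1 < c" "c < 2"
          by (simp_all only: mult_less_cancel1)
        then show False
          by linarith
      qed
      then show "[T (i + s + \<kappa>) = 0] (mod int p)"
        using T[of "i + s + \<kappa>"] by simp
    qed
    ultimately have "[0 = (\<Sum>i\<le>m. (-1) ^ i * int (m choose i) * ((if i = 1 then -1 else 0) - 0))] (mod int p)"
      using sums[of \<kappa>] by (simp only: mult_zero_right sum.neutral_const) (meson cong_sym cong_trans)
    also have "(\<Sum>i\<le>m. (-1) ^ i * int (m choose i) * ((if i = 1 then -1 else 0) - 0)) =
        (\<Sum>i\<le>m. if i = 1 then int m else 0)"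
      by (intro sum.cong) auto
    also have "\<dots> = int m"
      using m by simp
    finally have "p dvd m"
      by (simp add: cong_iff_dvd_diff)
    then show False
      using m p(2) by (auto dest: dvd_imp_le)
  next
    case False
    \<comment> \<open>The multiple s j just exceeds the degree m + s of the right-hand side, so
      nothing is selected there. On the left, \<open>s\<close> is invertible modulo p - 1 and only
      the term \<open>i = j\<close> survives, with a binomial coefficient prime to p.\<close>
    define j where "j = (m + s) div s + 1"
    have sj: "m + s < s * j" "s * j \<le> m + 2 * s"
    proof -
      have "s * j = s * ((m + s) div s) + s"
        by (simp add: j_def)
      moreover have "m + s = s * ((m + s) div s) + (m + s) mod s" "(m + s) mod s < s"
        using s2 by simp_all
      ultimately show "m + s < s * j" "s * j \<le> m + 2 * s"
        by linarith+
    qed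
    have j: "j \<le> Suc m"
    proof -
      have "(m + s) div s = m div s + 1"
        using s2 by simp
      moreover have "m div s \<le> m div 2"
        using s2 by (rule div_le_mono2[rotated]) simp
      ultimately show ?thesis
        unfolding j_def using m(1) by linarith
    qed
    define \<kappa> where "\<kappa> = p - 1 - s * j"
    have \<kappa>: "\<kappa> > 0" "s * j + \<kappa> = p - 1"
      using sj m p(2) by (auto simp: \<kappa>_def)
    have small: "\<not> (p - 1) dvd x" if "0 < x" "x < p - 1" for x
      using that by (auto dest: dvd_imp_le)
    have "[(\<Sum>i\<le>m. (-1) ^ i * int (m choose i) * (T (i + \<kappa>) - T (i + s + \<kappa>))) =
        (\<Sum>i\<le>m. (-1) ^ i * int (m choose i) * (0 - 0))] (mod int p)"
    proof (intro cong_sum cong_mult cong_diff cong_refl)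
      fix i assume "i \<in> {..m}"
      then have i: "i \<le> m" by simp
      show "[T (i + \<kappa>) = 0] (mod int p)"
        using T[of "i + \<kappa>"] small[of "i + \<kappa>"] i \<kappa> sj by simp
      show "[T (i + s + \<kappa>) = 0] (mod int p)"
        using T[of "i + s + \<kappa>"] small[of "i + s + \<kappa>"] i \<kappa> sj by simp
    qed
    moreover have "[(\<Sum>i\<le>Suc m. (-1) ^ i * int (Suc m choose i) * T (s * i + \<kappa>)) =
        (\<Sum>i\<le>Suc m. (-1) ^ i * int (Suc m choose i) * (if i = j then -1 else 0))] (mod int p)"
    proof (intro cong_sum cong_mult cong_refl)
      fix i assume "i \<in> {..Suc m}"
      then have i: "i \<le> Suc m" by simp
      have cop: "coprime (p - 1) s"
        using False s by (metis prime_imp_coprime Rings.coprime_commute)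
      have "(p - 1) dvd s * i + \<kappa> \<longleftrightarrow> i = j"
      proof
        assume "(p - 1) dvd s * i + \<kappa>"
        then have "int (p - 1) dvd int (s * i + \<kappa>) - int (s * j + \<kappa>)"
          using \<kappa>(2) by (intro dvd_diff) (simp_all only: of_nat_dvd_iff, simp)
        also have "int (s * i + \<kappa>) - int (s * j + \<kappa>) = int s * (int i - int j)"
          by (simp add: algebra_simps)
        finally have "int (p - 1) dvd int i - int j"
          using cop by (metis GCD.coprime_dvd_mult_right_iff coprime_int_iff)
        moreover have "\<bar>int i - int j\<bar> < int (p - 1)"
          using i j m p(2) by linarith
        ultimately have "int i - int j = 0"
          by (meson dvd_imp_le_int abs_of_nat not_less order.strict_trans2 abs_ge_self)
        then show "i = j" by simp
      qed (use \<kappa> in simp)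
      then show "[T (s * i + \<kappa>) = (if i = j then -1 else 0)] (mod int p)"
        using T[of "s * i + \<kappa>"] by simp
    qed
    ultimately have "[(\<Sum>i\<le>Suc m. (-1) ^ i * int (Suc m choose i) * (if i = j then -1 else 0)) = 0] (mod int p)"
      using sums[of \<kappa>] by (simp only: diff_self mult_zero_right sum.neutral_const) (meson cong_sym cong_trans)
    also have "(\<Sum>i\<le>Suc m. (-1) ^ i * int (Suc m choose i) * (if i = j then -1 else 0)) =
        (\<Sum>i\<le>Suc m. if i = j then - ((-1) ^ j * int (Suc m choose j)) else 0)"
      by (intro sum.cong) auto
    also have "\<dots> = - ((-1) ^ j * int (Suc m choose j))"
      using j by simp
    finally have "int p dvd (-1) ^ j * int (Suc m choose j)"
      by (simp add: cong_0_iff)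
    then have "p dvd (Suc m choose j)"
      by (cases "even j") simp_all
    then show False
      using prime_not_dvd_binomial[OF p(1) _ j] m p(2) by simp
  qed
qed

section \<open>Generating the residues modulo a prime\<close>

lemma ex_discrete_log:
  assumes p: "prime p" and g: "residue_primroot p g" and x: "\<not> p dvd x"
  shows "\<exists>e. [x = g ^ e] (mod p)"
proof -
  have "p > 1"
    using prime_gt_1_nat[OF p] .
  have "x mod p \<in> totatives p"
    using p x by (simp add: totatives_prime mod_greater_zero_iff_not_dvd prime_gt_0_nat)
  also have "totatives p = (\<lambda>i. g ^ i mod p) ` {..<totient p}"
    using residue_primroot_is_generator[OF \<open>p > 1\<close> g] by (simp add: bij_betw_def)
  finally show ?thesis
    by (auto simp: cong_def)
qed

lemma ex_inverse_mod_nat: "coprime m b \<Longrightarrow> \<exists>c. [b * c = 1] (mod m)" for b m :: nat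
  using cong_solve_coprime_nat[of b m] by (simp add: ac_simps)

definition geom_values :: "nat \<Rightarrow> nat list \<Rightarrow> nat" where
  "geom_values s ts = prod_list (map (\<lambda>t. geom_form s t 1) ts)"

lemma geom_values_append: "geom_values s (xs @ ys) = geom_values s xs * geom_values s ys"
  by (simp add: geom_values_def)

lemma geom_values_times_powers_generate:
  assumes s: "prime s" "odd s" and p: "prime p" "p > 4 * s + 1" and x: "\<not> p dvd x"
  shows "\<exists>ts a. [x = geom_values s ts * a ^ (s - 1)] (mod p)"
proof -
  obtain g where g: "residue_primroot p g"
    using prime_primitive_root_exists[OF prime_gt_1_nat[OF p(1)] p(1)] by blast
  have ord: "ord p g = p - 1" and cop: "coprime p g"
    using g p(1) by (auto simp: residue_primroot_def totient_prime)
  have s3: "s \<ge> 3"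
    using s prime_ge_2_nat[OF s(1)] by (cases "s = 2") auto
  have fermat: "[g ^ (p - 1) = 1] (mod p)"
    using ord_works[of g p] ord by simp
  define R where "R x \<longleftrightarrow> (\<exists>ts a. [x = geom_values s ts * a ^ (s - 1)] (mod p))" for x
  have R_mult: "R (x * y)" if xy: "R x" "R y" for x y
  proof -
    obtain ts a us b where "[x = geom_values s ts * a ^ (s - 1)] (mod p)"
        "[y = geom_values s us * b ^ (s - 1)] (mod p)"
      using xy unfolding R_def by blast
    then have "[x * y = (geom_values s ts * a ^ (s - 1)) * (geom_values s us * b ^ (s - 1))] (mod p)"
      by (rule cong_mult)
    also have "(geom_values s ts * a ^ (s - 1)) * (geom_values s us * b ^ (s - 1)) =
        geom_values s (ts @ us) * (a * b) ^ (s - 1)"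
      by (simp add: geom_values_append power_mult_distrib mult_ac)
    finally show ?thesis
      unfolding R_def by blast
  qed
  have R_power: "R (a ^ (s - 1))" for a
    unfolding R_def by (intro exI[of _ "[]"] exI[of _ a]) (simp add: geom_values_def)
  have R_1: "R 1"
    using R_power[of 1] by simp
  have R_pow: "R (x ^ n)" if "R x" for x n
    using that R_1 by (induction n) (auto intro: R_mult)
  have R_cong: "R x \<longleftrightarrow> R y" if "[x = y] (mod p)" for x y
    using that unfolding R_def by (meson cong_sym cong_trans)
  have R_value: "R (geom_form s t 1)" for t
    unfolding R_def by (intro exI[of _ "[t]"] exI[of _ 1]) (simp add: geom_values_def)
  define \<delta> where "\<delta> = (LEAST e. e > 0 \<and> R (g ^ e))"
  have "p - 1 > 0 \<and> R (g ^ (p - 1))"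
    using prime_gt_1_nat[OF p(1)] R_1 R_cong[OF fermat] by simp
  then have \<delta>: "\<delta> > 0" "R (g ^ \<delta>)"
    unfolding \<delta>_def by (metis (mono_tags, lifting) LeastI)+
  have dvd: "\<delta> dvd e" if "R (g ^ e)" for e
  proof (rule ccontr)
    assume "\<not> \<delta> dvd e"
    then have "e mod \<delta> > 0"
      by (simp add: mod_greater_zero_iff_not_dvd)
    define k where "k = e div \<delta>"
    \<comment> \<open>The exponent p - 2 serves as -1: this is division by (g^\<delta>)^k within the
      set.\<close>
    have "R (g ^ e * (g ^ \<delta>) ^ (k * (p - 2)))"
      by (intro R_mult R_pow that \<delta>)
    moreover have "g ^ e * (g ^ \<delta>) ^ (k * (p - 2)) = g ^ (e mod \<delta>) * (g ^ (p - 1)) ^ (\<delta> * k)"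
    proof -
      have "e + \<delta> * (k * (p - 2)) = e mod \<delta> + (p - 1) * (\<delta> * k)"
      proof -
        have "e = \<delta> * k + e mod \<delta>"
          by (simp add: k_def)
        moreover have "p - 1 = Suc (p - 2)"
          using p(2) by simp
        moreover have "\<delta> * k + r + \<delta> * (k * u) = r + Suc u * (\<delta> * k)" for r u
          by (simp add: algebra_simps)
        ultimately show ?thesis
          by metis
      qed
      then show ?thesis
        by (simp flip: power_mult power_add)
    qed
    moreover have "[g ^ (e mod \<delta>) * (g ^ (p - 1)) ^ (\<delta> * k) = g ^ (e mod \<delta>) * 1 ^ (\<delta> * k)] (mod p)"
      by (intro cong_mult cong_pow fermat cong_refl)
    ultimately have "R (g ^ (e mod \<delta>))"
      using R_cong by simp
    then have "\<delta> \<le> e mod \<delta>"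
      unfolding \<delta>_def using \<open>e mod \<delta> > 0\<close> by (intro Least_le) (simp add: \<delta>_def)
    then show False
      using \<delta>(1) by (meson mod_less_divisor not_le)
  qed
  have "\<delta> = 1"
  proof (rule ccontr)
    assume "\<delta> \<noteq> 1"
    then have \<delta>2: "\<delta> \<ge> 2"
      using \<delta>(1) by simp
    have "\<delta> dvd p - 1"
      by (intro dvd) (use R_1 R_cong[OF fermat] in simp)
    then obtain m where m: "p - 1 = \<delta> * m" ..
    have "\<delta> dvd s - 1"
      by (intro dvd R_power)
    then have "\<delta> \<le> s - 1"
      using s3 by (intro dvd_imp_le) auto
    have "2 * m \<le> p - 1"
      unfolding m using \<delta>2 by simp
    moreover have "m \<ge> 2"
    proof (rule ccontr)
      assume "\<not> m \<ge> 2"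
      then have "m \<le> 1"
        by simp
      then have "\<delta> * m \<le> (s - 1) * 1"
        using \<open>\<delta> \<le> s - 1\<close> by (intro mult_le_mono)
      then show False
        using m p(2) by linarith
    qed
    moreover have "p dvd geom_form s t 1 \<or> [geom_form s t 1 ^ m = 1] (mod p)" for t
    proof (cases "p dvd geom_form s t 1")
      case False
      then obtain e where e: "[geom_form s t 1 = g ^ e] (mod p)"
        using ex_discrete_log[OF p(1) g] by blast
      then have "\<delta> dvd e"
        using R_value R_cong dvd by blast
      then obtain k where k: "e = \<delta> * k" ..
      have "[geom_form s t 1 ^ m = (g ^ e) ^ m] (mod p)"
        by (rule cong_pow[OF e])
      also have "(g ^ e) ^ m = (g ^ (p - 1)) ^ k"
        unfolding k m power_mult[symmetric] by (simp only: mult_ac)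
      also have "[(g ^ (p - 1)) ^ k = 1 ^ k] (mod p)"
        by (rule cong_pow[OF fermat])
      finally show ?thesis by simp
    qed simp
    ultimately show False
      by (intro geom_form_not_in_subgroup[OF s(1) p, of m])
  qed
  obtain e where "[x = g ^ e] (mod p)"
    using ex_discrete_log[OF p(1) g x] by blast
  moreover have "R (g ^ e)"
    using R_pow[OF \<delta>(2), of e] \<open>\<delta> = 1\<close> by simp
  ultimately show ?thesis
    using R_cong unfolding R_def by blast
qed

text \<open>
  Among \<open>s\<close> prefixes of a list of values, two agree modulo \<open>(s - 1)\<close>-th powers, so the block between
  them can be absorbed in the power. Padding with the value at \<open>0\<close>, which is \<open>1\<close>, makes the
  number of factors independent of \<open>p\<close>.
\<close>

lemma geom_values_bounded_length:
  assumes s: "prime s" "odd s" and p: "prime p" "p > 4 * s + 1" and x: "\<not> p dvd x"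
  shows "\<exists>ts a. length ts = s \<and> [x = geom_values s ts * a ^ (s - 1)] (mod p)"
proof -
  obtain g where g: "residue_primroot p g"
    using prime_primitive_root_exists[OF prime_gt_1_nat[OF p(1)] p(1)] by blast
  have s3: "s \<ge> 3"
    using s prime_ge_2_nat[OF s(1)] by (cases "s = 2") auto
  have shorten: "\<exists>us b. length us < length ts \<and> [x = geom_values s us * b ^ (s - 1)] (mod p)"
    if ts: "[x = geom_values s ts * a ^ (s - 1)] (mod p)" and long: "length ts > s" for ts a
  proof -
    have "\<not> p dvd geom_values s ts"
    proof
      assume "p dvd geom_values s ts"
      then have "p dvd geom_values s ts * a ^ (s - 1)"
        by (rule dvd_mult2)
      then show False
        using ts x cong_dvd_iff by blast
    qed
    then have "\<not> p dvd geom_values s (take i ts)" for i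
      by (metis append_take_drop_id dvd_mult2 geom_values_append)
    then have "\<exists>e. [geom_values s (take i ts) = g ^ e] (mod p)" for i
      using ex_discrete_log[OF p(1) g] by blast
    then obtain e where e: "\<And>i. [geom_values s (take i ts) = g ^ e i] (mod p)"
      by metis
    have "\<not> inj_on (\<lambda>i. e i mod (s - 1)) {..<s}"
    proof
      assume "inj_on (\<lambda>i. e i mod (s - 1)) {..<s}"
      then have "card {..<s} \<le> card {..<s - 1}"
        using s3 by (intro card_inj_on_le[of "\<lambda>i. e i mod (s - 1)"]) auto
      then show False
        using s3 by simp
    qed
    then obtain i j where ij: "i < j" "j < s" "e i mod (s - 1) = e j mod (s - 1)"
      unfolding inj_on_def by (metis lessThan_iff linorder_neqE_nat)
    define B where "B = geom_values s (take (j - i) (drop i ts))"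
    have take_j: "geom_values s (take j ts) = geom_values s (take i ts) * B"
      using ij(1) by (simp add: B_def flip: geom_values_append take_add)
    have prime_g: "coprime p (g ^ k)" for k
      using g by (simp add: residue_primroot_def)
    have "\<exists>b. [B = b ^ (s - 1)] (mod p)"
    proof -
      have B: "[g ^ e j = g ^ e i * B] (mod p)"
        using e[of i] e[of j] take_j by (metis cong_mult cong_refl cong_sym cong_trans)
      \<comment> \<open>Instead of dividing by g^(e i), multiply by g^n: then n + e i is a multiple
        of s - 1, and so is n + e j.\<close>
      define n where "n = e i * (s - 2)"
      have gB: "[g ^ (e i * (s - 1)) * B = g ^ (n + e j)] (mod p)"
      proof -
        have "e i * (s - 1) = n + e i"
        proof -
          have "s - 1 = Suc (s - 2)"
            using s3 by simp
          then show ?thesis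
            by (simp add: n_def)
        qed
        then have "g ^ (e i * (s - 1)) * B = g ^ n * (g ^ e i * B)"
          by (simp add: power_add mult.assoc)
        also have "[g ^ n * (g ^ e i * B) = g ^ n * g ^ e j] (mod p)"
          using B cong_sym by (intro cong_mult cong_refl)
        finally show ?thesis
          by (simp add: power_add)
      qed
      have "(s - 1) dvd n + e j"
      proof -
        have "(n + e j) mod (s - 1) = (n + e i) mod (s - 1)"
          using ij(3) by (metis mod_add_right_eq)
        also have "n + e i = e i * (s - 1)"
        proof -
          have "s - 1 = Suc (s - 2)"
            using s3 by simp
          then show ?thesis
            by (simp add: n_def)
        qed
        finally show ?thesis
          by (simp add: mod_eq_0_iff_dvd)
      qed
      then obtain k where k: "n + e j = (s - 1) * k" ..
      obtain h where h: "[g * h = 1] (mod p)"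
        using ex_inverse_mod_nat[of p g] prime_g[of 1] by auto
      have "[(g * h) ^ (e i * (s - 1)) * B = 1 ^ (e i * (s - 1)) * B] (mod p)"
        by (intro cong_mult cong_pow h cong_refl)
      then have "[B = (g * h) ^ (e i * (s - 1)) * B] (mod p)"
        using cong_sym by simp
      also have "(g * h) ^ (e i * (s - 1)) * B = h ^ (e i * (s - 1)) * (g ^ (e i * (s - 1)) * B)"
        by (simp add: power_mult_distrib mult_ac)
      also have "[\<dots> = h ^ (e i * (s - 1)) * g ^ (n + e j)] (mod p)"
        by (intro cong_mult cong_refl gB)
      also have "h ^ (e i * (s - 1)) * g ^ (n + e j) = (h ^ e i * g ^ k) ^ (s - 1)"
        unfolding k power_mult_distrib power_mult[symmetric] by (simp only: mult.commute[of k])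
      finally show ?thesis by blast
    qed
    then obtain b where b: "[B = b ^ (s - 1)] (mod p)" ..
    define us where "us = take i ts @ drop j ts"
    have "geom_values s ts = geom_values s (take j ts) * geom_values s (drop j ts)"
      by (simp flip: geom_values_append)
    then have eq: "geom_values s ts * a ^ (s - 1) = geom_values s us * a ^ (s - 1) * B"
      by (simp add: take_j us_def geom_values_append mult_ac)
    have "[geom_values s us * a ^ (s - 1) * B = geom_values s us * a ^ (s - 1) * b ^ (s - 1)] (mod p)"
      by (intro cong_mult b cong_refl)
    then have "[x = geom_values s us * (a * b) ^ (s - 1)] (mod p)"
      using ts unfolding eq by (metis cong_trans mult.assoc power_mult_distrib)
    moreover have "length us < length ts"
      using ij long by (simp add: us_def)
    ultimately show ?thesis by blast
  qed
  have ex: "\<exists>ts a. [x = geom_values s ts * a ^ (s - 1)] (mod p)"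
    by (rule geom_values_times_powers_generate[OF s p x])
  define L where "L n \<longleftrightarrow> (\<exists>ts a. length ts = n \<and> [x = geom_values s ts * a ^ (s - 1)] (mod p))" for n
  have "\<exists>n. L n"
    using ex unfolding L_def by blast
  then have least: "L (LEAST n. L n)"
    by (rule LeastI_ex)
  have "(LEAST n. L n) \<le> s"
  proof (rule ccontr)
    assume gt: "\<not> (LEAST n. L n) \<le> s"
    obtain ts a where "length ts = (LEAST n. L n)" "[x = geom_values s ts * a ^ (s - 1)] (mod p)"
      using least unfolding L_def by blast
    then obtain us b where "length us < (LEAST n. L n)" "[x = geom_values s us * b ^ (s - 1)] (mod p)"
      using shorten[of ts a] gt by auto
    then show False
      using not_less_Least[of "length us" L] unfolding L_def by blast
  qed
  then obtain ts a where ts: "length ts \<le> s" "[x = geom_values s ts * a ^ (s - 1)] (mod p)"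
    using least unfolding L_def by metis
  have "geom_values s (replicate n 0) = 1" for n
    using s3 by (simp add: geom_values_def geom_form_0_left)
  then have "geom_values s (ts @ replicate (s - length ts) 0) = geom_values s ts"
    by (simp add: geom_values_append)
  then show ?thesis
    using ts by (intro exI[of _ "ts @ replicate (s - length ts) 0"] exI[of _ a]) simp
qed

text \<open>If x is 1 modulo m' and modulo p, then in x^p - 1 = (x - 1) (1 + x + ... + x^(p - 1))
  the two factors contribute m' and p. The exponent \<open>m\<close> is generous, but it lifts
  congruences from primes to any modulus.\<close>

lemma power_cong_1_of_primes:
  fixes w m :: nat
  assumes "m > 0" and "\<And>p. prime p \<Longrightarrow> p dvd m \<Longrightarrow> [w = 1] (mod p)"
  shows "[w ^ m = 1] (mod m)"
  using assms
proof (induction m rule: less_induct)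
  case (less m)
  show ?case
  proof (cases "m = 1")
    case False
    then obtain p where p: "prime p" "p dvd m"
      using prime_factor_nat by blast
    obtain m' where m: "m = p * m'"
      using p(2) by (elim dvdE)
    have "m' < m" "m' > 0"
      using less.prems(1) prime_gt_1_nat[OF p(1)] by (auto simp: m)
    then have IH: "[w ^ m' = 1] (mod m')"
      using less.prems by (intro less.IH) (auto simp: m)
    define x where "x = int (w ^ m')"
    have "int m' dvd x - 1"
      using IH unfolding x_def by (metis cong_iff_dvd_diff cong_int_iff of_nat_1)
    moreover have "int p dvd (\<Sum>i<p. x ^ i)"
    proof -
      have "[w ^ m' = 1 ^ m'] (mod p)"
        using less.prems(2)[OF p] by (rule cong_pow)
      then have "[x = 1] (mod int p)"
        unfolding x_def by (metis cong_int_iff of_nat_1 power_one)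
      then have "[(\<Sum>i<p. x ^ i) = (\<Sum>i<p. 1 ^ i)] (mod int p)"
        by (intro cong_sum cong_pow)
      also have "(\<Sum>i<p. 1 ^ i) = int p"
        by simp
      also have "[int p = 0] (mod int p)"
        by (simp add: cong_0_iff)
      finally show ?thesis
        by (simp only: cong_0_iff)
    qed
    ultimately have "int m' * int p dvd (x - 1) * (\<Sum>i<p. x ^ i)"
      by (rule mult_dvd_mono)
    then have "int m dvd x ^ p - 1"
      by (simp add: m mult.commute power_diff_1_eq)
    then have "[int (w ^ m) = int 1] (mod int m)"
      by (simp add: x_def m cong_iff_dvd_diff mult.commute power_mult)
    then show ?thesis
      by (simp only: cong_int_iff)
  qed simp
qed

text \<open>With w = v / b^n, which is 1 modulo all primes of \<open>m\<close>, the m-th power of w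
  is 1. An inverse j of n modulo \<open>m\<close> then gives w = (w^j)^n, and b w^j is the required
  root.\<close>

lemma ex_power_root_mod:
  fixes v b m n :: nat
  assumes m: "m > 0" "coprime m n" "coprime m b"
    and roots: "\<And>p. prime p \<Longrightarrow> p dvd m \<Longrightarrow> [v = b ^ n] (mod p)"
  shows "\<exists>a. [a ^ n = v] (mod m)"
proof -
  obtain c where c: "[b * c = 1] (mod m)"
    using ex_inverse_mod_nat[OF m(3)] by blast
  define w where "w = v * c ^ n"
  have "[w = 1] (mod p)" if p: "prime p" "p dvd m" for p
  proof -
    have "[w = b ^ n * c ^ n] (mod p)"
      unfolding w_def by (intro cong_mult roots[OF p] cong_refl)
    also have "b ^ n * c ^ n = (b * c) ^ n"
      by (simp add: power_mult_distrib)
    also have "[(b * c) ^ n = 1 ^ n] (mod p)"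
      by (intro cong_pow cong_dvd_modulus_nat[OF c p(2)])
    finally show ?thesis by simp
  qed
  then have wm: "[w ^ m = 1] (mod m)"
    by (rule power_cong_1_of_primes[OF m(1)])
  obtain j where j: "[n * j = 1] (mod m)"
    using ex_inverse_mod_nat[OF m(2)] by blast
  have "[w ^ (n * j) = w] (mod m)"
  proof (cases "m = 1")
    case False
    then have "n * j \<ge> 1"
      using j m(1) by (cases "n * j = 0") (auto simp: cong_def)
    then obtain k where k: "n * j = 1 + m * k"
      using j by (metis cong_altdef_nat cong_sym_eq dvdE le_add_diff_inverse)
    have "w ^ (n * j) = w * (w ^ m) ^ k"
      by (simp add: k power_add power_mult)
    also have "[\<dots> = w * 1 ^ k] (mod m)"
      by (intro cong_mult cong_pow wm cong_refl)
    finally show ?thesis by simp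
  qed simp
  then have "[b ^ n * w ^ (n * j) = b ^ n * w] (mod m)"
    by (intro cong_mult cong_refl)
  also have "b ^ n * w = v * (b * c) ^ n"
    by (simp add: w_def power_mult_distrib mult_ac)
  also have "[v * (b * c) ^ n = v * 1 ^ n] (mod m)"
    by (intro cong_mult cong_pow c cong_refl)
  finally show ?thesis
    by (intro exI[of _ "b * w ^ j"]) (simp add: power_mult_distrib mult.commute flip: power_mult)
qed

text \<open>Chinese remaindering is applied to the primes of \<open>q\<close> only. Raising the
  result to the power \<open>q\<close> makes its s-th power 1 modulo all of \<open>q\<close>, and
  changes nothing modulo these primes because \<open>q\<close> is 1 modulo \<open>s\<close>.\<close>

lemma ex_root_of_unity_mod:
  assumes q: "q > 0" and s: "s > 0" and primes: "\<And>p. prime p \<Longrightarrow> p dvd q \<Longrightarrow> [p = 1] (mod s)"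
  shows "\<exists>z::int. [z ^ s = 1] (mod int q) \<and> (\<forall>j\<in>{1..<s}. coprime (int q) (z ^ j - 1))"
proof -
  have "\<exists>a. [a ^ s = 1] (mod p) \<and> (\<forall>j\<in>{1..<s}. [a ^ j \<noteq> 1] (mod p))" if p: "p \<in> prime_factors q" for p
  proof -
    have pp: "prime p" "p dvd q"
      using p by auto
    obtain g where g: "residue_primroot p g"
      using prime_primitive_root_exists[OF prime_gt_1_nat[OF pp(1)] pp(1)] by blast
    have ord: "ord p g = p - 1"
      using g pp(1) by (auto simp: residue_primroot_def totient_prime)
    have "s dvd p - 1"
      using primes[OF pp] prime_gt_0_nat[OF pp(1)] by (metis One_nat_def Suc_leI cong_altdef_nat)
    then obtain k where k: "p - 1 = s * k" ..
    have "k > 0"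
      using k prime_gt_1_nat[OF pp(1)] by (cases k) auto
    have *: "[(g ^ k) ^ j = 1] (mod p) \<longleftrightarrow> s dvd j" for j
    proof -
      have "[(g ^ k) ^ j = 1] (mod p) \<longleftrightarrow> k * s dvd k * j"
        unfolding power_mult[symmetric] ord_divides ord k by (simp only: mult.commute)
      then show ?thesis
        using \<open>k > 0\<close> by simp
    qed
    show ?thesis
      using * by (intro exI[of _ "g ^ k"]) (auto dest: dvd_imp_le)
  qed
  then obtain a where a: "\<And>p. p \<in> prime_factors q \<Longrightarrow> [a p ^ s = 1] (mod p)"
      "\<And>p j. p \<in> prime_factors q \<Longrightarrow> j \<in> {1..<s} \<Longrightarrow> [a p ^ j \<noteq> 1] (mod p)"
    by metis
  have "\<exists>x. \<forall>p\<in>prime_factors q. [x = a p] (mod p)"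
    by (rule chinese_remainder_nat) (auto intro: primes_coprime)
  then obtain x where x: "\<And>p. p \<in> prime_factors q \<Longrightarrow> [x = a p] (mod p)"
    by blast
  have xs: "[(x ^ s) ^ q = 1] (mod q)"
  proof (rule power_cong_1_of_primes[OF q])
    fix p assume "prime p" "p dvd q"
    then have p: "p \<in> prime_factors q"
      using q by (simp add: prime_factors_dvd)
    have "[x ^ s = a p ^ s] (mod p)"
      by (rule cong_pow[OF x[OF p]])
    then show "[x ^ s = 1] (mod p)"
      using a(1)[OF p] cong_trans by blast
  qed
  have q1: "[q = 1] (mod s)"
  proof -
    have "q = (\<Prod>p\<in>prime_factors q. p ^ multiplicity p q)"
      using q by (simp add: prime_factorization_nat)
    moreover have "[(\<Prod>p\<in>prime_factors q. p ^ multiplicity p q) = (\<Prod>p\<in>prime_factors q. 1 ^ multiplicity p q)] (mod s)"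
      by (intro cong_prod cong_pow primes) auto
    ultimately show ?thesis by simp
  qed
  define z where "z = int (x ^ q)"
  have "[int ((x ^ q) ^ s) = int 1] (mod int q)"
    using xs by (simp only: cong_int_iff mult.commute flip: power_mult)
  then have "[z ^ s = 1] (mod int q)"
    by (simp add: z_def)
  moreover have "coprime (int q) (z ^ j - 1)" if j: "j \<in> {1..<s}" for j
  proof (rule ccontr)
    assume "\<not> coprime (int q) (z ^ j - 1)"
    then obtain c where "c dvd int q" "c dvd z ^ j - 1" "\<not> is_unit c"
      by (meson Rings.coprimeI)
    moreover have "c \<noteq> 0"
      using \<open>c dvd int q\<close> q by auto
    ultimately obtain r where r: "prime r" "r dvd int q" "r dvd z ^ j - 1"
      using prime_divisor_exists[of c] dvd_trans by blast
    define p where "p = nat r"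
    have p: "int p = r" "prime p"
      using r(1) prime_gt_0_int[of r] by (auto simp: p_def)
    then have "p dvd q"
      using r(2) by (metis int_dvd_int_iff)
    then have pq: "p \<in> prime_factors q"
      using p(2) q by (simp add: prime_factors_dvd)
    have "[int ((x ^ q) ^ j) = int 1] (mod int p)"
      using r(3) by (simp add: p(1) z_def cong_iff_dvd_diff)
    then have "[(x ^ q) ^ j = 1] (mod p)"
      by (simp only: cong_int_iff)
    moreover have "[(x ^ q) ^ j = (a p ^ q) ^ j] (mod p)"
      by (intro cong_pow x[OF pq])
    moreover have "[a p ^ q = a p ^ 1] (mod p)"
    proof -
      have "[a p ^ s = 1] (mod p)"
        by (rule a(1)[OF pq])
      then have "ord p (a p) dvd s"
        by (rule ord_divides[THEN iffD1])
      then have "[q = 1] (mod ord p (a p))"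
        using q1 cong_dvd_modulus_nat by blast
      moreover have "coprime p (a p)"
        using cong_imp_coprime[OF cong_sym[OF \<open>[a p ^ s = 1] (mod p)\<close>]] s by (simp add: ac_simps)
      ultimately show ?thesis
        using order_divides_expdiff by blast
    qed
    then have "[(a p ^ q) ^ j = (a p ^ 1) ^ j] (mod p)"
      by (rule cong_pow)
    ultimately have "[a p ^ j = 1] (mod p)"
      by (metis cong_sym cong_trans power_one_right)
    then show False
      using a(2)[OF pq j] by simp
  qed
  ultimately show ?thesis
    by blast
qed

section \<open>The cofactor\<close>

lemma prime_dvd_geom_form_imp_cong:
  assumes "prime r" "r dvd geom_form s a b"
  shows "[a ^ s = b ^ s] (mod r)"
proof -
  have "int r dvd (int a - int b) * int (geom_form s a b)"
    using assms(2) by simp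
  then have "[int (a ^ s) = int (b ^ s)] (mod int r)"
    unfolding geom_form_diff by (simp add: cong_iff_dvd_diff)
  then show ?thesis
    by (simp only: cong_int_iff)
qed

text \<open>Modulo \<open>r\<close>, the quotient a / b has order 1 or \<open>s\<close>. Order
  \<open>s\<close> gives the claim. Order 1 would make the form equal to s b^(s - 1), so
  \<open>r\<close> would divide \<open>s\<close> or \<open>b\<close>, hence \<open>b\<close> in
  either case, which coprimality excludes.\<close>

lemma prime_factor_geom_form_cong_1:
  assumes s: "prime s" and r: "prime r" "r dvd geom_form s a b" and ab: "coprime a b" "s dvd b"
  shows "[r = 1] (mod s)"
proof -
  have s1: "s > 1"
    using prime_gt_1_nat[OF s] .
  have pow: "[a ^ s = b ^ s] (mod r)"
    by (rule prime_dvd_geom_form_imp_cong[OF r])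
  have "\<not> r dvd b"
  proof
    assume "r dvd b"
    then have "r dvd b ^ s"
      using s1 by (simp add: dvd_power_iff_le dvd_trans[OF _ dvd_power])
    then have "r dvd a ^ s"
      using pow cong_dvd_iff by blast
    then have "r dvd a"
      using r(1) prime_dvd_power by blast
    then show False
      using ab(1) \<open>r dvd b\<close> r(1) by (metis Rings.coprime_common_divisor not_prime_unit)
  qed
  then have rb: "coprime r b"
    using r(1) prime_imp_coprime by blast
  obtain c where c: "[b * c = 1] (mod r)"
    using ex_inverse_mod_nat[OF rb] by blast
  define t where "t = a * c"
  have "[t ^ s = b ^ s * c ^ s] (mod r)"
    unfolding t_def power_mult_distrib by (intro cong_mult pow cong_refl)
  also have "b ^ s * c ^ s = (b * c) ^ s"
    by (simp add: power_mult_distrib)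
  also have "[(b * c) ^ s = 1 ^ s] (mod r)"
    by (rule cong_pow[OF c])
  finally have "ord r t dvd s"
    unfolding power_one by (rule ord_divides[THEN iffD1])
  then have "ord r t = 1 \<or> ord r t = s"
    using s by (simp add: prime_nat_iff)
  moreover have "ord r t \<noteq> 1"
  proof
    assume "ord r t = 1"
    then have "[t ^ 1 = 1] (mod r)"
      using ord_works[of t r] by simp
    then have "[b * t = b * 1] (mod r)"
      by (intro cong_mult cong_refl) simp
    moreover have "[a * (b * c) = a * 1] (mod r)"
      by (intro cong_mult cong_refl c)
    ultimately have ab_cong: "[a = b] (mod r)"
      by (simp add: t_def mult_ac) (meson cong_sym cong_trans)
    have "[geom_form s a b = geom_form s b b] (mod r)"
      by (intro geom_form_cong ab_cong cong_refl)
    also have "geom_form s b b = (\<Sum>i<s. b ^ (s - 1))"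
      unfolding geom_form_def by (intro sum.cong) (simp_all flip: power_add)
    also have "\<dots> = s * b ^ (s - 1)"
      by simp
    finally have "r dvd s * b ^ (s - 1)"
      using r(2) cong_dvd_iff by blast
    then have "r dvd s"
      using r(1) \<open>\<not> r dvd b\<close> by (metis prime_dvd_mult_iff prime_dvd_power)
    then show False
      using ab(2) \<open>\<not> r dvd b\<close> by (meson dvd_trans)
  qed
  ultimately have "ord r t = s"
    by blast
  moreover have "coprime r t"
  proof -
    have "coprime (t ^ s) r"
      using cong_imp_coprime[of 1 "t ^ s" r] \<open>[(b * c) ^ s = 1 ^ s] (mod r)\<close> pow
      by (metis \<open>ord r t = s\<close> cong_sym ord_works coprime_1_left)
    then show ?thesis
      using s1 by (simp add: ac_simps)
  qed
  ultimately have "s dvd r - 1"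
    using order_divides_totient[of r t] r(1) by (simp add: totient_prime)
  then show ?thesis
    using prime_gt_0_nat[OF r(1)] by (simp add: cong_altdef_nat)
qed

text \<open>Each p excludes at most \<open>s\<close> of the candidates j, since candidates below p
  give distinct solutions of x^s = b^s modulo p. Among \<open>s * card A + 1\<close> candidates one
  remains.\<close>

lemma geom_form_avoiding_primes:
  assumes s: "s > 0" and A: "finite A"
    and p: "\<And>p. p \<in> A \<Longrightarrow> prime p \<and> coprime p D \<and> p > s * card A"
  shows "\<exists>j\<le>s * card A. \<forall>p\<in>A. \<not> p dvd geom_form s (a + D * j) b"
proof (rule ccontr)
  assume no: "\<not> ?thesis"
  define bad where "bad p = {j. j \<le> s * card A \<and> p dvd geom_form s (a + D * j) b}" for p
  have "card (bad p) \<le> s" if pA: "p \<in> A" for p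
  proof -
    have "inj_on (\<lambda>j. (a + D * j) mod p) (bad p)"
    proof
      fix j k assume jk: "j \<in> bad p" "k \<in> bad p" "(a + D * j) mod p = (a + D * k) mod p"
      then have "[a + D * j = a + D * k] (mod p)"
        by (simp add: cong_def)
      then have "[D * j = D * k] (mod p)"
        by (simp only: cong_add_lcancel_nat)
      moreover have "coprime D p"
        using p[OF pA] by (simp add: ac_simps)
      ultimately have "[j = k] (mod p)"
        by (simp add: cong_mult_lcancel_nat)
      moreover have "j < p" "k < p"
        using jk p[OF pA] by (auto simp: bad_def)
      ultimately show "j = k"
        by (simp add: cong_def)
    qed
    moreover have "(\<lambda>j. (a + D * j) mod p) ` bad p \<subseteq> {x \<in> {..<p}. [x ^ s = b ^ s] (mod p)}"
    proof clarify
      fix j assume "j \<in> bad p"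
      then have "[(a + D * j) ^ s = b ^ s] (mod p)"
        using p[OF pA] by (intro prime_dvd_geom_form_imp_cong) (auto simp: bad_def)
      moreover have "[((a + D * j) mod p) ^ s = (a + D * j) ^ s] (mod p)"
        by (intro cong_pow) (simp add: cong_def)
      ultimately show "(a + D * j) mod p \<in> {..<p} \<and> [((a + D * j) mod p) ^ s = b ^ s] (mod p)"
        using p[OF pA] prime_gt_0_nat cong_trans by auto
    qed
    ultimately have "card (bad p) \<le> card {x \<in> {..<p}. [x ^ s = b ^ s] (mod p)}"
      by (intro card_inj_on_le[of "\<lambda>j. (a + D * j) mod p"]) auto
    also have "\<dots> \<le> s"
      using p[OF pA] s by (intro roots_mod_prime_bound) auto
    finally show ?thesis .
  qed
  then have "card (\<Union>p\<in>A. bad p) \<le> card A * s"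
    using card_UN_le[OF A, of bad] sum_bounded_above[of A "\<lambda>p. card (bad p)" s] by simp
  moreover have "{..s * card A} \<subseteq> (\<Union>p\<in>A. bad p)"
    using no by (auto simp: bad_def)
  then have "card {..s * card A} \<le> card (\<Union>p\<in>A. bad p)"
    using A by (intro card_mono) (auto simp: bad_def)
  ultimately show False
    by (simp add: mult.commute)
qed

lemma geom_form_bounds:
  assumes "a \<le> X" "b \<le> X" "X > 0" "s > 0"
  shows "b ^ (s - 1) \<le> geom_form s a b" "geom_form s a b \<le> s * X ^ s"
proof -
  have "a ^ 0 * b ^ (s - 1 - 0) \<le> geom_form s a b"
    unfolding geom_form_def using assms(4) by (intro member_le_sum) auto
  then show "b ^ (s - 1) \<le> geom_form s a b"
    by simp
  have "geom_form s a b \<le> (\<Sum>i<s. X ^ s)"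
    unfolding geom_form_def
  proof (intro sum_mono)
    fix i assume "i \<in> {..<s}"
    then have "a ^ i * b ^ (s - 1 - i) \<le> X ^ i * X ^ (s - 1 - i)"
      using assms by (intro mult_le_mono power_mono) auto
    also have "\<dots> = X ^ (i + (s - 1 - i))"
      by (simp add: power_add)
    also have "\<dots> \<le> X ^ s"
      using assms \<open>i \<in> {..<s}\<close> by (intro power_increasing) auto
    finally show "a ^ i * b ^ (s - 1 - i) \<le> X ^ s" .
  qed
  then show "geom_form s a b \<le> s * X ^ s"
    by simp
qed

text \<open>\<open>a\<close> is chosen 1 modulo \<open>K\<close>, which divides \<open>b\<close>:
  this makes the value 1 modulo \<open>K\<close> and its prime factors 1 modulo \<open>s\<close>.
  Shifting \<open>a\<close> by multiples of K M avoids \<open>A\<close>. The use with b = K gives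
  prescribed values of the form modulo the primes of \<open>M\<close>; the use with b = K M gives
  pure (s - 1)-th powers modulo \<open>M\<close>.\<close>

lemma ex_geom_form_factor:
  fixes s K M a0 b :: nat
  assumes s: "prime s" and K: "K > 1" "s dvd K" and cop: "coprime K M" and M: "M > 0"
    and b: "K dvd b" "b dvd K * M" "coprime a0 (gcd b M)"
    and A: "finite A" "\<And>p. p \<in> A \<Longrightarrow> prime p \<and> coprime p (K * M) \<and> p > s * card A"
  shows "\<exists>u. [u = geom_form s a0 b] (mod M) \<and> [u = 1] (mod K) \<and> (\<forall>r. prime r \<longrightarrow> r dvd u \<longrightarrow> [r = 1] (mod s)) \<and>
    (\<forall>p\<in>A. \<not> p dvd u) \<and> b ^ (s - 1) \<le> u \<and> u \<le> s * (K * M * (s * card A + 1)) ^ s"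
proof -
  have s0: "s > 0"
    using prime_gt_0_nat[OF s] .
  obtain a1 where a1: "[a1 = a0] (mod M)" "[a1 = 1] (mod K)"
    using binary_chinese_remainder_nat[of M K a0 1] cop by (auto simp: ac_simps)
  define a2 where "a2 = a1 mod (K * M)"
  obtain j where j: "j \<le> s * card A" "\<forall>p\<in>A. \<not> p dvd geom_form s (a2 + K * M * j) b"
    using geom_form_avoiding_primes[OF s0 A(1), of "K * M" a2 b] A(2) by blast
  define a where "a = a2 + K * M * j"
  have "[a = a1] (mod K * M)"
    by (simp add: a_def a2_def cong_def)
  then have a: "[a = a0] (mod M)" "[a = 1] (mod K)"
    using a1 cong_dvd_modulus_nat cong_trans by (meson dvd_triv_left dvd_triv_right)+
  have "coprime a b"
  proof (rule Rings.coprimeI)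
    have *: False if r: "prime r" "r dvd a" "r dvd b" for r
    proof -
      have "r dvd K * M"
        using r(3) b(2) dvd_trans by blast
      then have "r dvd K \<or> r dvd M"
        using r(1) by (simp add: prime_dvd_mult_iff)
      then show False
      proof
        assume "r dvd K"
        then have "[a = 1] (mod r)"
          using a(2) cong_dvd_modulus_nat by blast
        then have "r dvd 1"
          using r(2) cong_dvd_iff by blast
        then show False
          using r(1) not_prime_unit by blast
      next
        assume "r dvd M"
        then have "[a = a0] (mod r)"
          using a(1) cong_dvd_modulus_nat by blast
        then have "r dvd a0"
          using r(2) cong_dvd_iff by blast
        moreover have "r dvd gcd b M"
          using r(3) \<open>r dvd M\<close> by simp
        ultimately have "is_unit r"
          using b(3) by (meson Rings.coprime_common_divisor)
        then show False
          using r(1) not_prime_unit by blast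
      qed
    qed
    fix c assume c: "c dvd a" "c dvd b"
    show "is_unit c"
    proof (rule ccontr)
      assume "\<not> is_unit c"
      then obtain r where "prime r" "r dvd c"
        by (metis nat_dvd_1_iff_1 prime_factor_nat)
      then show False
        using * c dvd_trans by blast
    qed
  qed
  define u where "u = geom_form s a b"
  have "s dvd b"
    using K(2) b(1) dvd_trans by blast
  have "[b = 0] (mod K)"
    using b(1) by (simp add: cong_0_iff)
  then have "[u = geom_form s 1 0] (mod K)"
    unfolding u_def by (intro geom_form_cong a(2))
  then have "[u = 1] (mod K)"
    using s0 by (simp add: geom_form_0_right)
  moreover have "[u = geom_form s a0 b] (mod M)"
    unfolding u_def by (intro geom_form_cong a(1) cong_refl)
  moreover have "[r = 1] (mod s)" if "prime r" "r dvd u" for r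
    using prime_factor_geom_form_cong_1[OF s that(1) _ \<open>coprime a b\<close> \<open>s dvd b\<close>] that(2) by (simp add: u_def)
  moreover have "\<forall>p\<in>A. \<not> p dvd u"
    using j(2) by (simp add: u_def a_def)
  moreover have "a \<le> K * M * (s * card A + 1)"
  proof -
    have "a2 \<le> K * M"
      using K M by (simp add: a2_def less_imp_le)
    moreover have "K * M * j \<le> K * M * (s * card A)"
      using j(1) by simp
    ultimately have "a2 + K * M * j \<le> K * M * (s * card A) + K * M * 1"
      by linarith
    then show ?thesis
      by (simp only: a_def distrib_left)
  qed
  moreover have "b \<le> K * M * (s * card A + 1)"
    using dvd_imp_le[OF b(2)] K M by (simp add: algebra_simps trans_le_add1)
  ultimately show ?thesis
    using geom_form_bounds[of a "K * M * (s * card A + 1)" b s] K M s0 unfolding u_def[symmetric] by auto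
qed

text \<open>
  A substitute for Linnik's theorem: \<open>q\<close> need not be prime, it suffices that a primitive \<open>s\<close>-th root
  of unity exists modulo \<open>q\<close>.
\<close>

lemma ex_cofactor:
  fixes s K M g :: nat
  assumes s: "prime s" "odd s" and K: "K > 1" "s dvd K" and cop: "coprime K M" and M: "M > 0"
    and large: "\<And>l. prime l \<Longrightarrow> l dvd M \<Longrightarrow> l > 4 * s + 1" and g: "coprime g M"
    and A: "finite A" "\<And>p. p \<in> A \<Longrightarrow> prime p \<and> coprime p (K * M) \<and> p > s * card A"
  shows "\<exists>q>1. [q = g] (mod M) \<and> [q = 1] (mod K) \<and> (\<forall>r. prime r \<longrightarrow> r dvd q \<longrightarrow> [r = 1] (mod s)) \<and>
    (\<forall>p\<in>A. \<not> p dvd q) \<and> q \<le> (s * (K * M * (s * card A + 1)) ^ s) ^ Suc s"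
proof -
  define X where "X = s * (K * M * (s * card A + 1)) ^ s"
  define L where "L = prime_factors M"
  have s3: "s \<ge> 3"
    using s prime_ge_2_nat[OF s(1)] by (cases "s = 2") auto
  have L: "prime l" "l dvd M" "l > 4 * s + 1" "\<not> l dvd K" "\<not> l dvd g" if "l \<in> L" for l
  proof -
    show l: "prime l" "l dvd M"
      using that by (auto simp: L_def)
    then show "l > 4 * s + 1"
      by (rule large)
    show "\<not> l dvd K" "\<not> l dvd g"
      using cop g l by (metis Rings.coprime_common_divisor not_prime_unit)+
  qed
  have "\<exists>ts a. length ts = s \<and> [g = geom_values s ts * a ^ (s - 1)] (mod l)" if "l \<in> L" for l
    using L[OF that] by (intro geom_values_bounded_length[OF s]) auto
  then obtain ts a where ts: "\<And>l. l \<in> L \<Longrightarrow> length (ts l) = s"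
      "\<And>l. l \<in> L \<Longrightarrow> [g = geom_values s (ts l) * a l ^ (s - 1)] (mod l)"
    by metis
  have crt: "\<exists>x. \<forall>l\<in>L. [x = c l] (mod l)" for c :: "nat \<Rightarrow> nat"
    by (rule chinese_remainder_nat) (auto simp: L_def intro: primes_coprime)
  have cop_L: "coprime M x" if "\<And>l. l \<in> L \<Longrightarrow> \<not> l dvd x" for x
  proof (rule ccontr)
    assume "\<not> coprime M x"
    then obtain c where "c dvd M" "c dvd x" "\<not> is_unit c"
      by (meson Rings.coprimeI)
    then obtain l where "prime l" "l dvd M" "l dvd x"
      by (metis dvd_trans nat_dvd_1_iff_1 prime_factor_nat)
    then show False
      using that[of l] M by (simp add: L_def prime_factors_dvd)
  qed
  \<comment> \<open>The i-th factor realises the i-th entry of the lists for all primes l at once.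
    Taking \<open>K\<close> in place of 1 as second argument costs only the factor K^(s -
    1).\<close>
  have "\<exists>u. (\<forall>l\<in>L. [u = K ^ (s - 1) * geom_form s (ts l ! i) 1] (mod l)) \<and> [u = 1] (mod K) \<and>
      (\<forall>r. prime r \<longrightarrow> r dvd u \<longrightarrow> [r = 1] (mod s)) \<and> (\<forall>p\<in>A. \<not> p dvd u) \<and> 0 < u \<and> u \<le> X" for i
  proof -
    obtain x where x: "\<And>l. l \<in> L \<Longrightarrow> [x = K * (ts l ! i)] (mod l)"
      using crt[of "\<lambda>l. K * (ts l ! i)"] by blast
    have gcd: "gcd K M = 1"
      using cop by (rule GCD.coprime_imp_gcd_eq_1)
    obtain u where u: "[u = geom_form s x K] (mod M)" "[u = 1] (mod K)"
        "\<forall>r. prime r \<longrightarrow> r dvd u \<longrightarrow> [r = 1] (mod s)" "\<forall>p\<in>A. \<not> p dvd u" "K ^ (s - 1) \<le> u" "u \<le> X"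
      using ex_geom_form_factor[OF s(1) K cop M dvd_refl _ _ A, of x] gcd unfolding X_def by auto
    have "[u = K ^ (s - 1) * geom_form s (ts l ! i) 1] (mod l)" if l: "l \<in> L" for l
    proof -
      have "[u = geom_form s x K] (mod l)"
        using u(1) L(2)[OF l] cong_dvd_modulus_nat by blast
      also have "[geom_form s x K = geom_form s (K * (ts l ! i)) (K * 1)] (mod l)"
        by (intro geom_form_cong x l) simp
      finally show ?thesis
        by (simp only: geom_form_scale)
    qed
    moreover have "u > 0"
      using u(5) K(1) by (metis gr0I le_zero_eq less_numeral_extra(3) less_trans power_eq_0_iff zero_less_one)
    ultimately show ?thesis
      using u by blast
  qed
  then obtain u where u: "\<And>i l. l \<in> L \<Longrightarrow> [u i = K ^ (s - 1) * geom_form s (ts l ! i) 1] (mod l)"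
      "\<And>i. [u i = 1] (mod K)" "\<And>i r. prime r \<Longrightarrow> r dvd u i \<Longrightarrow> [r = 1] (mod s)"
      "\<And>i p. p \<in> A \<Longrightarrow> \<not> p dvd u i" "\<And>i. 0 < u i" "\<And>i. u i \<le> X"
    by metis
  define U where "U = (\<Prod>i<s. u i)"
  have U_l: "[U = K ^ ((s - 1) * s) * geom_values s (ts l)] (mod l)" if l: "l \<in> L" for l
  proof -
    have "[U = (\<Prod>i<s. K ^ (s - 1) * geom_form s (ts l ! i) 1)] (mod l)"
      unfolding U_def by (intro cong_prod u l)
    also have "(\<Prod>i<s. K ^ (s - 1) * geom_form s (ts l ! i) 1) = K ^ ((s - 1) * s) * geom_values s (ts l)"
      using ts(1)[OF l] by (simp add: prod.distrib power_mult geom_values_def prod.list_conv_set_nth atLeast0LessThan)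
    finally show ?thesis .
  qed
  have U_cop: "coprime M U"
  proof (rule cop_L, rule notI)
    fix l assume l: "l \<in> L" "l dvd U"
    then have "l dvd K ^ ((s - 1) * s) * geom_values s (ts l)"
      using U_l cong_dvd_iff by blast
    then have "l dvd geom_values s (ts l)"
      using L[OF l(1)] by (metis prime_dvd_mult_iff prime_dvd_power)
    then have "l dvd geom_values s (ts l) * a l ^ (s - 1)"
      by (rule dvd_mult2)
    then show False
      using ts(2)[OF l(1)] L(5)[OF l(1)] cong_dvd_iff by blast
  qed
  obtain c where c: "[U * c = 1] (mod M)"
    using ex_inverse_mod_nat[OF U_cop] by blast
  obtain k where k: "[K * k = 1] (mod M)"
    using ex_inverse_mod_nat[of M K] cop by (auto simp: ac_simps)
  \<comment> \<open>The class modulo \<open>M\<close> that the last factor has to hit.\<close>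
  define v where "v = g * c"
  have Uv: "[U * v = g] (mod M)"
  proof -
    have "[g * (U * c) = g * 1] (mod M)"
      by (intro cong_mult cong_refl c)
    then show ?thesis
      by (simp add: v_def mult_ac)
  qed
  \<comment> \<open>An (s - 1)-th root of \<open>v\<close> modulo each l; the inverse
    \<open>k\<close> of \<open>K\<close> cancels the powers of \<open>K\<close> collected in
    \<open>U\<close>.\<close>
  obtain b where b: "\<And>l. l \<in> L \<Longrightarrow> [b = a l * k ^ s] (mod l)"
    using crt[of "\<lambda>l. a l * k ^ s"] by blast
  have vb: "[v = b ^ (s - 1)] (mod l)" if l: "l \<in> L" for l
  proof -
    have kl: "[K * k = 1] (mod l)"
      using k L(2)[OF l] cong_dvd_modulus_nat by blast
    have "[U * b ^ (s - 1) = (K ^ ((s - 1) * s) * geom_values s (ts l)) * (a l * k ^ s) ^ (s - 1)] (mod l)"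
      by (intro cong_mult cong_pow U_l b l)
    also have "(K ^ ((s - 1) * s) * geom_values s (ts l)) * (a l * k ^ s) ^ (s - 1) =
        (K * k) ^ ((s - 1) * s) * (geom_values s (ts l) * a l ^ (s - 1))"
      by (simp add: power_mult_distrib mult_ac flip: power_mult)
    also have "[\<dots> = 1 ^ ((s - 1) * s) * (geom_values s (ts l) * a l ^ (s - 1))] (mod l)"
      by (intro cong_mult cong_pow kl cong_refl)
    also have "[1 ^ ((s - 1) * s) * (geom_values s (ts l) * a l ^ (s - 1)) = g] (mod l)"
      using ts(2)[OF l] cong_sym by simp
    also have "[g = U * v] (mod l)"
      using Uv L(2)[OF l] cong_dvd_modulus_nat cong_sym by blast
    finally have "[U * v = U * b ^ (s - 1)] (mod l)"
      by (rule cong_sym)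
    moreover have "coprime U l"
      using U_cop L(2)[OF l] by (metis Rings.coprime_commute coprime_divisors dvd_refl)
    ultimately show ?thesis
      by (simp add: cong_mult_lcancel_nat)
  qed
  have v_l: "\<not> l dvd v" if l: "l \<in> L" for l
  proof
    assume "l dvd v"
    then have "l dvd U * v"
      by (rule dvd_mult)
    moreover have "[U * v = g] (mod l)"
      using Uv L(2)[OF l] cong_dvd_modulus_nat by blast
    ultimately show False
      using L(5)[OF l] cong_dvd_iff by blast
  qed
  have "coprime M b"
  proof (rule cop_L, rule notI)
    fix l assume l: "l \<in> L" "l dvd b"
    then have "l dvd b ^ (s - 1)"
      using s3 by (intro dvd_trans[OF l(2) dvd_power]) auto
    then show False
      using vb[OF l(1)] v_l[OF l(1)] cong_dvd_iff by blast
  qed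
  moreover have "coprime M (s - 1)"
  proof (rule cop_L, rule notI)
    fix l assume l: "l \<in> L" "l dvd s - 1"
    then have "l \<le> s - 1"
      using s3 by (intro dvd_imp_le) auto
    then show False
      using L(3)[OF l(1)] by linarith
  qed
  ultimately obtain a0 where a0: "[a0 ^ (s - 1) = v] (mod M)"
    using ex_power_root_mod[OF M, of "s - 1" b v] vb M by (auto simp: L_def prime_factors_dvd)
  have "coprime M a0"
  proof (rule cop_L, rule notI)
    fix l assume l: "l \<in> L" "l dvd a0"
    then have "l dvd a0 ^ (s - 1)"
      using s3 by (intro dvd_trans[OF l(2) dvd_power]) auto
    moreover have "[a0 ^ (s - 1) = v] (mod l)"
      using a0 L(2)[OF l(1)] cong_dvd_modulus_nat by blast
    ultimately show False
      using v_l[OF l(1)] cong_dvd_iff by blast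
  qed
  then have a0_cop: "coprime a0 (gcd (K * M) M)"
    by (simp add: ac_simps)
  \<comment> \<open>Modulo \<open>M\<close> the second argument vanishes, so this value is
    \<open>a0 ^ (s - 1)\<close>.\<close>
  obtain u' where u': "[u' = geom_form s a0 (K * M)] (mod M)" "[u' = 1] (mod K)"
      "\<forall>r. prime r \<longrightarrow> r dvd u' \<longrightarrow> [r = 1] (mod s)" "\<forall>p\<in>A. \<not> p dvd u'" "(K * M) ^ (s - 1) \<le> u'" "u' \<le> X"
    using ex_geom_form_factor[OF s(1) K cop M _ dvd_refl a0_cop A] unfolding X_def by auto
  define q where "q = U * u'"
  have "[u' = geom_form s a0 0] (mod M)"
    using u'(1) geom_form_cong[of a0 a0 M "K * M" 0 s] cong_trans by (force simp: cong_0_iff)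
  then have "[u' = v] (mod M)"
    using a0 s3 cong_trans by (simp add: geom_form_0_right) blast
  then have "[q = g] (mod M)"
    using Uv unfolding q_def by (meson cong_mult cong_refl cong_trans)
  moreover have "[q = 1] (mod K)"
  proof -
    have "[q = (\<Prod>i<s. 1) * 1] (mod K)"
      unfolding q_def U_def by (intro cong_mult cong_prod u u')
    then show ?thesis by simp
  qed
  moreover have "[r = 1] (mod s)" if r: "prime r" "r dvd q" for r
    using r u(3) u'(3) by (auto simp: q_def U_def prime_dvd_mult_iff prime_dvd_prod_iff)
  moreover have "\<not> p dvd q" if p: "p \<in> A" for p
    using A(2)[OF p] u(4)[OF p] u'(4) p by (auto simp: q_def U_def prime_dvd_mult_iff prime_dvd_prod_iff)
  moreover have "q > 1"
  proof -
    have "U \<ge> 1"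
      unfolding U_def using u(5) by (simp add: Suc_le_eq prod_pos)
    moreover have "u' > 1"
    proof -
      have "1 < K * M"
        using K M mult_le_mono2[of 1 M K] by linarith
      then have "1 < (K * M) ^ (s - 1)"
        using s3 by (intro one_less_power) auto
      then show ?thesis
        using u'(5) by linarith
    qed
    ultimately show ?thesis
      unfolding q_def using mult_le_mono[of 1 U 2 u'] by simp
  qed
  moreover have "q \<le> X ^ Suc s"
  proof -
    have "U \<le> (\<Prod>i<s. X)"
      unfolding U_def by (intro prod_mono) (use u in auto)
    then have "U * u' \<le> X ^ s * X"
      using u'(6) by (intro mult_le_mono) simp_all
    then show ?thesis
      by (simp add: q_def mult.commute)
  qed
  ultimately show ?thesis
    unfolding X_def by blast
qed

section \<open>A common residue class\<close>

text \<open>Elements not subject to the condition survive every choice of t and keep their weight.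
  For the others some t retains at least the fraction 1/n of their weight, and the factor
  \<open>n\<close> makes up for the loss.\<close>

lemma weighted_pigeonhole:
  fixes W :: "'a \<Rightarrow> nat"
  assumes "finite P" and "\<And>p. p \<in> P \<Longrightarrow> Q p \<Longrightarrow> v p \<in> T" and "finite T" "card T \<le> n"
  shows "\<exists>t. (\<Sum>p\<in>P. W p) \<le> (\<Sum>p | p \<in> P \<and> (Q p \<longrightarrow> v p = t). W p * (if Q p then n else 1))"
proof -
  define V where "V t = (\<Sum>p | p \<in> P \<and> Q p \<and> v p = t. W p)" for t
  have split: "(\<Sum>p | p \<in> P \<and> (Q p \<longrightarrow> v p = t). W p * (if Q p then n else 1)) =
      (\<Sum>p | p \<in> P \<and> \<not> Q p. W p) + n * V t" for t
  proof -
    have "{p \<in> P. Q p \<longrightarrow> v p = t} = {p \<in> P. \<not> Q p} \<union> {p \<in> P. Q p \<and> v p = t}"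
      by auto
    then have "(\<Sum>p | p \<in> P \<and> (Q p \<longrightarrow> v p = t). W p * (if Q p then n else 1)) =
        (\<Sum>p | p \<in> P \<and> \<not> Q p. W p * (if Q p then n else 1)) + (\<Sum>p | p \<in> P \<and> Q p \<and> v p = t. W p * (if Q p then n else 1))"
      using assms(1) by (simp only:) (intro sum.union_disjoint, auto)
    also have "(\<Sum>p | p \<in> P \<and> Q p \<and> v p = t. W p * (if Q p then n else 1)) = n * V t"
      unfolding V_def sum_distrib_left by (intro sum.cong) auto
    also have "(\<Sum>p | p \<in> P \<and> \<not> Q p. W p * (if Q p then n else 1)) = (\<Sum>p | p \<in> P \<and> \<not> Q p. W p)"
      by (intro sum.cong) auto
    finally show ?thesis .
  qed
  have total: "(\<Sum>p\<in>P. W p) = (\<Sum>p | p \<in> P \<and> \<not> Q p. W p) + (\<Sum>p | p \<in> P \<and> Q p. W p)"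
    using assms(1) by (subst sum.union_disjoint[symmetric]) (auto intro!: sum.cong)
  have sum_V: "(\<Sum>p | p \<in> P \<and> Q p. W p) = (\<Sum>t\<in>T. V t)"
  proof -
    have "(\<Sum>t\<in>T. V t) = (\<Sum>t\<in>T. \<Sum>p | p \<in> {p \<in> P. Q p} \<and> v p = t. W p)"
      unfolding V_def by (intro sum.cong) auto
    also have "\<dots> = (\<Sum>p | p \<in> P \<and> Q p. W p)"
      using assms by (intro sum.group) auto
    finally show ?thesis ..
  qed
  have "\<exists>t. (\<Sum>p | p \<in> P \<and> Q p. W p) \<le> n * V t"
  proof (rule ccontr)
    assume "\<not> ?thesis"
    then have less: "n * V t < (\<Sum>t\<in>T. V t)" for t
      by (simp add: sum_V not_le)
    then have "T \<noteq> {}"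
      by (metis less_nat_zero_code sum.empty)
    have "n * (\<Sum>t\<in>T. V t) = (\<Sum>t\<in>T. n * V t)"
      by (simp add: sum_distrib_left)
    also have "\<dots> < (\<Sum>t\<in>T. (\<Sum>t\<in>T. V t))"
      using less \<open>T \<noteq> {}\<close> assms(3) by (intro sum_strict_mono) auto
    also have "\<dots> \<le> n * (\<Sum>t\<in>T. V t)"
      using assms(4) by simp
    finally show False
      by simp
  qed
  then show ?thesis
    unfolding split total by auto
qed

text \<open>Iterating \<open>weighted_pigeonhole\<close> over l, a surviving p gains a factor
  \<open>n\<close> for each condition imposed on it. The loss thus depends on the size of
  \<open>R p\<close> and not on that of \<Lambda>.\<close>

lemma ex_popular_choice:
  fixes R :: "'a \<Rightarrow> 'b set"
  assumes P: "finite P" and \<Lambda>: "finite \<Lambda>"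
    and T: "\<And>p l. p \<in> P \<Longrightarrow> l \<in> R p \<Longrightarrow> v p l \<in> T l" "\<And>l. l \<in> \<Lambda> \<Longrightarrow> finite (T l) \<and> card (T l) \<le> n"
  shows "\<exists>c. card P \<le> (\<Sum>p | p \<in> P \<and> (\<forall>l\<in>R p \<inter> \<Lambda>. v p l = c l). n ^ card (R p \<inter> \<Lambda>))"
  using \<Lambda> T(2)
proof (induction \<Lambda>)
  case (insert l \<Lambda>)
  obtain c where c: "card P \<le> (\<Sum>p | p \<in> P \<and> (\<forall>l\<in>R p \<inter> \<Lambda>. v p l = c l). n ^ card (R p \<inter> \<Lambda>))"
    using insert.IH insert.prems by auto
  define P' where "P' = {p \<in> P. \<forall>l\<in>R p \<inter> \<Lambda>. v p l = c l}"
  obtain t where t: "(\<Sum>p\<in>P'. n ^ card (R p \<inter> \<Lambda>)) \<le>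
      (\<Sum>p | p \<in> P' \<and> (l \<in> R p \<longrightarrow> v p l = t). n ^ card (R p \<inter> \<Lambda>) * (if l \<in> R p then n else 1))"
    using weighted_pigeonhole[of P' "\<lambda>p. l \<in> R p" "\<lambda>p. v p l" "T l" n "\<lambda>p. n ^ card (R p \<inter> \<Lambda>)"] P T(1) insert.prems[of l]
    by (auto simp: P'_def)
  have "(\<Sum>p | p \<in> P' \<and> (l \<in> R p \<longrightarrow> v p l = t). n ^ card (R p \<inter> \<Lambda>) * (if l \<in> R p then n else 1)) =
      (\<Sum>p | p \<in> P \<and> (\<forall>k\<in>R p \<inter> insert l \<Lambda>. v p k = (c(l := t)) k). n ^ card (R p \<inter> insert l \<Lambda>))"
  proof (intro sum.cong)
    show "{p \<in> P'. l \<in> R p \<longrightarrow> v p l = t} = {p \<in> P. \<forall>k\<in>R p \<inter> insert l \<Lambda>. v p k = (c(l := t)) k}"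
      using insert.hyps by (auto simp: P'_def)
    show "n ^ card (R p \<inter> \<Lambda>) * (if l \<in> R p then n else 1) = n ^ card (R p \<inter> insert l \<Lambda>)" for p
      using insert.hyps by (simp add: mult.commute)
  qed
  then show ?case
    using c t unfolding P'_def[symmetric] by (intro exI[of _ "c(l := t)"]) linarith
qed simp

text \<open>Modulo each prime of \<open>h p\<close>, p is one of at most d solutions of x^d = 1, so
  the popular choice loses a factor d per prime factor. A suitable power of the resulting
  \<open>c0\<close> lifts the agreement from the primes to \<open>h p\<close>.\<close>

lemma ex_common_residue:
  fixes h :: "nat \<Rightarrow> nat" and d :: nat
  assumes P: "finite P" and d: "d > 0"
    and h: "\<And>p. p \<in> P \<Longrightarrow> h p > 0 \<and> [p ^ d = 1] (mod h p) \<and> coprime (h p) d"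
  shows "\<exists>S c. S \<subseteq> P \<and> (\<forall>p\<in>S. [c = p] (mod h p)) \<and> card P \<le> (\<Sum>p\<in>S. d ^ card (prime_factors (h p)))"
proof -
  define \<Lambda> where "\<Lambda> = (\<Union>p\<in>P. prime_factors (h p))"
  define T where "T l = {x \<in> {..<l}. [x ^ d = 1 ^ d] (mod l)}" for l :: nat
  have \<Lambda>: "finite \<Lambda>" "\<And>l. l \<in> \<Lambda> \<Longrightarrow> prime l"
    using P by (auto simp: \<Lambda>_def)
  have "\<exists>c. card P \<le> (\<Sum>p | p \<in> P \<and> (\<forall>l\<in>prime_factors (h p) \<inter> \<Lambda>. p mod l = c l). d ^ card (prime_factors (h p) \<inter> \<Lambda>))"
  proof (rule ex_popular_choice[OF P \<Lambda>(1)])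
    fix p l assume p: "p \<in> P" "l \<in> prime_factors (h p)"
    then have "[p ^ d = 1] (mod l)"
      using h[OF p(1)] cong_dvd_modulus_nat by blast
    moreover have "[(p mod l) ^ d = p ^ d] (mod l)"
      by (intro cong_pow) simp
    ultimately have "[(p mod l) ^ d = 1 ^ d] (mod l)"
      unfolding power_one by (rule cong_trans[rotated])
    moreover have "l > 0"
      using p prime_gt_0_nat[of l] by auto
    ultimately show "p mod l \<in> T l"
      by (simp add: T_def)
  next
    fix l assume "l \<in> \<Lambda>"
    then show "finite (T l) \<and> card (T l) \<le> d"
      unfolding T_def using \<Lambda>(2) d by (intro conjI roots_mod_prime_bound) auto
  qed
  then obtain c' where "card P \<le> (\<Sum>p | p \<in> P \<and> (\<forall>l\<in>prime_factors (h p) \<inter> \<Lambda>. p mod l = c' l). d ^ card (prime_factors (h p) \<inter> \<Lambda>))" ..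
  also have "\<dots> = (\<Sum>p | p \<in> P \<and> (\<forall>l\<in>prime_factors (h p). p mod l = c' l). d ^ card (prime_factors (h p)))"
  proof -
    have "prime_factors (h p) \<inter> \<Lambda> = prime_factors (h p)" if "p \<in> P" for p
      using that by (auto simp: \<Lambda>_def)
    then show ?thesis
      by (intro sum.cong) auto
  qed
  finally have c': "card P \<le> (\<Sum>p | p \<in> P \<and> (\<forall>l\<in>prime_factors (h p). p mod l = c' l). d ^ card (prime_factors (h p)))" .
  define S where "S = {p \<in> P. \<forall>l\<in>prime_factors (h p). p mod l = c' l}"
  have "\<exists>x. \<forall>l\<in>\<Lambda>. [x = c' l] (mod l)"
    by (rule chinese_remainder_nat) (auto simp: \<Lambda>(1) dest!: \<Lambda>(2) intro: primes_coprime)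
  then obtain c0 where c0: "\<And>l. l \<in> \<Lambda> \<Longrightarrow> [c0 = c' l] (mod l)"
    by blast
  \<comment> \<open>The exponent m y below is a multiple of every \<open>h p\<close>, which achieves
    the lifting, and is 1 modulo d, which leaves the d-th root of unity p unchanged.\<close>
  define m where "m = (\<Prod>p\<in>P. h p)"
  have "coprime d m"
    unfolding m_def using h by (intro prod_coprime_right) (simp add: ac_simps)
  then obtain y where y: "[m * y = 1] (mod d)"
    using ex_inverse_mod_nat by blast
  have "[c0 ^ (m * y) = p] (mod h p)" if p: "p \<in> S" for p
  proof -
    have pP: "p \<in> P" and op: "h p > 0" "[p ^ d = 1] (mod h p)"
      using p h by (auto simp: S_def)
    \<comment> \<open>\<open>p ^ (d - 1)\<close> is the inverse of p modulo
      \<open>h p\<close>.\<close>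
    have "[(c0 * p ^ (d - 1)) ^ h p = 1] (mod h p)"
    proof (rule power_cong_1_of_primes[OF op(1)])
      fix l assume l: "prime l" "l dvd h p"
      then have lp: "l \<in> prime_factors (h p)"
        using op(1) by (simp add: prime_factors_dvd)
      then have "[c0 = c' l] (mod l)" "p mod l = c' l"
        using c0 pP p by (auto simp: \<Lambda>_def S_def)
      then have "[c0 = p] (mod l)"
        by (metis cong_mod_right)
      then have "[c0 * p ^ (d - 1) = p * p ^ (d - 1)] (mod l)"
        by (intro cong_mult cong_refl)
      also have "p * p ^ (d - 1) = p ^ d"
        using d by (simp add: power_eq_if)
      also have "[p ^ d = 1] (mod l)"
        using op(2) l(2) cong_dvd_modulus_nat by blast
      finally show "[c0 * p ^ (d - 1) = 1] (mod l)" .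
    qed
    moreover have "h p dvd m"
      using P pP by (auto simp: m_def)
    then obtain e where e: "m * y = h p * e"
      by (metis dvd_def mult.assoc)
    ultimately have "[((c0 * p ^ (d - 1)) ^ h p) ^ e = 1 ^ e] (mod h p)"
      by (intro cong_pow)
    then have "[c0 ^ (m * y) * p ^ ((d - 1) * (m * y)) = 1] (mod h p)"
      by (simp add: e power_mult_distrib mult.assoc flip: power_mult)
    then have "[c0 ^ (m * y) * p ^ ((d - 1) * (m * y)) * p ^ (m * y) = 1 * p ^ (m * y)] (mod h p)"
      by (intro cong_mult cong_refl)
    moreover have "p ^ ((d - 1) * (m * y)) * p ^ (m * y) = (p ^ d) ^ (m * y)"
      using d by (simp flip: power_add power_mult) (metis Suc_pred add.commute mult_Suc)
    moreover have "[c0 ^ (m * y) * (p ^ d) ^ (m * y) = c0 ^ (m * y) * 1 ^ (m * y)] (mod h p)"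
      by (intro cong_mult cong_pow op(2) cong_refl)
    ultimately have "[c0 ^ (m * y) = p ^ (m * y)] (mod h p)"
      by (simp add: mult.assoc) (meson cong_sym cong_trans)
    also have "[p ^ (m * y) = p ^ 1] (mod h p)"
    proof -
      have "ord (h p) p dvd d"
        using op(2) by (rule ord_divides[THEN iffD1])
      then have "[m * y = 1] (mod ord (h p) p)"
        using y cong_dvd_modulus_nat by blast
      moreover have "coprime (h p) p"
        using cong_imp_coprime[OF cong_sym[OF op(2)]] d by (simp add: ac_simps)
      ultimately show ?thesis
        by (simp only: order_divides_expdiff)
    qed
    finally show ?thesis
      by simp
  qed
  then show ?thesis
    using c' unfolding S_def[symmetric] by (intro exI[of _ S] exI[of _ "c0 ^ (m * y)"]) (auto simp: S_def)
qed

section \<open>Smooth parts and Chebyshev bounds\<close>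

lemma prime_power_dvd_mult_imp_dvd_left:
  fixes a b l :: int
  assumes "prime l" "l ^ v dvd a * b" "\<not> l ^ k dvd b"
  shows "l ^ (v - k) dvd a"
proof (cases "a = 0")
  case False
  have "b \<noteq> 0"
    using assms(3) by auto
  have "\<not> is_unit l"
    using assms(1) not_prime_unit by blast
  then have "v \<le> multiplicity l (a * b)"
    using assms False \<open>b \<noteq> 0\<close> by (simp add: power_dvd_iff_le_multiplicity)
  also have "\<dots> = multiplicity l a + multiplicity l b"
    using assms(1) False \<open>b \<noteq> 0\<close> by (intro prime_elem_multiplicity_mult_distrib prime_imp_prime_elem)
  moreover have "multiplicity l b < k"
    using assms(3) \<open>b \<noteq> 0\<close> \<open>\<not> is_unit l\<close> by (simp add: power_dvd_iff_le_multiplicity)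
  ultimately show ?thesis
    by (intro multiplicity_dvd') linarith
qed simp

text \<open>If solutions p and q agree modulo l^d, the cofactor of p - q in p^d - q^d is d q^(d - 1)
  modulo l^d, hence not divisible by l^d, as l^d > d. So p and q agree modulo l^(v - d), and p is
  determined by its residue modulo l^d and its quotient by l^(v - d).\<close>

lemma card_prime_power_dvd_power_diff_1:
  fixes l d v Y :: nat
  assumes l: "prime l" and d: "d > 0" and v: "v > 0"
  shows "card {p. 0 < p \<and> p < Y \<and> l ^ v dvd p ^ d - 1} \<le> l ^ d * (Y div l ^ (v - d) + 1)"
proof -
  define P where "P = {p. 0 < p \<and> p < Y \<and> l ^ v dvd p ^ d - 1}"
  have l0: "l > 0"
    using prime_gt_0_nat[OF l] .
  have "inj_on (\<lambda>p. (p mod l ^ d, p div l ^ (v - d))) P"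
  proof
    fix p q assume pq: "p \<in> P" "q \<in> P"
      and eq: "(p mod l ^ d, p div l ^ (v - d)) = (q mod l ^ d, q div l ^ (v - d))"
    have dvd: "int l ^ v dvd int x ^ d - 1" if "x \<in> P" for x
    proof -
      have "int (l ^ v) dvd int (x ^ d - 1)"
        using that unfolding P_def int_dvd_int_iff by simp
      then show ?thesis
        using that by (simp add: P_def of_nat_diff Suc_le_eq)
    qed
    define S where "S = (\<Sum>i<d. int q ^ (d - Suc i) * int p ^ i)"
    have "int l ^ v dvd (int p ^ d - 1) - (int q ^ d - 1)"
      by (rule dvd_diff[OF dvd[OF pq(1)] dvd[OF pq(2)]])
    then have "int l ^ v dvd (int p - int q) * S"
      unfolding S_def power_diff_sumr2[symmetric] by simp
    moreover have "\<not> int l ^ d dvd S"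
    proof
      have cong: "[int p = int q] (mod int l ^ d)"
        using eq by (simp add: cong_def flip: of_nat_mod of_nat_power)
      have "[S = (\<Sum>i<d. int q ^ (d - Suc i) * int q ^ i)] (mod int l ^ d)"
        unfolding S_def by (intro cong_sum cong_mult cong_pow cong cong_refl)
      also have "(\<Sum>i<d. int q ^ (d - Suc i) * int q ^ i) = (\<Sum>i<d. int q ^ (d - 1))"
        by (intro sum.cong) (simp_all flip: power_add)
      also have "\<dots> = int d * int q ^ (d - 1)"
        by simp
      finally have S: "[S = int d * int q ^ (d - 1)] (mod int l ^ d)" .
      assume "int l ^ d dvd S"
      then have "int l ^ d dvd int d * int q ^ (d - 1)"
        using S cong_dvd_iff by blast
      then have "l ^ d dvd d * q ^ (d - 1)"
        by (simp only: int_dvd_int_iff flip: of_nat_power of_nat_mult)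
      moreover have "\<not> l dvd q"
      proof
        assume "l dvd q"
        then have "int l dvd int q ^ d"
          using d by (simp add: dvd_trans[OF _ dvd_power])
        moreover have "int l dvd int q ^ d - 1"
          using dvd[OF pq(2)] v by (meson dvd_power dvd_trans)
        ultimately have "int l dvd int q ^ d - (int q ^ d - 1)"
          by (rule dvd_diff)
        then show False
          using l by (auto simp: not_prime_unit)
      qed
      then have "coprime (l ^ d) (q ^ (d - 1))"
        using l by (simp add: prime_imp_coprime)
      ultimately have "l ^ d dvd d"
        by (simp add: coprime_dvd_mult_left_iff)
      then have "l ^ d \<le> d"
        using d by (rule dvd_imp_le)
      moreover have "d < l ^ d"
        using prime_gt_1_nat[OF l] by (simp add: power_gt_expt)
      ultimately show False
        by simp
    qed
    ultimately have "int l ^ (v - d) dvd int p - int q"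
      using l by (intro prime_power_dvd_mult_imp_dvd_left) auto
    then have "[int p = int q] (mod int (l ^ (v - d)))"
      by (simp add: cong_iff_dvd_diff)
    then have "p mod l ^ (v - d) = q mod l ^ (v - d)"
      unfolding cong_int_iff by (simp only: cong_def)
    then show "p = q"
      using eq by (metis Pair_inject mult_div_mod_eq)
  qed
  moreover have "(\<lambda>p. (p mod l ^ d, p div l ^ (v - d))) ` P \<subseteq> {..<l ^ d} \<times> {..Y div l ^ (v - d)}"
    using l0 by (auto simp: P_def intro: div_le_mono)
  ultimately have "card P \<le> card ({..<l ^ d} \<times> {..Y div l ^ (v - d)})"
    by (intro card_inj_on_le) auto
  then show ?thesis
    by (simp add: P_def)
qed

text \<open>For each prime l up to \<open>z\<close>,
  \<open>card_prime_power_dvd_power_diff_1\<close> applies with the least power of l exceeding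
  \<open>B\<close>. The two factors l^d and the sum over l account for the power of
  \<open>z\<close>.\<close>

lemma card_large_smooth_part:
  fixes Y B :: real and d z :: nat
  assumes d: "d > 0" and B: "B \<ge> 1" and Y: "Y \<ge> 0" and P: "\<And>p. p \<in> P \<Longrightarrow> prime p \<and> real p < Y"
  shows "real (card {p \<in> P. \<exists>l\<le>z. prime l \<and> B < real (l ^ multiplicity l (p ^ d - 1))})
    \<le> real z ^ (2 * d + 1) * ((Y + 1) / B + 1)"
proof -
  define bad where "bad l = {p \<in> P. B < real (l ^ multiplicity l (p ^ d - 1))}" for l
  have fin: "finite P"
  proof (rule finite_subset)
    show "P \<subseteq> {..nat \<lceil>Y\<rceil>}"
      using P by (force simp: le_nat_iff less_ceiling_iff intro: less_imp_le)
  qed simp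
  have bad: "real (card (bad l)) \<le> real z ^ (2 * d) * ((Y + 1) / B + 1)" if l: "prime l" "l \<le> z" for l
  proof -
    have l1: "l > 1"
      using prime_gt_1_nat[OF l(1)] .
    define y where "y = nat \<lceil>Y\<rceil>"
    define v where "v = (LEAST v. B < real l ^ v)"
    have v: "B < real l ^ v"
      unfolding v_def by (rule LeastI_ex) (use real_arch_pow[of "real l" B] l1 in simp)
    then have "v > 0"
      using B by (cases v) auto
    have "bad l \<subseteq> {p. 0 < p \<and> p < y \<and> l ^ v dvd p ^ d - 1}"
    proof
      fix p assume p: "p \<in> bad l"
      then have "v \<le> multiplicity l (p ^ d - 1)"
        unfolding v_def bad_def by (intro Least_le) simp
      then have "l ^ v dvd p ^ d - 1"
        by (rule multiplicity_dvd')
      moreover have "p < y"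
        using p P[of p] by (auto simp: bad_def y_def zless_nat_eq_int_zless less_ceiling_iff)
      ultimately show "p \<in> {p. 0 < p \<and> p < y \<and> l ^ v dvd p ^ d - 1}"
        using p P[of p] by (simp add: bad_def prime_gt_0_nat)
    qed
    then have "card (bad l) \<le> card {p. 0 < p \<and> p < y \<and> l ^ v dvd p ^ d - 1}"
      by (intro card_mono) auto
    also have "\<dots> \<le> l ^ d * (y div l ^ (v - d) + 1)"
      by (rule card_prime_power_dvd_power_diff_1[OF l(1) d \<open>v > 0\<close>])
    finally have "real (card (bad l)) \<le> real (l ^ d * (y div l ^ (v - d) + 1))"
      by (simp only: of_nat_le_iff)
    also have "\<dots> = real l ^ d * (real (y div l ^ (v - d)) + 1)"
      by (simp add: distrib_left)
    also have "\<dots> \<le> real l ^ d * (real l ^ d * ((Y + 1) / B + 1))"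
    proof (intro mult_left_mono)
      have "real l ^ v \<le> real l ^ (d + (v - d))"
        using l1 by (intro power_increasing) auto
      then have *: "B \<le> real l ^ d * real l ^ (v - d)"
        using v by (simp add: power_add)
      have "real (y div l ^ (v - d)) \<le> real y / real l ^ (v - d)"
        using of_nat_div_le_of_nat[of y "l ^ (v - d)", where ?'a = real] by simp
      also have "\<dots> \<le> (Y + 1) / real l ^ (v - d)"
        using Y by (intro divide_right_mono) (auto simp: y_def intro: less_imp_le of_int_ceiling_le_add_one)
      also have "\<dots> \<le> real l ^ d * ((Y + 1) / B)"
      proof -
        have "B / real l ^ (v - d) \<le> real l ^ d"
          using * l1 by (simp add: field_simps)
        then have "(Y + 1) / B * (B / real l ^ (v - d)) \<le> (Y + 1) / B * real l ^ d"
          using Y B by (intro mult_left_mono) auto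
        then show ?thesis
          using B by (simp add: mult_ac)
      qed
      finally have "real (y div l ^ (v - d)) \<le> real l ^ d * ((Y + 1) / B)" .
      moreover have "1 \<le> real l ^ d"
        using l1 by (intro one_le_power) auto
      ultimately show "real (y div l ^ (v - d)) + 1 \<le> real l ^ d * ((Y + 1) / B + 1)"
        unfolding distrib_left by linarith
    qed simp
    also have "\<dots> = real l ^ (2 * d) * ((Y + 1) / B + 1)"
      by (simp add: mult_2 power_add)
    also have "\<dots> \<le> real z ^ (2 * d) * ((Y + 1) / B + 1)"
      using l Y B by (intro mult_right_mono power_mono) auto
    finally show ?thesis .
  qed
  have "{p \<in> P. \<exists>l\<le>z. prime l \<and> B < real (l ^ multiplicity l (p ^ d - 1))} = (\<Union>l\<in>{l. l \<le> z \<and> prime l}. bad l)"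
    by (auto simp: bad_def)
  moreover have "card (\<Union>l\<in>{l. l \<le> z \<and> prime l}. bad l) \<le> (\<Sum>l | l \<le> z \<and> prime l. card (bad l))"
    by (intro card_UN_le) simp
  ultimately have "real (card {p \<in> P. \<exists>l\<le>z. prime l \<and> B < real (l ^ multiplicity l (p ^ d - 1))})
      \<le> real (\<Sum>l | l \<le> z \<and> prime l. card (bad l))"
    by (simp only: of_nat_le_iff)
  also have "\<dots> \<le> (\<Sum>l | l \<le> z \<and> prime l. real z ^ (2 * d) * ((Y + 1) / B + 1))"
    using bad by (simp only: of_nat_sum) (intro sum_mono, auto)
  also have "\<dots> = real (card {l. l \<le> z \<and> prime l}) * (real z ^ (2 * d) * ((Y + 1) / B + 1))"
    by simp
  also have "\<dots> \<le> real z * (real z ^ (2 * d) * ((Y + 1) / B + 1))"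
  proof (intro mult_right_mono)
    have "card {l. l \<le> z \<and> prime l} \<le> card {1..z}"
      by (intro card_mono) (auto simp: Suc_le_eq prime_gt_0_nat)
    then show "real (card {l. l \<le> z \<and> prime l}) \<le> real z"
      by simp
  qed (use Y B in auto)
  finally show ?thesis
    by (simp add: mult.assoc)
qed

section \<open>Separation of the small prime factors\<close>

definition rough_part :: "nat \<Rightarrow> nat \<Rightarrow> nat" where
  "rough_part z n = (\<Prod>l | l \<in> prime_factors n \<and> l > z. l ^ multiplicity l n)"

lemma rough_part_pos: "rough_part z n > 0"
  by (auto simp: rough_part_def intro!: prod_pos prime_gt_0_nat)

lemma prime_factors_split_rough_part:
  assumes "n > 0"
  shows "n = (\<Prod>l | l \<in> prime_factors n \<and> l \<le> z. l ^ multiplicity l n) * rough_part z n"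
proof -
  have "n = (\<Prod>l\<in>prime_factors n. l ^ multiplicity l n)"
    using assms prod_prime_factors[of n] by simp
  also have "prime_factors n = {l \<in> prime_factors n. l \<le> z} \<union> {l \<in> prime_factors n. l > z}"
    by auto
  also have "(\<Prod>l\<in>\<dots>. l ^ multiplicity l n) =
      (\<Prod>l | l \<in> prime_factors n \<and> l \<le> z. l ^ multiplicity l n) * rough_part z n"
    unfolding rough_part_def by (intro prod.union_disjoint) auto
  finally show ?thesis .
qed

lemma rough_part_dvd: "n > 0 \<Longrightarrow> rough_part z n dvd n"
  using prime_factors_split_rough_part[of n z] by (metis dvd_triv_right)

lemma prime_dvd_rough_part:
  assumes "prime l" "l dvd rough_part z n"
  shows "l > z"
proof -
  obtain k where k: "k \<in> prime_factors n" "k > z" "l dvd k ^ multiplicity k n"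
    using assms unfolding rough_part_def by (subst (asm) prime_dvd_prod_iff) auto
  then have "l = k"
    using assms(1) by (metis in_prime_factors_iff prime_dvd_power primes_dvd_imp_eq)
  then show ?thesis
    using k by simp
qed

text \<open>At most \<open>z\<close> primes are removed, each with a prime power of size at most
  \<open>B\<close>.\<close>

lemma le_rough_part_mult:
  fixes B :: real
  assumes "n > 0" "B \<ge> 1" and small: "\<And>l. prime l \<Longrightarrow> l \<le> z \<Longrightarrow> real (l ^ multiplicity l n) \<le> B"
  shows "real n \<le> B ^ z * real (rough_part z n)"
proof -
  have "real (\<Prod>l | l \<in> prime_factors n \<and> l \<le> z. l ^ multiplicity l n) \<le> (\<Prod>l | l \<in> prime_factors n \<and> l \<le> z. B)"
    unfolding of_nat_prod using small by (intro prod_mono) auto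
  also have "\<dots> \<le> B ^ z"
  proof -
    have "card {l. l \<in> prime_factors n \<and> l \<le> z} \<le> card {1..z}"
      by (intro card_mono) (auto simp: Suc_le_eq dest!: in_prime_factors_imp_prime prime_gt_0_nat)
    then show ?thesis
      using assms(2) by (simp add: power_increasing)
  qed
  finally have "real (\<Prod>l | l \<in> prime_factors n \<and> l \<le> z. l ^ multiplicity l n) * real (rough_part z n) \<le> B ^ z * real (rough_part z n)"
    by (intro mult_right_mono) auto
  then show ?thesis
    using prime_factors_split_rough_part[OF assms(1), of z] by (metis of_nat_mult)
qed

text \<open>Induction after Erdos: for n = 2 m + 1 the primes above m + 1 divide
  \<open>n choose m\<close>, which is at most 4^m because it occurs twice in a row of sum 2 *
  4^m.\<close>

lemma primorial_le: "(\<Prod>p | prime p \<and> p \<le> n. p) \<le> (4 :: nat) ^ n"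
proof (induction n rule: less_induct)
  case (less n)
  consider "n \<le> 1" | "n = 2" | "n > 2" "even n" | "n > 2" "odd n"
    by linarith
  then show ?case
  proof cases
    case 1
    have "prime p \<Longrightarrow> \<not> p \<le> n" for p :: nat
      using 1 prime_gt_1_nat[of p] by auto
    then have "{p. prime p \<and> p \<le> n} = {}"
      by auto
    then show ?thesis
      by (simp only:) simp
  next
    case 2
    have "{p. prime p \<and> p \<le> n} = {2::nat}"
      using 2 prime_ge_2_nat by (auto intro: le_antisym)
    then show ?thesis
      using 2 by (simp only:) simp
  next
    case 3
    then have "\<not> prime n"
      using prime_odd_nat by blast
    then have "{p. prime p \<and> p \<le> n} = {p. prime p \<and> p \<le> n - 1}"
      using 3 by (auto simp: le_less) 
    then have "(\<Prod>p | prime p \<and> p \<le> n. p) \<le> 4 ^ (n - 1)"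
      using less.IH[of "n - 1"] 3 by simp
    also have "\<dots> \<le> 4 ^ n"
      by (intro power_increasing) auto
    finally show ?thesis .
  next
    case 4
    then obtain m where n: "n = 2 * m + 1"
      by (elim oddE)
    have m: "m \<ge> 1"
      using 4 n by simp
    have "{p. prime p \<and> p \<le> n} = {p. prime p \<and> p \<le> m + 1} \<union> {p. prime p \<and> m + 1 < p \<and> p \<le> n}"
      using n by auto
    then have "(\<Prod>p | prime p \<and> p \<le> n. p) =
        (\<Prod>p | prime p \<and> p \<le> m + 1. p) * (\<Prod>p | prime p \<and> m + 1 < p \<and> p \<le> n. p)"
      by (simp only:) (intro prod.union_disjoint, auto)
    also have "\<dots> \<le> 4 ^ (m + 1) * 4 ^ m"
    proof (intro mult_le_mono)
      show "(\<Prod>p | prime p \<and> p \<le> m + 1. p) \<le> 4 ^ (m + 1)"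
        using m n by (intro less.IH) simp
      have "(\<Prod>p | prime p \<and> m + 1 < p \<and> p \<le> n. p) dvd n choose m"
      proof -
        have "[n choose m = 0] (mod (\<Prod>p | prime p \<and> m + 1 < p \<and> p \<le> n. p))"
        proof (rule coprime_cong_prod_nat)
          fix p assume p: "p \<in> {p. prime p \<and> m + 1 < p \<and> p \<le> n}"
          have "p dvd fact n"
            using p by (simp add: prime_dvd_fact_iff)
          then have "p dvd fact m * fact (n - m) * (n choose m)"
            using n by (subst binomial_fact_lemma) auto
          moreover have "\<not> p dvd fact m" "\<not> p dvd fact (n - m)"
            using p n by (simp_all only: prime_dvd_fact_iff mem_Collect_eq) linarith+
          ultimately have "p dvd n choose m"
            using p prime_dvd_multD by blast
          then show "[n choose m = 0] (mod p)"
            by (simp add: cong_0_iff)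
        qed (auto intro: primes_coprime)
        then show ?thesis
          by (simp add: cong_0_iff)
      qed
      then have "(\<Prod>p | prime p \<and> m + 1 < p \<and> p \<le> n. p) \<le> n choose m"
        using n by (intro dvd_imp_le) auto
      moreover have "2 * (n choose m) \<le> 2 ^ n"
      proof -
        have "(n choose m) = (n choose (m + 1))"
          using n binomial_symmetric[of m n] by simp
        then have "2 * (n choose m) = (\<Sum>k\<in>{m, m + 1}. n choose k)"
          by simp
        also have "\<dots> \<le> (\<Sum>k\<le>n. n choose k)"
          using n by (intro sum_mono2) auto
        finally show ?thesis
          by (simp add: choose_row_sum)
      qed
      moreover have "(2::nat) ^ n = 2 * 4 ^ m"
        using n by (simp add: power_mult)
      ultimately show "(\<Prod>p | prime p \<and> m + 1 < p \<and> p \<le> n. p) \<le> 4 ^ m"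
        by linarith
    qed
    also have "\<dots> = 4 ^ n"
      using n by (simp flip: power_add)
    finally show ?thesis .
  qed
qed

text \<open>Each prime up to \<open>m\<close> contributes a power of size at most \<open>n\<close>.
  A prime above \<open>m\<close> has square above \<open>n\<close> and contributes only itself, so
  the primorial bound applies.\<close>

lemma Lcm_atMost_le:
  fixes n m :: nat
  assumes n: "n > 0" "n \<le> m ^ 2"
  shows "Lcm {1..n} \<le> n ^ m * 4 ^ n"
proof -
  define e where "e p = Max {v. p ^ v \<le> n}" for p
  have e: "p ^ e p \<le> n" "\<And>v. p ^ v \<le> n \<Longrightarrow> v \<le> e p" if "prime p" for p
  proof -
    have "v \<le> n" if "p ^ v \<le> n" for v
      using that power_gt_expt[of p v] prime_gt_1_nat[OF \<open>prime p\<close>] by simp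
    then have "{v. p ^ v \<le> n} \<subseteq> {..n}"
      by blast
    then have fin: "finite {v. p ^ v \<le> n}"
      by (rule finite_subset) simp
    have "0 \<in> {v. p ^ v \<le> n}"
      using n by simp
    then show "p ^ e p \<le> n" "\<And>v. p ^ v \<le> n \<Longrightarrow> v \<le> e p"
      unfolding e_def using Max_in[OF fin] Max_ge[OF fin] by blast+
  qed
  define T where "T = (\<Prod>p | prime p \<and> p \<le> n. p ^ e p)"
  have "Lcm {1..n} dvd T"
  proof (rule Lcm_least)
    fix k assume k: "k \<in> {1..n}"
    have "k = (\<Prod>p\<in>prime_factors k. p ^ multiplicity p k)"
      using k prod_prime_factors[of k] by simp
    also have "\<dots> dvd (\<Prod>p\<in>prime_factors k. p ^ e p)"
    proof (intro prod_dvd_prod le_imp_power_dvd)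
      fix p assume p: "p \<in> prime_factors k"
      have "p ^ multiplicity p k \<le> k"
        using k by (intro dvd_imp_le multiplicity_dvd) auto
      then show "multiplicity p k \<le> e p"
        using k p by (intro e) auto
    qed
    also have "\<dots> dvd T"
      unfolding T_def
    proof (intro prod_dvd_prod_subset subsetI)
      fix p assume "p \<in> prime_factors k"
      then have "prime p" "p dvd k"
        by auto
      then show "p \<in> {p. prime p \<and> p \<le> n}"
        using k dvd_imp_le[of p k] by auto
    qed simp
    finally show "k dvd T" .
  qed
  moreover have "T > 0"
    unfolding T_def by (intro prod_pos) (auto simp: prime_gt_0_nat)
  ultimately have "Lcm {1..n} \<le> T"
    by (rule dvd_imp_le)
  also have "{p. prime p \<and> p \<le> n} = {p. prime p \<and> p \<le> n \<and> p \<le> m} \<union> {p. prime p \<and> p \<le> n \<and> p > m}"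
    by auto
  then have "T = (\<Prod>p | prime p \<and> p \<le> n \<and> p \<le> m. p ^ e p) * (\<Prod>p | prime p \<and> p \<le> n \<and> p > m. p ^ e p)"
    unfolding T_def by (simp only:) (intro prod.union_disjoint, auto)
  also have "\<dots> \<le> n ^ m * 4 ^ n"
  proof (intro mult_le_mono)
    have "(\<Prod>p | prime p \<and> p \<le> n \<and> p \<le> m. p ^ e p) \<le> (\<Prod>p | prime p \<and> p \<le> n \<and> p \<le> m. n)"
      using e by (intro prod_mono) auto
    also have "\<dots> = n ^ card {p. prime p \<and> p \<le> n \<and> p \<le> m}"
      by simp
    also have "\<dots> \<le> n ^ m"
    proof (rule power_increasing)
      have "card {p. prime p \<and> p \<le> n \<and> p \<le> m} \<le> card {1..m}"
        by (intro card_mono) (auto simp: Suc_le_eq prime_gt_0_nat)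
      then show "card {p. prime p \<and> p \<le> n \<and> p \<le> m} \<le> m"
        by simp
    qed (use n in simp)
    finally show "(\<Prod>p | prime p \<and> p \<le> n \<and> p \<le> m. p ^ e p) \<le> n ^ m" .
    have "p ^ e p \<le> p" if p: "prime p" "p > m" for p
    proof -
      have "e p < 2"
      proof (rule ccontr)
        assume "\<not> e p < 2"
        then have "p ^ 2 \<le> p ^ e p"
          using prime_gt_0_nat[OF p(1)] by (intro power_increasing) auto
        then have "p ^ 2 \<le> m ^ 2"
          using e(1)[OF p(1)] n(2) by linarith
        then show False
          using p(2) by (simp add: power_mono_iff)
      qed
      then have "p ^ e p \<le> p ^ 1"
        using prime_gt_0_nat[OF p(1)] by (intro power_increasing) auto
      then show ?thesis
        by simp
    qed
    then have "(\<Prod>p | prime p \<and> p \<le> n \<and> p > m. p ^ e p) \<le> (\<Prod>p | prime p \<and> p \<le> n \<and> p > m. p)"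
      by (intro prod_mono) auto
    also have "\<dots> \<le> (\<Prod>p | prime p \<and> p \<le> n. p)"
      by (intro dvd_imp_le prod_dvd_prod_subset prod_pos) (auto simp: prime_gt_0_nat)
    also have "\<dots> \<le> 4 ^ n"
      by (rule primorial_le)
    finally show "(\<Prod>p | prime p \<and> p \<le> n \<and> p > m. p ^ e p) \<le> 4 ^ n" .
  qed
  finally show ?thesis .
qed

section \<open>Counting pseudoprimes\<close>

lemma card_dvd_mult_less:
  fixes h m :: nat
  assumes "m > 0"
  shows "card {j \<in> {..<h}. h dvd j * m} \<le> m"
proof -
  have "inj_on (\<lambda>j. j * m div h) {j \<in> {..<h}. h dvd j * m}"
    using assms by (intro inj_onI) (auto simp: dvd_div_eq_iff)
  moreover have "(\<lambda>j. j * m div h) ` {j \<in> {..<h}. h dvd j * m} \<subseteq> {..<m}"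
    using assms by (auto simp: div_less_iff_less_mult mult.commute)
  ultimately show ?thesis
    using card_inj_on_le[of "\<lambda>j. j * m div h" _ "{..<m}"] by simp
qed

text \<open>The second summand pays for exponents \<open>j\<close> with coinciding conjugates, that
  is, for elements of proper subfields: for each i < d there are at most p^i - 1 of them.\<close>

lemma le_card_good_polys_prime:
  assumes p: "prime p" "odd p" and d: "d > 0" and h: "h > 0" "h dvd p ^ d - 1"
    and N: "[N = p] (mod h)"
  shows "h \<le> d * card (good_polys N d p ((-1) ^ (d - 1))) + d * p ^ (d - 1)"
proof -
  define S where "S = {j \<in> {..<h}. \<forall>i\<in>{1..<d}. \<not> h dvd j * (p ^ i - 1)}"
  define R where "R i = {j \<in> {..<h}. h dvd j * (p ^ i - 1)}" for i
  have p1: "p > 1"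
    using prime_gt_1_nat[OF p(1)] .
  have "{..<h} \<subseteq> S \<union> (\<Union>i\<in>{1..<d}. R i)"
    by (auto simp: S_def R_def)
  then have "card {..<h} \<le> card (S \<union> (\<Union>i\<in>{1..<d}. R i))"
    by (intro card_mono) (auto simp: S_def R_def)
  also have "\<dots> \<le> card S + card (\<Union>i\<in>{1..<d}. R i)"
    by (rule card_Un_le)
  also have "card (\<Union>i\<in>{1..<d}. R i) \<le> (\<Sum>i\<in>{1..<d}. card (R i))"
    by (intro card_UN_le) simp
  also have "\<dots> \<le> (\<Sum>i\<in>{1..<d}. p ^ (d - 1))"
  proof (intro sum_mono)
    fix i assume i: "i \<in> {1..<d}"
    then have "1 < p ^ i"
      using p1 by (intro one_less_power) auto
    then have "card (R i) \<le> p ^ i - 1"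
      unfolding R_def by (intro card_dvd_mult_less) simp
    also have "\<dots> \<le> p ^ (d - 1)"
      using i p1 by (intro order.trans[OF diff_le_self power_increasing]) auto
    finally show "card (R i) \<le> p ^ (d - 1)" .
  qed
  also have "\<dots> \<le> d * p ^ (d - 1)"
    by simp
  finally show ?thesis
    using card_good_polys_prime[OF p d h N] unfolding S_def by simp
qed

text \<open>In \<open>card_good_polys_prime\<close> with n = s, the exponent j = 1 qualifies because
  \<open>r\<close> has order exactly d modulo \<open>s\<close>.\<close>

lemma good_polys_of_order_nonempty:
  assumes r: "prime r" "odd r" and d: "d > 0" and s: "s > 1" "[r ^ d = 1] (mod s)"
    and order: "\<And>i. i \<in> {1..<d} \<Longrightarrow> [r ^ i \<noteq> 1] (mod s)" and N: "[N = r] (mod s)"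
  shows "card (good_polys N d r ((-1) ^ (d - 1))) > 0"
proof -
  have r0: "r ^ i \<ge> 1" for i
    using prime_gt_0_nat[OF r(1)] by (simp add: Suc_le_eq)
  have cong_iff: "s dvd r ^ i - 1 \<longleftrightarrow> [r ^ i = 1] (mod s)" for i
    using r0[of i] by (simp only: cong_altdef_nat)
  have "1 \<in> {j \<in> {..<s}. \<forall>i\<in>{1..<d}. \<not> s dvd j * (r ^ i - 1)}"
    using s order by (simp add: cong_iff[simplified])
  then have "card {j \<in> {..<s}. \<forall>i\<in>{1..<d}. \<not> s dvd j * (r ^ i - 1)} > 0"
    by (intro card_gt_0_iff[THEN iffD2]) auto
  also have "\<dots> \<le> d * card (good_polys N d r ((-1) ^ (d - 1)))"
    using s by (intro card_good_polys_prime r d N) (auto simp: cong_iff[simplified])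
  finally show ?thesis
    by simp
qed

text \<open>\<open>K = 2 * s * r\<close> makes q odd, 1 modulo \<open>s\<close> and prime to
  \<open>r\<close>. As s - 1 divides \<open>k\<close> and all p in \<open>S\<close> share a residue
  modulo \<open>s\<close>, the product of \<open>A\<close> is 1 modulo \<open>s\<close>, so
  \<open>N\<close> is \<open>r\<close> modulo \<open>s\<close>; with \<open>k\<close> even the signs
  of \<open>A\<close> cancel. \<open>G\<close> is a lower bound for the number of polynomials modulo
  each p, and \<open>Q\<close> bounds how many sets give the same \<open>N\<close>.\<close>

lemma sum_L_count_ge:
  fixes d s r M c k a Y G X :: nat and h :: "nat \<Rightarrow> nat"
  assumes d: "d > 0" "cyclic_on \<sigma> {1..d}"
    and r: "prime r" "odd r" and s: "prime s" "odd s" and rs: "[r ^ d = 1] (mod s)"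
    and order: "\<And>i. i \<in> {1..<d} \<Longrightarrow> [r ^ i \<noteq> 1] (mod s)"
    and M: "M > 0" "\<And>l. prime l \<Longrightarrow> l dvd M \<Longrightarrow> l > 4 * s + 1 \<and> l \<noteq> r" and c: "coprime c M"
    and k: "even k" "k > 0" "(s - 1) dvd k"
    and fin: "finite S"
    and prime: "\<And>p. p \<in> S \<Longrightarrow> prime p \<and> odd p \<and> p > s * k \<and> p \<noteq> r \<and> \<not> p dvd M \<and> p \<le> Y"
    and cong: "\<And>p. p \<in> S \<Longrightarrow> [p = a] (mod s) \<and> [c = p] (mod h p)"
    and h: "\<And>p. p \<in> S \<Longrightarrow> h p > 0 \<and> h p dvd M \<and> h p dvd p ^ d - 1 \<and> d * G + d * p ^ (d - 1) \<le> h p"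
    and Q: "Q = (s * (2 * s * r * M * (s * k + 1)) ^ s) ^ Suc s"
    and X: "r * Y ^ k * Q < X"
  shows "(card S choose k) * G ^ k \<le> Q * (\<Sum>n | 1 < n \<and> odd n \<and> \<not> prime n \<and> n < X. L_count d \<sigma> n)"
proof -
  define K where "K = 2 * s * r"
  define \<A> where "\<A> = {A. A \<subseteq> S \<and> card A = k}"
  have s1: "s > 1"
    using prime_gt_1_nat[OF s(1)] .
  have K: "K > 1" "s dvd K"
    using s1 prime_gt_1_nat[OF r(1)] by (auto simp only: K_def intro!: less_1_mult) auto
  have cop_K: "coprime K l" if "prime l" "l \<noteq> 2" "l \<noteq> s" "l \<noteq> r" for l
    unfolding K_def coprime_mult_left_iff using that s(1) r(1)
    by (intro conjI) (auto intro: primes_coprime simp del: coprime_left_2_iff_odd)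
  have cop_KM: "coprime K M"
  proof (rule ccontr)
    assume "\<not> coprime K M"
    then obtain u where "u dvd K" "u dvd M" "\<not> is_unit u"
      by (meson Rings.coprimeI)
    then obtain l where l: "prime l" "l dvd K" "l dvd M"
      by (metis dvd_trans nat_dvd_1_iff_1 prime_factor_nat)
    then have "coprime K l"
      using M(2)[of l] s1 by (intro cop_K) auto
    then show False
      using l by (metis Rings.coprime_common_divisor dvd_refl not_prime_unit)
  qed
  have "\<forall>A\<in>\<A>. \<exists>q. q > 1 \<and> q \<le> Q \<and> [r * \<Prod>A * q = c] (mod M) \<and> [q = 1] (mod K) \<and>
      (\<forall>l. prime l \<longrightarrow> l dvd q \<longrightarrow> [l = 1] (mod s)) \<and> (\<forall>p\<in>A. \<not> p dvd q)"
  proof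
    fix A assume A: "A \<in> \<A>"
    have A': "A \<subseteq> S" "card A = k" "finite A"
      using A fin by (auto simp: \<A>_def intro: finite_subset)
    have "coprime M (r * \<Prod>A)"
    proof (simp only: coprime_mult_right_iff, intro conjI prod_coprime_right)
      show "coprime M r"
        using M(2)[OF r(1)] r(1) prime_imp_coprime[of r M] by (auto simp: ac_simps)
      show "coprime M p" if "p \<in> A" for p
        using that A' prime[of p] prime_imp_coprime[of p M] by (auto simp: ac_simps)
    qed
    then obtain w where w: "[r * \<Prod>A * w = 1] (mod M)"
      using ex_inverse_mod_nat by blast
    have "coprime w M"
      using cong_imp_coprime[OF cong_sym[OF w]] by simp
    then have g: "coprime (c * w) M"
      using c by simp
    have "\<exists>q>1. [q = c * w] (mod M) \<and> [q = 1] (mod K) \<and> (\<forall>l. prime l \<longrightarrow> l dvd q \<longrightarrow> [l = 1] (mod s)) \<and>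
        (\<forall>p\<in>A. \<not> p dvd q) \<and> q \<le> (s * (K * M * (s * card A + 1)) ^ s) ^ Suc s"
    proof (rule ex_cofactor[OF s K cop_KM M(1) _ g A'(3)])
      show "l > 4 * s + 1" if "prime l" "l dvd M" for l
        using M(2)[OF that] by simp
      show "prime p \<and> coprime p (K * M) \<and> p > s * card A" if "p \<in> A" for p
      proof -
        have p: "prime p \<and> odd p \<and> p > s * k \<and> p \<noteq> r \<and> \<not> p dvd M \<and> p \<le> Y"
          using that A'(1) prime[of p] by blast
        then have "p \<noteq> s"
          using k(2) by auto
        moreover have "p \<noteq> 2"
          using p by auto
        ultimately have "coprime p K"
          using cop_K[of p] p by (simp add: ac_simps)
        then show ?thesis
          using p A'(2) prime_imp_coprime[of p M] by simp
      qed
    qed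
    then obtain q where q: "q > 1" "[q = c * w] (mod M)" "[q = 1] (mod K)"
        "\<forall>l. prime l \<longrightarrow> l dvd q \<longrightarrow> [l = 1] (mod s)" "\<forall>p\<in>A. \<not> p dvd q" "q \<le> Q"
      unfolding A'(2) K_def Q[symmetric] by blast
    have "[r * \<Prod>A * q = r * \<Prod>A * (c * w)] (mod M)"
      by (intro cong_mult cong_refl q)
    also have "r * \<Prod>A * (c * w) = c * (r * \<Prod>A * w)"
      by (simp add: mult_ac)
    also have "[c * (r * \<Prod>A * w) = c * 1] (mod M)"
      by (intro cong_mult cong_refl w)
    finally have "[r * \<Prod>A * q = c] (mod M)"
      by simp
    then show "\<exists>q. q > 1 \<and> q \<le> Q \<and> [r * \<Prod>A * q = c] (mod M) \<and> [q = 1] (mod K) \<and>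
        (\<forall>l. prime l \<longrightarrow> l dvd q \<longrightarrow> [l = 1] (mod s)) \<and> (\<forall>p\<in>A. \<not> p dvd q)"
      using q by blast
  qed
  from bchoice[OF this] obtain q where q: "\<And>A. A \<in> \<A> \<Longrightarrow> q A > 1" "\<And>A. A \<in> \<A> \<Longrightarrow> q A \<le> Q"
      "\<And>A. A \<in> \<A> \<Longrightarrow> [r * \<Prod>A * q A = c] (mod M)" "\<And>A. A \<in> \<A> \<Longrightarrow> [q A = 1] (mod K)"
      "\<And>A l. A \<in> \<A> \<Longrightarrow> prime l \<Longrightarrow> l dvd q A \<Longrightarrow> [l = 1] (mod s)"
      "\<And>A p. A \<in> \<A> \<Longrightarrow> p \<in> A \<Longrightarrow> \<not> p dvd q A"
    by blast
  define N where "N A = r * \<Prod>A * q A" for A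
  have N: "1 < N A \<and> odd (N A) \<and> \<not> prime (N A) \<and> N A < X \<and> G ^ k \<le> L_count d \<sigma> (N A)" if A: "A \<in> \<A>" for A
  proof -
    have A': "A \<subseteq> S" "card A = k" "finite A" "A \<noteq> {}"
      using A fin k(2) by (auto simp: \<A>_def intro: finite_subset)
    have pA: "prime p" "odd p" "p > s * k" "p \<noteq> r" "\<not> p dvd M" "p \<le> Y" "[p = a] (mod s)" "[c = p] (mod h p)"
        "h p > 0" "h p dvd M" "h p dvd p ^ d - 1" "d * G + d * p ^ (d - 1) \<le> h p" if "p \<in> A" for p
      using that A'(1) prime[of p] cong[of p] h[of p] by auto
    have prod1: "\<Prod>A > 1"
    proof -
      obtain p where p: "p \<in> A"
        using A'(4) by blast
      then have "p dvd \<Prod>A"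
        using dvd_prodI[of A p "\<lambda>p. p"] A'(3) by simp
      moreover have "\<Prod>A > 0"
        using pA(1) by (intro prod_pos) (auto simp: prime_gt_0_nat)
      ultimately have "p \<le> \<Prod>A"
        by (rule dvd_imp_le)
      then show ?thesis
        using prime_gt_1_nat[OF pA(1)[OF p]] by linarith
    qed
    have r1: "r > 1"
      using prime_gt_1_nat[OF r(1)] .
    have "even K"
      by (simp add: K_def)
    then have "[q A = 1] (mod 2)"
      using q(4)[OF A] cong_dvd_modulus_nat by blast
    then have odd_q: "odd (q A)"
      by (auto simp: cong_def odd_iff_mod_2_eq_one)
    have odd: "odd (N A)"
      using r(2) odd_q pA(2) A'(3) by (auto simp: N_def even_prod_iff)
    have "[\<Prod>A = (\<Prod>p\<in>A. a)] (mod s)"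
      using pA(7) by (intro cong_prod)
    also have "(\<Prod>p\<in>A. a) = (a ^ (s - 1)) ^ (k div (s - 1))"
      using k(3) A'(2) by (simp flip: power_mult)
    also have "[\<dots> = 1 ^ (k div (s - 1))] (mod s)"
    proof (intro cong_pow fermat_theorem s(1))
      obtain p where p: "p \<in> A"
        using A'(4) by blast
      then have "p > s"
        using pA(3)[OF p] k(2) by (metis Suc_leI less_le_trans mult.right_neutral mult_le_mono2 not_le One_nat_def)
      then have "\<not> s dvd p"
        using pA(1)[OF p] s(1) by (metis less_irrefl primes_dvd_imp_eq)
      then show "\<not> s dvd a"
        using pA(7)[OF p] cong_dvd_iff by blast
    qed
    finally have prod_s: "[\<Prod>A = 1] (mod s)"
      by simp
    have "[q A = 1] (mod s)"
      using q(4)[OF A] K(2) cong_dvd_modulus_nat by blast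
    then have "[N A = r * 1 * 1] (mod s)"
      unfolding N_def by (intro cong_mult cong_refl prod_s)
    then have N_s: "[N A = r] (mod s)"
      by simp
    have N_p: "[N A = p] (mod h p)" if "p \<in> A" for p
    proof -
      have "[N A = c] (mod h p)"
        unfolding N_def using q(3)[OF A] pA(10)[OF that] cong_dvd_modulus_nat by blast
      then show ?thesis
        using pA(8)[OF that] cong_trans by blast
    qed
    define t :: int where "t = (-1) ^ (d - 1)"
    have "G ^ k = (\<Prod>p\<in>A. G)"
      using A' by simp
    also have "\<dots> \<le> (\<Prod>p\<in>A. card (good_polys (N A) d p t))"
    proof (intro prod_mono conjI)
      fix p assume p: "p \<in> A"
      have "d * G + d * p ^ (d - 1) \<le> d * card (good_polys (N A) d p t) + d * p ^ (d - 1)"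
        using le_card_good_polys_prime[OF pA(1,2)[OF p] d(1) pA(9,11)[OF p] N_p[OF p]] pA(12)[OF p] unfolding t_def by linarith
      then show "G \<le> card (good_polys (N A) d p t)"
        using d(1) by simp
    qed simp
    also have "\<dots> \<le> card (good_polys (N A) d (\<Prod>A) (t ^ k))"
      using prod_card_good_polys_le[OF A'(3,4)] pA(1) A'(2) by blast
    also have "t ^ k = 1"
      using k(1) by (simp add: t_def minus_one_power_iff)
    finally have prod_card: "G ^ k \<le> card (good_polys (N A) d (\<Prod>A) 1)" .
    have r_card: "0 < card (good_polys (N A) d r t)"
      unfolding t_def by (rule good_polys_of_order_nonempty[OF r d(1) s1 rs order N_s])
    obtain z where z: "[z ^ s = 1] (mod int (q A))" "\<forall>j\<in>{1..<s}. coprime (int (q A)) (z ^ j - 1)"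
      using ex_root_of_unity_mod[of "q A" s] q(1,5)[OF A] s1 by auto
    have "good_polys (N A) d (q A) 1 \<noteq> {}"
      using z s1 by (intro good_polys_root_of_unity_nonempty[OF q(1)[OF A] _ z(1) _ d(1) rs order N_s]) auto
    then have q_card: "0 < card (good_polys (N A) d (q A) 1)"
      using q(1)[OF A] by (simp add: card_gt_0_iff finite_good_polys)
    have "coprime r (\<Prod>A)"
      using pA r(1) by (intro prod_coprime_right primes_coprime) auto
    then have r_prod_card: "G ^ k \<le> card (good_polys (N A) d (r * \<Prod>A) (t * 1))"
      using card_good_polys_mult[OF r1 prod1, of "N A" d t 1] r_card prod_card
      by (metis One_nat_def Suc_leI le_trans mult_1 mult_le_mono)
    have cop: "coprime (r * \<Prod>A) (q A)"
    proof (simp only: coprime_mult_left_iff, intro conjI prod_coprime_left)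
      have "[q A = 1] (mod r)"
        using q(4)[OF A] cong_dvd_modulus_nat[of "q A" 1 K r] by (simp add: K_def)
      then show "coprime r (q A)"
        using cong_imp_coprime[OF cong_sym, of "q A" 1 r] by (simp add: ac_simps)
      show "coprime p (q A)" if "p \<in> A" for p
        using that q(6)[OF A that] pA(1)[OF that] prime_imp_coprime by blast
    qed
    have r_prod: "r * \<Prod>A > 1"
      using r1 prod1 by (intro less_1_mult)
    have "G ^ k * 1 \<le> card (good_polys (N A) d (r * \<Prod>A) (t * 1)) * card (good_polys (N A) d (q A) 1)"
      using r_prod_card q_card by (intro mult_le_mono) auto
    also have "\<dots> \<le> card (good_polys (N A) d (N A) (t * 1 * 1))"
      using card_good_polys_mult[OF r_prod q(1)[OF A] cop] unfolding N_def .
    also have "\<dots> \<le> L_count d \<sigma> (N A)"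
      using less_1_mult[OF r_prod q(1)[OF A]] odd d(1)
      by (intro card_good_polys_le_L_count d) (auto simp: t_def N_def)
    finally have "G ^ k \<le> L_count d \<sigma> (N A)"
      by simp
    moreover have "1 < N A"
      unfolding N_def using r_prod q(1)[OF A] by (rule less_1_mult)
    moreover have "\<not> prime (N A)"
      unfolding N_def using r_prod q(1)[OF A] by (metis not_less_iff_gr_or_eq prime_product)
    moreover have "N A < X"
    proof -
      have "\<Prod>A \<le> (\<Prod>p\<in>A. Y)"
        using pA(6) by (intro prod_mono) auto
      then have "N A \<le> r * Y ^ k * Q"
        unfolding N_def using A'(2) q(2)[OF A] by (intro mult_le_mono) auto
      then show ?thesis
        using X by linarith
    qed
    ultimately show ?thesis
      using odd by blast
  qed
  have fin\<A>: "finite \<A>"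
    unfolding \<A>_def using fin by simp
  \<comment> \<open>\<open>N A\<close> and \<open>q A\<close> determine the product of
    \<open>A\<close>, whose prime factors are the elements of \<open>A\<close>.\<close>
  have "inj_on (\<lambda>A. (N A, q A)) \<A>"
  proof
    fix A B assume AB: "A \<in> \<A>" "B \<in> \<A>" "(N A, q A) = (N B, q B)"
    have "q A > 0" "r > 0"
      using q(1)[OF AB(1)] prime_gt_0_nat[OF r(1)] by auto
    then have eq: "\<Prod>A = \<Prod>B"
      using AB(3) by (auto simp: N_def)
    have "C = {p. prime p \<and> p dvd \<Prod>C}" if C: "C \<in> \<A>" for C
    proof (rule Set.set_eqI, rule iffI)
      fix p
      have C': "finite C" "\<And>p. p \<in> C \<Longrightarrow> prime p"
        using C fin prime by (auto simp: \<A>_def intro: finite_subset)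
      show "p \<in> {p. prime p \<and> p dvd \<Prod>C}" if "p \<in> C"
        using that C' by (auto intro: dvd_prodI[of C p id, simplified])
      show "p \<in> C" if p: "p \<in> {p. prime p \<and> p dvd \<Prod>C}"
      proof -
        obtain x where "x \<in> C" "p dvd x"
          using p C'(1) by (auto simp: prime_dvd_prod_iff)
        then show ?thesis
          using p C'(2) primes_dvd_imp_eq[of p x] by auto
      qed
    qed
    then show "A = B"
      using AB eq by metis
  qed
  moreover have "(\<lambda>A. (N A, q A)) ` \<A> \<subseteq> N ` \<A> \<times> {1..Q}"
    using q(1,2) by (auto simp only: image_subset_iff mem_Sigma_iff atLeastAtMost_iff intro: less_imp_le)
  ultimately have "card \<A> \<le> card (N ` \<A> \<times> {1..Q})"
    using fin\<A> by (intro card_inj_on_le) auto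
  then have "card S choose k \<le> card (N ` \<A>) * Q"
    using n_subsets[OF fin, of k] by (simp add: \<A>_def card_cartesian_product)
  then have "(card S choose k) * G ^ k \<le> card (N ` \<A>) * Q * G ^ k"
    by (intro mult_le_mono1)
  also have "\<dots> = Q * (\<Sum>n\<in>N ` \<A>. G ^ k)"
    by simp
  also have "(\<Sum>n\<in>N ` \<A>. G ^ k) \<le> (\<Sum>n\<in>N ` \<A>. L_count d \<sigma> n)"
    using N by (intro sum_mono) auto
  also have "\<dots> \<le> (\<Sum>n | 1 < n \<and> odd n \<and> \<not> prime n \<and> n < X. L_count d \<sigma> n)"
    using N by (intro sum_mono2) auto
  finally show ?thesis
    by simp
qed

section \<open>Asymptotics\<close>

lemma prime_dvd_Lcm_finite:
  fixes A :: "nat set"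
  assumes "finite A" "prime p" "p dvd Lcm A"
  shows "\<exists>a\<in>A. p dvd a"
  using assms(1,3)
proof (induction A)
  case (insert a A)
  have "Lcm (insert a A) dvd a * Lcm A"
    by (simp add: lcm_least)
  then have "p dvd a * Lcm A"
    using insert.prems dvd_trans by blast
  then show ?case
    using insert.IH assms(2) by (auto simp: prime_dvd_mult_iff)
qed (use assms(2) not_prime_unit in auto)

lemma finite_prime_set: "finite (prime_set \<alpha> F x)"
proof (rule finite_subset)
  show "prime_set \<alpha> F x \<subseteq> {..nat \<lfloor>ln x powr \<alpha>\<rfloor>}"
    by (auto simp: prime_set_def le_nat_floor intro: less_imp_le)
qed simp

lemma le_nat_floor_iff: "k \<ge> 1 \<Longrightarrow> k \<le> nat \<lfloor>y\<rfloor> \<longleftrightarrow> real k \<le> y"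
  by (cases "y \<ge> 0") (auto simp: le_nat_iff le_floor_iff nat_floor_neg)

lemma lcm_upto_eq: "lcm_upto x = Lcm {1..nat \<lfloor>ln x / ln (ln x)\<rfloor>}"
  unfolding lcm_upto_def by (intro arg_cong[of _ _ Lcm]) (auto simp: le_nat_floor_iff[symmetric])

lemma lcm_upto_pos: "lcm_upto x > 0"
  unfolding lcm_upto_eq by (intro Nat.gr0I) (simp add: Lcm_0_iff)

lemma prime_dvd_lcm_upto_imp_le:
  assumes "prime p" "p dvd lcm_upto x"
  shows "real p \<le> ln x / ln (ln x)"
proof -
  obtain k where k: "k \<in> {1..nat \<lfloor>ln x / ln (ln x)\<rfloor>}" "p dvd k"
    using prime_dvd_Lcm_finite[OF _ assms(1)] assms(2) unfolding lcm_upto_eq by blast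
  then have "p \<le> k"
    by (intro dvd_imp_le) auto
  also have "real k \<le> ln x / ln (ln x)"
    using k(1) by (simp add: le_nat_floor_iff[symmetric])
  finally show ?thesis
    by simp
qed

text \<open>Here u = ln x. With n about u / ln u, both factors of \<open>Lcm_atMost_le\<close> are
  exp(o(u)), so M(x) is x^o(1).\<close>

lemma lcm_upto_le_exp:
  assumes "\<delta> > 0"
  shows "\<forall>\<^sub>F u in at_top. real (lcm_upto (exp u)) \<le> exp (\<delta> * u)"
proof -
  have "\<forall>\<^sub>F u in at_top. (sqrt u + 1) * ln u + u / ln u * ln 4 \<le> \<delta> * u"
    using assms by real_asymp
  moreover have "\<forall>\<^sub>F u in at_top. 1 \<le> ln u \<and> 1 \<le> u / ln u \<and> 1 \<le> (u :: real)"
    by (intro eventually_conj) real_asymp+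
  ultimately show ?thesis
  proof eventually_elim
    case (elim u)
    define n where "n = nat \<lfloor>u / ln u\<rfloor>"
    define m where "m = nat \<lceil>sqrt (real n)\<rceil>"
    have "0 < ln u"
      using elim by linarith
    then have "u / ln u \<le> u / 1"
      using elim by (intro divide_left_mono) auto
    moreover have "real n \<le> u / ln u"
      unfolding n_def using elim by (intro of_nat_floor) linarith
    moreover have "1 \<le> n"
      unfolding n_def using elim by (intro le_nat_floor) simp
    ultimately have n: "1 \<le> real n" "real n \<le> u / ln u" "real n \<le> u"
      by auto
    have m: "sqrt (real n) \<le> real m" "real m \<le> sqrt u + 1"
    proof -
      show "sqrt (real n) \<le> real m"
        unfolding m_def by (rule real_nat_ceiling_ge)
      have "real m \<le> sqrt (real n) + 1"
        unfolding m_def by (simp add: of_nat_ceiling)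
      also have "\<dots> \<le> sqrt u + 1"
        using n by simp
      finally show "real m \<le> sqrt u + 1" .
    qed
    have "n \<le> m ^ 2"
      using sqrt_le_D[OF m(1)] by (simp only: of_nat_le_iff flip: of_nat_power)
    then have "real (lcm_upto (exp u)) \<le> real (n ^ m * 4 ^ n)"
      using n(1) unfolding lcm_upto_eq ln_exp n_def[symmetric] of_nat_le_iff by (intro Lcm_atMost_le) auto
    also have "\<dots> = exp (real m * ln (real n) + real n * ln 4)"
      using n(1) by (simp add: exp_add exp_of_nat_mult ln_realpow[symmetric])
    also have "\<dots> \<le> exp (\<delta> * u)"
    proof (subst exp_le_cancel_iff)
      have "real m * ln (real n) \<le> (sqrt u + 1) * ln u"
        using n m elim by (intro mult_mono) auto
      moreover have "real n * ln 4 \<le> u / ln u * ln 4"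
        using n by (intro mult_right_mono) auto
      ultimately show "real m * ln (real n) + real n * ln 4 \<le> \<delta> * u"
        using elim by linarith
    qed
    finally show ?case .
  qed
qed

lemma power_card_prime_factors_le:
  fixes n z :: nat
  assumes "n > 0" and "\<And>l. prime l \<Longrightarrow> l dvd n \<Longrightarrow> l > z"
  shows "z ^ card (prime_factors n) \<le> n"
proof -
  have "z ^ card (prime_factors n) = (\<Prod>l\<in>prime_factors n. z)"
    by simp
  also have "\<dots> \<le> (\<Prod>l\<in>prime_factors n. l ^ multiplicity l n)"
  proof (intro prod_mono conjI)
    fix l assume l: "l \<in> prime_factors n"
    then have "z \<le> l ^ 1"
      using assms(2)[of l] by (auto intro: less_imp_le)
    also have "\<dots> \<le> l ^ multiplicity l n"
      using l by (intro power_increasing) (auto simp: prime_factors_multiplicity Suc_le_eq prime_gt_0_nat)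
    finally show "z \<le> l ^ multiplicity l n" .
  qed simp
  also have "\<dots> = n"
    using prod_prime_factors[of n] assms(1) by simp
  finally show ?thesis .
qed

text \<open>With L = ln x, primes up to L^(\<alpha> - \<gamma>) are discarded, and so are those for
  which some prime up to \<open>z\<close> enters p^d - 1 with a power above L^\<gamma>; for the
  others the smooth part is at most (L^\<gamma>)^z = L^\<beta>. The residue modulo \<open>s\<close>
  costs a factor \<open>s\<close>, and the common residue costs d^\<omega> if h p has \<omega> prime
  factors, where (d^\<omega>)^J \<le> z^\<omega> \<le> h p \<le> L^(\<alpha> d) \<le>
  (L^\<beta>)^J.\<close>

lemma ex_compatible_primes:
  fixes d s z J :: nat and \<alpha> \<beta> \<gamma> L :: real
  assumes d: "d > 0" and s: "s > 0" and L: "L \<ge> 1" and \<gamma>: "\<gamma> > 0" "\<gamma> * z = \<beta>"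
    and J: "J > 0" "d ^ J \<le> z" "\<alpha> * d \<le> \<beta> * J"
    and P: "finite P" "\<And>p. p \<in> P \<Longrightarrow> prime p \<and> real p < L powr \<alpha>"
    and card: "L powr (\<alpha> - \<gamma> / 2) \<le> card P"
    and few: "L powr (\<alpha> - \<gamma>) + z ^ (2 * d + 1) * ((L powr \<alpha> + 1) / L powr \<gamma> + 1) \<le> L powr (\<alpha> - \<gamma> / 2) / 2"
    and many: "2 * s * L powr \<beta> * L powr (\<alpha> - 3 * \<beta>) \<le> L powr (\<alpha> - \<gamma> / 2)"
  shows "\<exists>S a c. S \<subseteq> P \<and> L powr (\<alpha> - 3 * \<beta>) \<le> card S \<and> (\<forall>p\<in>S. L powr (\<alpha> - \<gamma>) < p \<and> [p = a] (mod s) \<and>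
    [c = p] (mod rough_part z (p ^ d - 1)) \<and> p ^ d - 1 \<le> L powr \<beta> * rough_part z (p ^ d - 1))"
proof -
  define h where "h p = rough_part z (p ^ d - 1)" for p
  define B where "B = L powr \<gamma>"
  have B: "B \<ge> 1"
    using L \<gamma> by (simp add: B_def ge_one_powr_ge_zero)
  have Bz: "B ^ z = L powr \<beta>"
    using L \<gamma>(2) by (simp add: B_def powr_powr flip: powr_realpow)
  define bad1 where "bad1 = {p \<in> P. real p \<le> L powr (\<alpha> - \<gamma>)}"
  define bad2 where "bad2 = {p \<in> P. \<exists>l\<le>z. prime l \<and> B < real (l ^ multiplicity l (p ^ d - 1))}"
  define P1 where "P1 = P - (bad1 \<union> bad2)"
  have "real (card bad1) \<le> L powr (\<alpha> - \<gamma>)"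
  proof -
    have "bad1 \<subseteq> {1..nat \<lfloor>L powr (\<alpha> - \<gamma>)\<rfloor>}"
      using P(2) prime_gt_0_nat by (force simp: bad1_def le_nat_floor Suc_le_eq)
    then have "card bad1 \<le> nat \<lfloor>L powr (\<alpha> - \<gamma>)\<rfloor>"
      using card_mono[of "{1..nat \<lfloor>L powr (\<alpha> - \<gamma>)\<rfloor>}" bad1] by simp
    then have "real (card bad1) \<le> real (nat \<lfloor>L powr (\<alpha> - \<gamma>)\<rfloor>)"
      by (simp only: of_nat_le_iff)
    also have "\<dots> \<le> L powr (\<alpha> - \<gamma>)"
      by (intro of_nat_floor) simp
    finally show ?thesis .
  qed
  moreover have "real (card bad2) \<le> real z ^ (2 * d + 1) * ((L powr \<alpha> + 1) / B + 1)"
    unfolding bad2_def using P(2) by (intro card_large_smooth_part d B) auto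
  moreover have "card P \<le> card P1 + (card bad1 + card bad2)"
  proof -
    have "card P = card (P1 \<union> (bad1 \<union> bad2))"
      by (intro arg_cong[where f = card]) (auto simp: P1_def bad1_def bad2_def)
    also have "\<dots> \<le> card P1 + card (bad1 \<union> bad2)"
      by (rule card_Un_le)
    also have "\<dots> \<le> card P1 + (card bad1 + card bad2)"
      by (intro add_left_mono card_Un_le)
    finally show ?thesis .
  qed
  then have "real (card P) \<le> real (card P1) + (real (card bad1) + real (card bad2))"
    by linarith
  ultimately have P1: "L powr (\<alpha> - \<gamma> / 2) / 2 \<le> real (card P1)"
    using few card unfolding B_def of_nat_power by linarith
  have finP1: "finite P1"
    using P(1) by (simp add: P1_def)
  have "\<exists>a. card P1 \<le> s * card {p \<in> P1. p mod s = a}"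
  proof (rule ccontr)
    assume no: "\<not> ?thesis"
    have "s * card P1 = s * (\<Sum>a<s. card {p \<in> P1. p mod s = a})"
    proof -
      have "P1 = (\<Union>a\<in>{..<s}. {p \<in> P1. p mod s = a})"
        using s by auto
      then have "card P1 = card (\<Union>a\<in>{..<s}. {p \<in> P1. p mod s = a})"
        by simp
      also have "\<dots> = (\<Sum>a<s. card {p \<in> P1. p mod s = a})"
        using finP1 by (intro card_UN_disjoint) auto
      finally show ?thesis
        by simp
    qed
    also have "\<dots> = (\<Sum>a<s. s * card {p \<in> P1. p mod s = a})"
      by (rule sum_distrib_left)
    also have "\<dots> < (\<Sum>a<s. card P1)"
      using no s by (intro sum_strict_mono) (auto simp: not_le)
    finally show False
      by simp
  qed
  then obtain a where a: "card P1 \<le> s * card {p \<in> P1. p mod s = a}" ..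
  define P2 where "P2 = {p \<in> P1. p mod s = a}"
  have pd: "p ^ d - 1 > 0" if "p \<in> P2" for p
    using that P(2)[of p] d prime_gt_1_nat[of p] one_less_power[of p d] by (auto simp: P2_def P1_def)
  obtain S c where S: "S \<subseteq> P2" "\<forall>p\<in>S. [c = p] (mod h p)" "card P2 \<le> (\<Sum>p\<in>S. d ^ card (prime_factors (h p)))"
  proof -
    have "h p > 0 \<and> [p ^ d = 1] (mod h p) \<and> coprime (h p) d" if p: "p \<in> P2" for p
    proof (intro conjI)
      show "h p > 0"
        unfolding h_def by (rule rough_part_pos)
      have "h p dvd p ^ d - 1"
        unfolding h_def using pd[OF p] by (rule rough_part_dvd)
      then show "[p ^ d = 1] (mod h p)"
        using pd[OF p] by (simp add: cong_altdef_nat)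
      show "coprime (h p) d"
      proof (rule ccontr)
        assume "\<not> coprime (h p) d"
        then obtain u where "u dvd h p" "u dvd d" "\<not> is_unit u"
          by (meson Rings.coprimeI)
        then obtain l where l: "prime l" "l dvd h p" "l dvd d"
          by (metis dvd_trans nat_dvd_1_iff_1 prime_factor_nat)
        have "l > z"
          using prime_dvd_rough_part l unfolding h_def by blast
        moreover have "l \<le> d"
          using l(3) d by (rule dvd_imp_le)
        moreover have "d \<le> d ^ J"
          using J(1) d by (simp add: self_le_power)
        ultimately show False
          using J(2) by linarith
      qed
    qed
    then show ?thesis
      using that ex_common_residue[of P2 d h] finP1 d by (auto simp: P2_def)
  qed
  have "real (card P2) \<le> real (\<Sum>p\<in>S. d ^ card (prime_factors (h p)))"
    using S(3) by (simp only: of_nat_le_iff)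
  also have "\<dots> = (\<Sum>p\<in>S. real d ^ card (prime_factors (h p)))"
    by simp
  also have "\<dots> \<le> (\<Sum>p\<in>S. L powr \<beta>)"
  proof (intro sum_mono)
    fix p assume p: "p \<in> S"
    have "(real d ^ card (prime_factors (h p))) ^ J = real ((d ^ J) ^ card (prime_factors (h p)))"
      by (simp add: mult.commute flip: power_mult)
    also have "\<dots> \<le> real (z ^ card (prime_factors (h p)))"
      using J(2) by (simp only: of_nat_le_iff) (intro power_mono, auto)
    also have "z ^ card (prime_factors (h p)) \<le> h p"
      unfolding h_def by (intro power_card_prime_factors_le rough_part_pos prime_dvd_rough_part)
    also have "h p \<le> p ^ d"
    proof -
      have "p ^ d - 1 > 0"
        using p S(1) pd by blast
      then have "rough_part z (p ^ d - 1) \<le> p ^ d - 1"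
        by (intro dvd_imp_le rough_part_dvd)
      then show ?thesis
        unfolding h_def by simp
    qed
    also have "real (p ^ d) \<le> (L powr \<alpha>) ^ d"
    proof -
      have "p \<in> P"
        using p S(1) by (auto simp: P2_def P1_def)
      then have "real p \<le> L powr \<alpha>"
        using P(2) less_imp_le by blast
      then show ?thesis
        by (simp add: power_mono)
    qed
    also have "\<dots> = L powr (\<alpha> * d)"
      using L by (simp add: powr_powr flip: powr_realpow)
    also have "\<dots> \<le> L powr (\<beta> * J)"
      using L J(3) by (intro powr_mono)
    also have "\<dots> = (L powr \<beta>) ^ J"
      using L by (simp add: powr_powr flip: powr_realpow)
    finally show "real d ^ card (prime_factors (h p)) \<le> L powr \<beta>"
      using J(1) by (simp add: power_mono_iff)
  qed
  also have "\<dots> = card S * L powr \<beta>"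
    by simp
  finally have P2: "real (card P2) \<le> card S * L powr \<beta>" .
  have "L powr (\<alpha> - \<gamma> / 2) / 2 \<le> real (s * card P2)"
    using P1 a unfolding P2_def[symmetric] by linarith
  also have "\<dots> \<le> s * (card S * L powr \<beta>)"
    using P2 by (simp add: mult_left_mono)
  finally have "2 * s * L powr \<beta> * L powr (\<alpha> - 3 * \<beta>) \<le> 2 * s * L powr \<beta> * card S"
    using many by (simp add: mult_ac)
  then have "L powr (\<alpha> - 3 * \<beta>) \<le> card S"
    using s L by (simp add: mult_le_cancel_left)
  moreover have "L powr (\<alpha> - \<gamma>) < p \<and> [p = a] (mod s) \<and> [c = p] (mod h p) \<and> p ^ d - 1 \<le> L powr \<beta> * h p"
    if p: "p \<in> S" for p
  proof -
    have pS: "p \<in> P2" "[c = p] (mod h p)"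
      using p S by auto
    then have p': "p \<in> P" "p \<notin> bad1" "p \<notin> bad2" "p mod s = a"
      by (auto simp: P2_def P1_def)
    have "real (p ^ d - 1) \<le> B ^ z * h p"
      unfolding h_def using p'(1,3) pd[OF pS(1)] B by (intro le_rough_part_mult) (auto simp: bad2_def not_less)
    moreover have "L powr (\<alpha> - \<gamma>) < p"
      using p'(1,2) by (auto simp: bad1_def)
    moreover have "[p = a] (mod s)"
      using p'(4) by (auto simp: cong_def)
    moreover have "real p ^ d - 1 = real (p ^ d - 1)"
      using pd[OF pS(1)] by (simp add: of_nat_diff)
    ultimately show ?thesis
      using pS(2) Bz by simp
  qed
  ultimately show ?thesis
    using S(1) unfolding h_def P2_def P1_def by blast
qed

section \<open>Explicit bounds for the parameters\<close>

lemma cofactor_bound_le_exp: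
  fixes s r M k :: nat and u \<delta> :: real
  assumes M: "M \<le> exp (\<delta> * u)" and c: "2 * real s * real r * (real s * u + 1) \<le> exp (\<delta> * u)" and s: "s \<le> exp (\<delta> * u)"
    and k: "k \<le> u" and u: "u \<ge> 0" and \<delta>: "\<delta> > 0"
  shows "real ((s * (2 * s * r * M * (s * k + 1)) ^ s) ^ Suc s) \<le> exp (2 * (real s + 1) ^ 2 * \<delta> * u)"
proof -
  have "real (2 * s * r * M * (s * k + 1)) = real M * (2 * real s * real r * (real s * real k + 1))"
    by (simp add: algebra_simps)
  also have "\<dots> \<le> real M * (2 * real s * real r * (real s * u + 1))"
    using k by (intro mult_left_mono add_right_mono) auto
  also have "\<dots> \<le> exp (\<delta> * u) * exp (\<delta> * u)"
    using M c u by (intro mult_mono) auto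
  finally have "real (2 * s * r * M * (s * k + 1)) ^ s \<le> (exp (\<delta> * u) * exp (\<delta> * u)) ^ s"
    by (intro power_mono) auto
  then have "real s * real (2 * s * r * M * (s * k + 1)) ^ s \<le> exp (\<delta> * u) * (exp (\<delta> * u) * exp (\<delta> * u)) ^ s"
    using s by (intro mult_mono) auto
  also have "\<dots> = exp ((2 * real s + 1) * (\<delta> * u))"
    by (simp add: ring_distribs mult.commute flip: exp_add exp_of_nat_mult)
  also have "\<dots> \<le> exp (2 * (real s + 1) * (\<delta> * u))"
    using u \<delta> by (simp add: mult_right_mono)
  finally have "(real s * real (2 * s * r * M * (s * k + 1)) ^ s) ^ Suc s \<le> exp (2 * (real s + 1) * (\<delta> * u)) ^ Suc s"
    by (intro power_mono) auto
  also have "\<dots> = exp (real (Suc s) * (2 * (real s + 1) * (\<delta> * u)))"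
    by (simp only: exp_of_nat_mult)
  also have "real (Suc s) * (2 * (real s + 1) * (\<delta> * u)) = 2 * (real s + 1) ^ 2 * \<delta> * u"
    by (simp add: power2_eq_square algebra_simps)
  finally show ?thesis
    by (simp only: of_nat_power of_nat_mult)
qed

text \<open>Since \<open>h\<close> is at least p^d / (2 u^\<beta>), it suffices that each of the two
  terms is at most p^d / (4 u^\<beta>).\<close>

lemma rough_part_minus_small_orders:
  fixes d p h G :: nat and \<alpha> \<beta> \<gamma> u :: real
  assumes d: "d > 0" and u: "u \<ge> 1" and \<beta>: "4 * d \<le> u powr \<beta>" "4 * d * u powr \<beta> \<le> u powr (\<alpha> - \<gamma>)"
    and p: "u powr (\<alpha> - \<gamma>) < p" "real p ^ d - 1 \<le> u powr \<beta> * h"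
    and G: "G \<le> u powr ((\<alpha> - \<gamma>) * d - 2 * \<beta>)"
  shows "d * G + d * p ^ (d - 1) \<le> h"
proof -
  have d1: "real d \<ge> 1"
    using d by simp
  have "4 * 1 * 1 \<le> 4 * d * u powr \<beta>"
    using d1 \<beta>(1) by (intro mult_mono) auto
  then have p4: "4 \<le> real p"
    using \<beta>(2) p(1) by linarith
  have "real p ^ 1 \<le> real p ^ d"
    using p4 d by (intro power_increasing) auto
  then have "real p ^ d / 2 \<le> u powr \<beta> * h"
    using p(2) p4 unfolding power_one_right by linarith
  moreover have "u powr \<beta> * (d * real p ^ (d - 1)) \<le> real p ^ d / 4"
  proof -
    have "(4 * d * u powr \<beta>) * real p ^ (d - 1) \<le> real p * real p ^ (d - 1)"
      using \<beta>(2) p(1) by (intro mult_right_mono) auto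
    also have "\<dots> = real p ^ d"
      using d by (simp add: power_eq_if)
    finally show ?thesis
      by (simp add: mult_ac)
  qed
  moreover have "u powr \<beta> * (d * real G) \<le> real p ^ d / 4"
  proof -
    have "u powr \<beta> * (d * real G) \<le> u powr \<beta> * (u powr \<beta> / 4 * u powr ((\<alpha> - \<gamma>) * d - 2 * \<beta>))"
      using G \<beta>(1) by (intro mult_left_mono mult_mono) auto
    also have "\<dots> = u powr ((\<alpha> - \<gamma>) * d) / 4"
      using u by (simp flip: powr_add)
    also have "\<dots> = (u powr (\<alpha> - \<gamma>)) ^ d / 4"
      using u by (simp add: powr_powr flip: powr_realpow)
    also have "\<dots> \<le> real p ^ d / 4"
      using p(1) by (intro divide_right_mono power_mono) auto
    finally show ?thesis .
  qed
  ultimately have "u powr \<beta> * (d * real G + d * real p ^ (d - 1)) \<le> u powr \<beta> * h"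
    unfolding distrib_left by linarith
  then have "d * real G + d * real p ^ (d - 1) \<le> h"
    using u by (simp add: mult_le_cancel_left)
  then have "real (d * G + d * p ^ (d - 1)) \<le> real h"
    by simp
  then show ?thesis
    by (simp only: of_nat_le_iff)
qed

text \<open>Each of the \<open>k\<close> primes contributes u^(\<alpha> - 1) to the number of sets
  and u^(\<alpha> d) to the number of polynomials, up to multiples of \<beta> in the exponent. With
  \<open>k\<close> close to u / (\<alpha> ln u), the k-th power is exp(u (d + 1 - 1/\<alpha>)) up to
  errors of the same kind.\<close>

lemma count_exponent_bound:
  fixes d m k G s :: nat and \<alpha> \<beta> \<gamma> \<eta> u t Q \<Sigma> :: real
  assumes \<alpha>: "\<alpha> > 1" and \<beta>: "0 < \<beta>" "\<beta> \<le> 1 / 2" "(real d + 6) * \<beta> \<le> \<alpha> - 1" "(2 * real d + 8) * \<beta> \<le> \<eta>"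
    and \<gamma>: "0 < \<gamma>" "\<gamma> \<le> \<beta>" and u: "u \<ge> 1" "ln u > 0" "2 \<le> u powr \<beta>" and s: "s \<ge> 1" and d: "d > 0"
    and t: "t = (1 - \<beta>) * u / (\<alpha> * ln u)" and k: "k \<ge> 1" "k \<le> u" "t - (real s - 1) \<le> k"
    and m: "u powr (\<alpha> - 3 * \<beta>) \<le> m"
    and G: "G = nat \<lfloor>u powr ((\<alpha> - \<gamma>) * d - 2 * \<beta>)\<rfloor>"
    and small: "u powr ((real s - 1) * (\<alpha> * (real d + 1) - 1 - (real d + 6) * \<beta>)) \<le> exp (\<beta> / 2 * u)"
    and Q: "Q \<le> exp (\<beta> / 2 * u)" "\<Sigma> \<ge> 0" and main: "(m choose k) * G ^ k \<le> Q * \<Sigma>"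
  shows "exp (u * (real d + 1 - 1 / \<alpha> - \<eta>)) \<le> \<Sigma>"
proof -
  define w where "w = (\<alpha> - \<gamma>) * d - 2 * \<beta>"
  \<comment> \<open>A lower bound for the exponent \<alpha> - 1 - 4 \<beta> + w that each prime
    contributes, obtained from \<gamma> \<le> \<beta>.\<close>
  define e where "e = \<alpha> * (real d + 1) - 1 - (real d + 6) * \<beta>"
  have d1: "real d \<ge> 1"
    using d by simp
  have \<beta>\<alpha>: "7 * \<beta> \<le> \<alpha> - 1"
  proof -
    have "7 * \<beta> \<le> (real d + 6) * \<beta>"
      using \<beta>(1) d1 by (intro mult_right_mono) auto
    then show ?thesis
      using \<beta>(3) by linarith
  qed
  have e0: "e \<ge> 0"
  proof -
    have "\<alpha> * d > 0"
      using \<alpha> d1 by simp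
    then show ?thesis
      using \<beta>(3) \<alpha> unfolding e_def distrib_left[of \<alpha>] by linarith
  qed
  have w0: "w \<ge> 0"
  proof -
    have "(\<alpha> - \<gamma>) * 1 \<le> (\<alpha> - \<gamma>) * d"
      using \<gamma> \<beta>\<alpha> \<beta>(1) d1 by (intro mult_left_mono) linarith+
    moreover have "2 * \<beta> \<le> \<alpha> - \<gamma>"
      using \<gamma> \<beta>\<alpha> \<beta>(1) by linarith
    ultimately show ?thesis
      by (simp add: w_def)
  qed
  have "real k \<le> real m"
  proof -
    have "u powr 1 \<le> u powr (\<alpha> - 3 * \<beta>)"
      using \<beta>\<alpha> \<beta>(1) u(1) by (intro powr_mono) auto
    then show ?thesis
      using k(2) m u(1) by simp
  qed
  then have "(real m / real k) ^ k \<le> real (m choose k)"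
    by (intro binomial_ge_n_over_k_pow_k) simp
  moreover have "u powr (\<alpha> - 3 * \<beta> - 1) \<le> real m / real k"
  proof -
    have "u powr (\<alpha> - 3 * \<beta> - 1) = u powr (\<alpha> - 3 * \<beta>) / u"
      using u(1) by (simp add: powr_diff)
    also have "\<dots> \<le> real m / real k"
      using m k u(1) by (intro frac_le) auto
    finally show ?thesis .
  qed
  then have "(u powr (\<alpha> - 3 * \<beta> - 1)) ^ k \<le> (real m / real k) ^ k"
    by (intro power_mono) auto
  ultimately have choose: "(u powr (\<alpha> - 3 * \<beta> - 1)) ^ k \<le> real (m choose k)"
    by linarith
  \<comment> \<open>Rounding down costs at most a factor 2, which u^\<beta> absorbs.\<close>
  have "u powr (w - \<beta>) \<le> real G"
  proof -
    have one: "1 \<le> u powr w"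
      using u(1) w0 by (rule ge_one_powr_ge_zero)
    then have "real_of_int \<lfloor>u powr w\<rfloor> \<ge> u powr w / 2"
      using le_floor_iff[of 1 "u powr w"] by linarith
    then have "u powr w / 2 \<le> real G"
      using one unfolding G w_def[symmetric] by simp
    moreover have "u powr (w - \<beta>) \<le> u powr w / 2"
      unfolding powr_diff using u by (intro divide_left_mono) auto
    ultimately show ?thesis
      by linarith
  qed
  then have "(u powr (\<alpha> - 3 * \<beta> - 1)) ^ k * (u powr (w - \<beta>)) ^ k \<le> real (m choose k) * real G ^ k"
    using choose by (intro mult_mono power_mono) auto
  moreover have "(u powr (\<alpha> - 3 * \<beta> - 1)) ^ k * (u powr (w - \<beta>)) ^ k = u powr ((\<alpha> - 1 - 4 * \<beta> + w) * k)"
    using u(1) by (simp add: powr_powr algebra_simps flip: powr_realpow powr_add)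
  ultimately have lower: "u powr ((\<alpha> - 1 - 4 * \<beta> + w) * k) \<le> Q * \<Sigma>"
    using main by simp
  have "e \<le> \<alpha> - 1 - 4 * \<beta> + w"
  proof -
    have "\<gamma> * d \<le> \<beta> * d"
      using \<gamma> by (intro mult_right_mono) auto
    then show ?thesis
      by (simp add: e_def w_def algebra_simps)
  qed
  then have "e * k \<le> (\<alpha> - 1 - 4 * \<beta> + w) * k"
    by (intro mult_right_mono) auto
  moreover have "e * (t - (real s - 1)) \<le> e * k"
    using k(3) e0 by (rule mult_left_mono)
  ultimately have "u powr (e * (t - (real s - 1))) \<le> Q * \<Sigma>"
    using lower powr_mono[of "e * (t - (real s - 1))" "(\<alpha> - 1 - 4 * \<beta> + w) * k" u] u(1) by linarith
  moreover have "u powr (e * (t - (real s - 1))) = u powr (e * t) / u powr ((real s - 1) * e)"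
    by (simp add: right_diff_distrib powr_diff mult.commute)
  moreover have "u powr (e * t) / exp (\<beta> / 2 * u) \<le> u powr (e * t) / u powr ((real s - 1) * e)"
    using small u(1) unfolding e_def by (intro divide_left_mono) auto
  moreover have "Q * \<Sigma> \<le> exp (\<beta> / 2 * u) * \<Sigma>"
    using Q by (intro mult_right_mono)
  ultimately have "u powr (e * t) / exp (\<beta> / 2 * u) \<le> exp (\<beta> / 2 * u) * \<Sigma>"
    by linarith
  then have "u powr (e * t) / (exp (\<beta> / 2 * u) * exp (\<beta> / 2 * u)) \<le> \<Sigma>"
    by (simp add: field_simps)
  moreover have "u powr (e * t) = exp (e * (1 - \<beta>) / \<alpha> * u)"
    using u \<alpha> by (simp add: powr_def t field_simps)
  moreover have "exp (e * (1 - \<beta>) / \<alpha> * u) / (exp (\<beta> / 2 * u) * exp (\<beta> / 2 * u)) = exp ((e * (1 - \<beta>) / \<alpha> - \<beta>) * u)"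
    by (simp add: left_diff_distrib flip: exp_add exp_diff)
  moreover have "real d + 1 - 1 / \<alpha> - \<eta> \<le> e * (1 - \<beta>) / \<alpha> - \<beta>"
  proof -
    have e\<alpha>: "e / \<alpha> = real d + 1 - 1 / \<alpha> - (real d + 6) * \<beta> / \<alpha>"
      using \<alpha> by (simp add: e_def field_simps)
    have "(real d + 6) * \<beta> / \<alpha> \<le> (real d + 6) * \<beta> / 1"
      using \<alpha> \<beta>(1) by (intro divide_left_mono) auto
    moreover have "0 \<le> (real d + 6) * \<beta> / \<alpha>"
      using \<alpha> \<beta>(1) by simp
    moreover have "0 \<le> 1 / \<alpha>"
      using \<alpha> by simp
    then have "e / \<alpha> * \<beta> \<le> (real d + 1) * \<beta>"
      using e\<alpha> \<beta>(1) \<open>0 \<le> (real d + 6) * \<beta> / \<alpha>\<close> by (intro mult_right_mono) linarith+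
    moreover have "e * (1 - \<beta>) / \<alpha> = e / \<alpha> - e / \<alpha> * \<beta>"
      by (simp add: right_diff_distrib diff_divide_distrib)
    moreover have "(2 * real d + 8) * \<beta> = (real d + 6) * \<beta> + (real d + 1) * \<beta> + \<beta>"
      by (simp add: algebra_simps)
    ultimately show ?thesis
      using e\<alpha> \<beta>(4) by linarith
  qed
  then have "exp (u * (real d + 1 - 1 / \<alpha> - \<eta>)) \<le> exp ((e * (1 - \<beta>) / \<alpha> - \<beta>) * u)"
    using u(1) by (simp add: mult.commute)
  ultimately show ?thesis
    by (metis order.trans)
qed

lemma sum_L_count_ge_exp:
  fixes d :: nat and \<alpha> \<eta> :: real
  assumes d: "d > 0" "cyclic_on \<sigma> {1..d}" and \<alpha>: "\<alpha> > 1" and \<eta>: "\<eta> > 0"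
    and many: "\<And>\<gamma>. \<gamma> > 0 \<Longrightarrow> \<forall>\<^sub>F u in at_top. u powr (\<alpha> - \<gamma>) \<le> card (prime_set \<alpha> (Polynomial.monom 1 d - 1) (exp u))"
  shows "\<forall>\<^sub>F u in at_top. exp (u * (real d + 1 - 1 / \<alpha> - \<eta>))
    \<le> real (\<Sum>n | 1 < n \<and> odd n \<and> \<not> prime n \<and> real n < exp u. L_count d \<sigma> n)"
proof -
  obtain r s :: nat where r: "prime r" "odd r" and s: "prime s" "odd s" and rs: "[r ^ d = 1] (mod s)"
      and order: "\<forall>i\<in>{1..<d}. [r ^ i \<noteq> 1] (mod s)"
    using ex_prime_order[OF d(1)] by blast
  have s3: "s \<ge> 3"
    using s prime_ge_2_nat[OF s(1)] by (cases "s = 2") auto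
  have r3: "r \<ge> 3"
    using r prime_ge_2_nat[OF r(1)] by (cases "r = 2") auto
  \<comment> \<open>The unit in which all losses in the exponent are measured; the last bound keeps
    their total (2 d + 8) \<beta> below \<eta>.\<close>
  define \<beta> where "\<beta> = min (1 / 2) (min ((\<alpha> - 1) / (real d + 6)) (\<eta> / (2 * real d + 8)))"
  have \<beta>: "0 < \<beta>" "\<beta> \<le> 1 / 2" "(real d + 6) * \<beta> \<le> \<alpha> - 1" "(2 * real d + 8) * \<beta> \<le> \<eta>"
  proof -
    show "0 < \<beta>"
      using \<alpha> \<eta> by (simp add: \<beta>_def add_nonneg_pos)
    show "\<beta> \<le> 1 / 2"
      unfolding \<beta>_def by (rule min.cobounded1)
    have "\<beta> \<le> (\<alpha> - 1) / (real d + 6)" "\<beta> \<le> \<eta> / (2 * real d + 8)"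
      by (auto simp: \<beta>_def)
    then show "(real d + 6) * \<beta> \<le> \<alpha> - 1" "(2 * real d + 8) * \<beta> \<le> \<eta>"
      by (simp_all add: pos_le_divide_eq add_nonneg_pos mult.commute)
  qed
  have "7 * \<beta> \<le> (real d + 6) * \<beta>"
    using \<beta>(1) d(1) by (intro mult_right_mono) auto
  then have \<beta>\<alpha>: "7 * \<beta> \<le> \<alpha> - 1"
    using \<beta>(3) by linarith
  obtain J :: nat where J: "\<alpha> * d / \<beta> < J"
    using reals_Archimedean2 by blast
  have "0 < \<alpha> * d / \<beta>"
    using \<alpha> d(1) \<beta>(1) by simp
  then have J0: "J > 0"
    using J by (simp add: zero_less_iff_neq_zero)
  have J\<beta>: "\<alpha> * d \<le> \<beta> * J"
    using J \<beta>(1) by (simp add: field_simps)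
  \<comment> \<open>d^J controls the pigeonhole loss; the other two bounds keep the primes of
    \<open>M\<close> above 4 s + 1 and different from \<open>r\<close>.\<close>
  define z where "z = max (d ^ J) (max (4 * s + 1) r)"
  define \<gamma> where "\<gamma> = \<beta> / z"
  have z: "d ^ J \<le> z" "4 * s + 1 \<le> z" "r \<le> z"
    by (auto simp: z_def)
  have z1: "real z \<ge> 1"
    using z(2) by linarith
  have \<gamma>: "0 < \<gamma>" "\<gamma> \<le> \<beta>" "\<gamma> * z = \<beta>"
    using \<beta>(1) z1 by (auto simp: \<gamma>_def divide_le_eq)
  \<comment> \<open>The bound for the cofactor raises \<open>M\<close> to a power of order s^2; this
    \<delta> brings it down to exp(\<beta> u / 2).\<close>
  define \<delta> where "\<delta> = \<beta> / (4 * (real s + 1) ^ 2)"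
  have \<delta>: "\<delta> > 0" "2 * (real s + 1) ^ 2 * \<delta> = \<beta> / 2"
  proof -
    have "(real s + 1) ^ 2 > 0"
      by simp
    then show "\<delta> > 0" "2 * (real s + 1) ^ 2 * \<delta> = \<beta> / 2"
      using \<beta>(1) by (auto simp: \<delta>_def field_simps)
  qed
  define e where "e = (real s - 1) * (\<alpha> * (real d + 1) - 1 - (real d + 6) * \<beta>)"
  define C where "C = real z ^ (2 * d + 1)"
  have C: "C > 0"
    using z1 by (simp add: C_def)
  have e: "e > 0"
  proof -
    have "\<alpha> * d > 0"
      using \<alpha> d(1) by simp
    then have "\<alpha> * (real d + 1) - 1 - (real d + 6) * \<beta> > 0"
      using \<beta>(3) unfolding distrib_left[of \<alpha>] by linarith
    then show ?thesis
      using s3 by (simp add: e_def)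
  qed
  define F where "F = Polynomial.monom (1 :: int) d - 1"
  have "\<forall>\<^sub>F u in at_top. u powr (\<alpha> - \<gamma> / 2) \<le> card (prime_set \<alpha> F (exp u))"
    unfolding F_def using \<gamma>(1) by (intro many) simp
  moreover have "\<forall>\<^sub>F u in at_top. u powr (\<alpha> - \<gamma>) + C * ((u powr \<alpha> + 1) / u powr \<gamma> + 1) \<le> u powr (\<alpha> - \<gamma> / 2) / 2"
    using \<gamma>(1) C \<alpha> \<gamma>(2) \<beta>\<alpha> \<beta>(1) by real_asymp
  moreover have "\<forall>\<^sub>F u in at_top. 2 * real s * u powr \<beta> * u powr (\<alpha> - 3 * \<beta>) \<le> u powr (\<alpha> - \<gamma> / 2)"
    using \<beta>(1) s3 \<gamma> by real_asymp
  moreover have "\<forall>\<^sub>F u in at_top. real s * u < u powr (\<alpha> - \<gamma>) \<and> real r < u powr (\<alpha> - \<gamma>)"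
  proof (intro eventually_conj)
    have "\<alpha> - \<gamma> > 1" "real s > 0"
      using \<gamma>(2) \<beta>\<alpha> \<beta>(1) s3 by auto
    then show "\<forall>\<^sub>F u in at_top. real s * u < u powr (\<alpha> - \<gamma>)" "\<forall>\<^sub>F u in at_top. real r < u powr (\<alpha> - \<gamma>)"
      by real_asymp+
  qed
  moreover have "\<forall>\<^sub>F u in at_top. 4 * real d \<le> u powr \<beta> \<and> 4 * real d * u powr \<beta> \<le> u powr (\<alpha> - \<gamma>)"
  proof (intro eventually_conj)
    have "\<alpha> - \<gamma> > \<beta>" "real d > 0"
      using \<gamma>(2) \<beta>\<alpha> \<beta>(1) d(1) by auto
    then show "\<forall>\<^sub>F u in at_top. 4 * real d \<le> u powr \<beta>" "\<forall>\<^sub>F u in at_top. 4 * real d * u powr \<beta> \<le> u powr (\<alpha> - \<gamma>)"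
      using \<beta>(1) by real_asymp+
  qed
  moreover have "\<forall>\<^sub>F u in at_top. real s \<le> (1 - \<beta>) * u / (\<alpha> * ln u) \<and> 1 \<le> ln u \<and> 1 \<le> u"
  proof (intro eventually_conj)
    have "1 - \<beta> > 0"
      using \<beta>(2) by linarith
    then show "\<forall>\<^sub>F u in at_top. real s \<le> (1 - \<beta>) * u / (\<alpha> * ln u)"
      using \<alpha> by real_asymp
  qed real_asymp+
  moreover have "\<forall>\<^sub>F u in at_top. real (lcm_upto (exp u)) \<le> exp (\<delta> * u)"
    by (rule lcm_upto_le_exp[OF \<delta>(1)])
  moreover have "\<forall>\<^sub>F u in at_top. 2 * real s * real r * (real s * u + 1) \<le> exp (\<delta> * u) \<and> real s \<le> exp (\<delta> * u)"
  proof (intro eventually_conj)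
    have "real s > 0" "real r > 0"
      using s3 r3 by auto
    then show "\<forall>\<^sub>F u in at_top. 2 * real s * real r * (real s * u + 1) \<le> exp (\<delta> * u)"
        "\<forall>\<^sub>F u in at_top. real s \<le> exp (\<delta> * u)"
      using \<delta>(1) by real_asymp+
  qed
  moreover have "\<forall>\<^sub>F u in at_top. real r < exp (\<beta> / 2 * u) \<and> u powr e \<le> exp (\<beta> / 2 * u)"
    by (intro eventually_conj) (use \<beta>(1) e in real_asymp)+
  ultimately show ?thesis
  proof eventually_elim
    case (elim u)
    have u: "u \<ge> 1" "ln u \<ge> 1"
      using elim by auto
    have "0 < ln u"
      using u by linarith
    then have u1: "u > 1"
      using u by simp
    define P where "P = prime_set \<alpha> F (exp u)"
    have P: "prime p" "real p < u powr \<alpha>" "p ^ d - 1 dvd lcm_upto (exp u)" if "p \<in> P" for p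
    proof -
      show p: "prime p" "real p < u powr \<alpha>"
        using that by (auto simp: P_def prime_set_def)
      have "int p ^ d - 1 dvd int (lcm_upto (exp u))"
        using that by (simp add: P_def prime_set_def F_def poly_monom)
      moreover have "int p ^ d - 1 = int (p ^ d - 1)"
        using prime_gt_0_nat[OF p(1)] by (simp add: of_nat_diff Suc_le_eq)
      ultimately show "p ^ d - 1 dvd lcm_upto (exp u)"
        by (simp only: int_dvd_int_iff)
    qed
    define h where "h p = rough_part z (p ^ d - 1)" for p
    obtain S a c where S: "S \<subseteq> P" "u powr (\<alpha> - 3 * \<beta>) \<le> card S"
      and Sp: "\<And>p. p \<in> S \<Longrightarrow> u powr (\<alpha> - \<gamma>) < p \<and> [p = a] (mod s) \<and> [c = p] (mod h p) \<and> real p ^ d - 1 \<le> u powr \<beta> * h p"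
    proof -
      have "finite P"
        unfolding P_def by (rule finite_prime_set)
      then have "\<exists>S a c. S \<subseteq> P \<and> u powr (\<alpha> - 3 * \<beta>) \<le> card S \<and> (\<forall>p\<in>S. u powr (\<alpha> - \<gamma>) < p \<and> [p = a] (mod s) \<and>
          [c = p] (mod rough_part z (p ^ d - 1)) \<and> real p ^ d - 1 \<le> u powr \<beta> * rough_part z (p ^ d - 1))"
        using elim P(1,2) s3 by (intro ex_compatible_primes[OF d(1) _ u(1) \<gamma>(1,3) J0 z(1) J\<beta>]) (auto simp: P_def C_def)
      then show ?thesis
        unfolding h_def[symmetric] using that by blast
    qed
    have finS: "finite S"
      using S(1) finite_prime_set finite_subset unfolding P_def by blast
    have SP: "prime p" "real p < u powr \<alpha>" "p ^ d - 1 dvd lcm_upto (exp u)" if "p \<in> S" for p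
      using P that S(1) by blast+
    have h: "h p > 0" "h p dvd p ^ d - 1" "\<And>l. prime l \<Longrightarrow> l dvd h p \<Longrightarrow> l > z" if "p \<in> S" for p
    proof -
      have "p ^ d > 1"
        using prime_gt_1_nat[OF SP(1)[OF that]] d(1) by (rule one_less_power)
      then show "h p dvd p ^ d - 1"
        unfolding h_def by (intro rough_part_dvd) simp
    qed (auto simp: h_def rough_part_pos dest: prime_dvd_rough_part)
    define M where "M = Lcm (h ` S)"
    have M_dvd: "M dvd lcm_upto (exp u)"
      unfolding M_def using h(2) SP(3) dvd_trans by (intro Lcm_least) blast
    have M0: "M > 0"
      using M_dvd lcm_upto_pos by (metis dvd_0_left_iff gr0I less_irrefl)
    have M_le: "real M \<le> exp (\<delta> * u)"
      using dvd_imp_le[OF M_dvd lcm_upto_pos] elim by linarith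
    have M_prime: "\<exists>p\<in>S. l dvd h p" if "prime l" "l dvd M" for l
      using prime_dvd_Lcm_finite[of "h ` S" l] that finS by (auto simp: M_def)
    \<comment> \<open>The number of factors up to u^\<alpha> whose product stays below exp((1 -
      \<beta>) u), leaving exp(\<beta> u) for \<open>r\<close> and the cofactor. Rounding down to a
      multiple of s - 1, which is even, gives \<open>k\<close>.\<close>
    define t where "t = (1 - \<beta>) * u / (\<alpha> * ln u)"
    define k where "k = (s - 1) * nat \<lfloor>t / (real s - 1)\<rfloor>"
    have t: "real s \<le> t" "t \<le> u"
    proof -
      show "real s \<le> t"
        using elim by (simp add: t_def)
      have "1 * 1 \<le> \<alpha> * ln u"
        using \<alpha> u by (intro mult_mono) auto
      then have "t \<le> (1 - \<beta>) * u / 1"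
        unfolding t_def using \<beta> u by (intro divide_left_mono) auto
      also have "\<dots> \<le> 1 * u"
        using \<beta>(1) u by simp
      finally show "t \<le> u"
        by simp
    qed
    have k: "1 \<le> real k" "real k \<le> t" "t - (real s - 1) \<le> k"
    proof -
      define v where "v = t / (real s - 1)"
      have v: "1 \<le> v" "t = (real s - 1) * v"
        using t(1) s3 by (auto simp: v_def)
      have "real (nat \<lfloor>v\<rfloor>) = real_of_int \<lfloor>v\<rfloor>"
        using v(1) by simp
      then have fl: "1 \<le> real (nat \<lfloor>v\<rfloor>)" "real (nat \<lfloor>v\<rfloor>) \<le> v" "v - 1 \<le> real (nat \<lfloor>v\<rfloor>)"
        using v(1) le_floor_iff[of 1 v] by linarith+
      have rk: "real k = (real s - 1) * real (nat \<lfloor>v\<rfloor>)"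
        using s3 by (simp add: k_def v_def of_nat_diff)
      have "1 * 1 \<le> (real s - 1) * real (nat \<lfloor>v\<rfloor>)"
        using s3 fl(1) by (intro mult_mono) auto
      then show "1 \<le> real k"
        using rk by simp
      show "real k \<le> t"
        unfolding rk v(2) using s3 fl(2) by (intro mult_left_mono) auto
      have "(real s - 1) * (v - 1) \<le> real k"
        unfolding rk using s3 fl(3) by (intro mult_left_mono) auto
      then show "t - (real s - 1) \<le> k"
        unfolding v(2) by (simp add: right_diff_distrib)
    qed
    define G where "G = nat \<lfloor>u powr ((\<alpha> - \<gamma>) * d - 2 * \<beta>)\<rfloor>"
    define Y where "Y = nat \<lfloor>u powr \<alpha>\<rfloor>"
    define X where "X = nat \<lceil>exp u\<rceil>"
    define Q where "Q = (s * (2 * s * r * M * (s * k + 1)) ^ s) ^ Suc s"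
    have Q: "real Q \<le> exp (\<beta> / 2 * u)"
      unfolding Q_def \<delta>(2)[symmetric] using elim M_le k(2) t(2) u(1) \<delta>(1) by (intro cofactor_bound_le_exp) auto
    have less_X: "n < X \<longleftrightarrow> real n < exp u" for n
      unfolding X_def by (simp add: zless_nat_eq_int_zless less_ceiling_iff)
    have "(card S choose k) * G ^ k \<le> Q * (\<Sum>n | 1 < n \<and> odd n \<and> \<not> prime n \<and> n < X. L_count d \<sigma> n)"
    proof (rule sum_L_count_ge[OF d r s rs _ M0])
      show "[r ^ i \<noteq> 1] (mod s)" if "i \<in> {1..<d}" for i
        using order that by blast
      show "l > 4 * s + 1 \<and> l \<noteq> r" if l: "prime l" "l dvd M" for l
      proof -
        have "l > z"
          using M_prime[OF l] h(3) l(1) by blast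
        then show ?thesis
          using z(2,3) by linarith
      qed
      \<comment> \<open>A common prime l divides some \<open>h p\<close>, where c is congruent to p;
        then l would divide both p and p^d - 1.\<close>
      show "coprime c M"
      proof (rule ccontr)
        assume "\<not> coprime c M"
        then obtain w where "w dvd c" "w dvd M" "\<not> is_unit w"
          by (meson Rings.coprimeI)
        then obtain l where l: "prime l" "l dvd c" "l dvd M"
          by (metis dvd_trans nat_dvd_1_iff_1 prime_factor_nat)
        then obtain p where p: "p \<in> S" "l dvd h p"
          using M_prime by blast
        then have "[c = p] (mod l)"
          using Sp cong_dvd_modulus_nat by blast
        then have "l dvd p"
          using l(2) cong_dvd_iff by blast
        then have "l dvd p ^ d"
          using d(1) by (intro dvd_trans[OF _ dvd_power]) auto
        moreover have "l dvd p ^ d - 1"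
          using p h(2) dvd_trans by blast
        moreover have "p ^ d \<ge> 1"
          using prime_gt_0_nat[OF SP(1)[OF p(1)]] by (simp add: Suc_le_eq)
        ultimately have "l dvd 1"
          by (metis dvd_diffD1)
        then show False
          using l(1) not_prime_unit by blast
      qed
      show "even k" "s - 1 dvd k"
        using s(2) by (auto simp: k_def)
      show "k > 0"
        using k(1) by simp
      show "finite S"
        by (rule finS)
      show "Q = (s * (2 * s * r * M * (s * k + 1)) ^ s) ^ Suc s"
        by (rule Q_def)
      show "prime p \<and> odd p \<and> p > s * k \<and> p \<noteq> r \<and> \<not> p dvd M \<and> p \<le> Y" if p: "p \<in> S" for p
      proof (intro conjI)
        have big: "u powr (\<alpha> - \<gamma>) < p"
          using Sp[OF p] by blast
        then have "r < p"
          using elim by linarith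
        then show "p \<noteq> r" "odd p"
          using prime_odd_nat[OF SP(1)[OF p]] r3 by auto
        have "real s * real k \<le> real s * u"
          using k(2) t(2) by (intro mult_left_mono) auto
        then have "real (s * k) < real p"
          using big elim by simp
        then show "p > s * k"
          by (simp only: of_nat_less_iff)
        \<comment> \<open>Prime divisors of M(x) are at most u / ln u, well below p.\<close>
        show "\<not> p dvd M"
        proof
          assume "p dvd M"
          then have "p dvd lcm_upto (exp u)"
            using M_dvd dvd_trans by blast
          then have "real p \<le> u / ln u"
            using prime_dvd_lcm_upto_imp_le[OF SP(1)[OF p], of "exp u"] by simp
          also have "\<dots> \<le> u / 1"
            using u u1 by (intro divide_left_mono) auto
          also have "\<dots> \<le> real s * u"
            using s3 u by simp
          finally show False
            using big elim by linarith
        qed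
        show "p \<le> Y"
          unfolding Y_def using SP(2)[OF p] by (intro le_nat_floor) simp
      qed (rule SP(1)[OF p])
      show "[p = a] (mod s) \<and> [c = p] (mod h p)" if "p \<in> S" for p
        using Sp[OF that] by blast
      show "h p > 0 \<and> h p dvd M \<and> h p dvd p ^ d - 1 \<and> d * G + d * p ^ (d - 1) \<le> h p" if p: "p \<in> S" for p
      proof (intro conjI)
        show "h p dvd M"
          unfolding M_def using p by (intro dvd_Lcm) simp
        show "d * G + d * p ^ (d - 1) \<le> h p"
          using Sp[OF p] elim unfolding G_def
          by (intro rough_part_minus_small_orders[OF d(1) u(1), of \<beta> \<alpha> \<gamma> p]) auto
      qed (use h(1,2)[OF p] in auto)
      have "real (r * Y ^ k * Q) = real r * real Y ^ k * real Q"
        by simp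
      also have "\<dots> < exp (\<beta> / 2 * u) * exp ((1 - \<beta>) * u) * exp (\<beta> / 2 * u)"
      proof -
        have "real Y ^ k \<le> (u powr \<alpha>) ^ k"
          unfolding Y_def by (intro power_mono of_nat_floor) auto
        also have "\<dots> = u powr (\<alpha> * k)"
          using u(1) by (simp add: powr_powr flip: powr_realpow)
        also have "\<dots> \<le> u powr (\<alpha> * t)"
          using u(1) k(2) \<alpha> by (intro powr_mono mult_left_mono) auto
        also have "\<dots> = exp ((1 - \<beta>) * u)"
          using u1 \<alpha> by (simp add: powr_def t_def)
        finally have Yk: "real Y ^ k \<le> exp ((1 - \<beta>) * u)" .
        have "real r * real Y ^ k * real Q \<le> real r * exp ((1 - \<beta>) * u) * exp (\<beta> / 2 * u)"
          using Yk Q by (intro mult_mono) auto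
        also have "\<dots> < exp (\<beta> / 2 * u) * exp ((1 - \<beta>) * u) * exp (\<beta> / 2 * u)"
          using elim by simp
        finally show ?thesis .
      qed
      also have "\<dots> = exp u"
        by (simp add: algebra_simps flip: exp_add)
      finally show "r * Y ^ k * Q < X"
        by (simp only: less_X)
    qed
    then have main: "real ((card S choose k) * G ^ k) \<le> real Q * real (\<Sum>n | 1 < n \<and> odd n \<and> \<not> prime n \<and> real n < exp u. L_count d \<sigma> n)"
      unfolding less_X by (simp only: of_nat_le_iff flip: of_nat_mult)
    have "2 \<le> u powr \<beta>"
    proof -
      have "4 * 1 \<le> 4 * real d"
        using d(1) by simp
      then show ?thesis
        using elim by linarith
    qed
    show ?case
    proof (rule count_exponent_bound[OF \<alpha> \<beta> \<gamma>(1,2) u(1) \<open>0 < ln u\<close> \<open>2 \<le> u powr \<beta>\<close> _ d(1) t_def _ _ k(3) S(2) G_def _ Q])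
      show "1 \<le> k" "real k \<le> u" "1 \<le> s"
        using k(1,2) t(2) s3 by linarith+
      show "u powr ((real s - 1) * (\<alpha> * (real d + 1) - 1 - (real d + 6) * \<beta>)) \<le> exp (\<beta> / 2 * u)"
        using elim by (simp add: e_def)
    qed (rule of_nat_0_le_iff main)+
  qed
qed

text \<open>The actual deficit in the exponent, truncated at 0, is eventually below every fixed
  \<eta>, so it is a single error term tending to 0.\<close>

lemma ex_error_term:
  fixes f :: "real \<Rightarrow> real"
  assumes "\<And>\<eta>. \<eta> > 0 \<Longrightarrow> \<forall>\<^sub>F x in at_top. x powr (E - \<eta>) \<le> f x"
  shows "\<exists>\<delta>. (\<delta> \<longlongrightarrow> 0) at_top \<and> (\<forall>\<^sub>F x in at_top. x powr (E - \<delta> x) \<le> f x)"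
proof (intro exI conjI)
  define \<delta> where "\<delta> x = max 0 (E - ln (f x) / ln x)" for x
  show "(\<delta> \<longlongrightarrow> 0) at_top"
  proof (rule tendstoI)
    fix \<eta> :: real assume "\<eta> > 0"
    then have "\<forall>\<^sub>F x in at_top. x powr (E - \<eta> / 2) \<le> f x"
      by (intro assms) simp
    then show "\<forall>\<^sub>F x in at_top. dist (\<delta> x) 0 < \<eta>"
      using eventually_gt_at_top[of 1]
    proof eventually_elim
      case (elim x)
      have "ln (x powr (E - \<eta> / 2)) \<le> ln (f x)"
        using elim by (intro ln_mono) auto
      then have "E - \<eta> / 2 \<le> ln (f x) / ln x"
        using elim by (simp add: ln_powr pos_le_divide_eq)
      then show ?case
        using \<open>\<eta> > 0\<close> by (simp add: \<delta>_def dist_real_def)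
    qed
  qed
  show "\<forall>\<^sub>F x in at_top. x powr (E - \<delta> x) \<le> f x"
    using assms[of 1, simplified] eventually_gt_at_top[of 1]
  proof eventually_elim
    case (elim x)
    then have "0 < x powr (E - 1)"
      by simp
    then have "f x > 0"
      using elim(1) by linarith
    have "E - \<delta> x \<le> ln (f x) / ln x"
      by (simp add: \<delta>_def)
    then have "x powr (E - \<delta> x) \<le> x powr (ln (f x) / ln x)"
      using elim by (intro powr_mono) auto
    also have "\<dots> = f x"
      using elim \<open>f x > 0\<close> by (simp add: powr_def)
    finally show ?case .
  qed
qed

theorem theorem4p12:
  fixes d :: nat and \<sigma> :: "nat \<Rightarrow> nat" and F :: "int poly" and \<alpha> :: real
  assumes "d \<ge> 1"
    and "\<sigma> permutes {1..d}" and "cyclic_on \<sigma> {1..d}"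
    and "F = Polynomial.monom 1 d - 1"
    and "\<alpha> > 1"
    and "\<exists>\<epsilon> :: real \<Rightarrow> real. (\<epsilon> \<longlongrightarrow> 0) at_top \<and>
           (\<forall>\<^sub>F x in at_top. real (card (prime_set \<alpha> F x)) \<ge> ln x powr (\<alpha> - \<epsilon> x))"
  shows "\<exists>\<delta> :: real \<Rightarrow> real. (\<delta> \<longlongrightarrow> 0) at_top \<and>
           (\<forall>\<^sub>F x in at_top.
              real (\<Sum>n | n > 1 \<and> odd n \<and> \<not> prime n \<and> real n < x. L_count d \<sigma> n)
                \<ge> x powr (real d + 1 - 1 / \<alpha> - \<delta> x))"
proof (rule ex_error_term)
  obtain \<epsilon> where \<epsilon>: "(\<epsilon> \<longlongrightarrow> 0) at_top"
      and many: "\<forall>\<^sub>F x in at_top. ln x powr (\<alpha> - \<epsilon> x) \<le> real (card (prime_set \<alpha> F x))"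
    using assms(6) by blast
  have dense: "\<forall>\<^sub>F u in at_top. u powr (\<alpha> - \<gamma>) \<le> card (prime_set \<alpha> (Polynomial.monom 1 d - 1) (exp u))"
    if "\<gamma> > 0" for \<gamma>
  proof -
    have "\<forall>\<^sub>F x in at_top. \<epsilon> x < \<gamma>"
      using \<epsilon> that by (rule order_tendstoD)
    then have "\<forall>\<^sub>F x in at_top. ln x powr (\<alpha> - \<gamma>) \<le> real (card (prime_set \<alpha> F x))"
      using many eventually_ge_at_top[of "exp 1"]
    proof eventually_elim
      case (elim x)
      then have "ln (exp 1) \<le> ln x"
        by (intro ln_mono) (auto intro: less_le_trans[OF exp_gt_zero])
      then have "ln x powr (\<alpha> - \<gamma>) \<le> ln x powr (\<alpha> - \<epsilon> x)"
        using elim by (intro powr_mono) auto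
      then show ?case
        using elim by linarith
    qed
    then have "\<forall>\<^sub>F u in at_top. ln (exp u) powr (\<alpha> - \<gamma>) \<le> real (card (prime_set \<alpha> F (exp u)))"
      by (rule eventually_compose_filterlim[OF _ exp_at_top])
    then show ?thesis
      by (simp add: assms(4))
  qed
  fix \<eta> :: real assume "\<eta> > 0"
  then have "\<forall>\<^sub>F u in at_top. exp (u * (real d + 1 - 1 / \<alpha> - \<eta>)) \<le>
      real (\<Sum>n | 1 < n \<and> odd n \<and> \<not> prime n \<and> real n < exp u. L_count d \<sigma> n)"
    using assms(1) dense by (intro sum_L_count_ge_exp assms) auto
  then have "\<forall>\<^sub>F x in at_top. exp (ln x * (real d + 1 - 1 / \<alpha> - \<eta>)) \<le>
      real (\<Sum>n | 1 < n \<and> odd n \<and> \<not> prime n \<and> real n < exp (ln x). L_count d \<sigma> n)"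
    by (rule eventually_compose_filterlim[OF _ ln_at_top])
  then show "\<forall>\<^sub>F x in at_top. x powr (real d + 1 - 1 / \<alpha> - \<eta>) \<le>
      real (\<Sum>n | n > 1 \<and> odd n \<and> \<not> prime n \<and> real n < x. L_count d \<sigma> n)"
    using eventually_gt_at_top[of 0]
  proof eventually_elim
    case (elim x)
    then show ?case
      by (simp add: powr_def mult.commute)
  qed
qed

end
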